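(* Let $N\ge 2$ and $k\ge 1$ be integers. There exists a constant $M=M(k,N)$, depending only on $k$ and $N$, such that for every quasi-open set $A\subseteq\mathbb R^N$ one has $$\lambda_k(A)\le M\,\lambda_1(A).$$
   Context: Capacity: if $\Omega\subseteq\mathbb R^N$ is open and $V\subset\subset\Omega$, then $\mathrm{cap}_\Omega(V)=\inf\{\int_\Omega|D\varphi|^2\}$, the infimum being over $\varphi\in W^{1,2}_0(\Omega)$ with $\varphi\ge 1$ a.e. in a neighbourhood of $V$. A bounded set $A\subseteq\mathbb R^N$ is quasi-open if, given an open set $\Omega$ with $A\subset\subset\Omega$, for every $\varepsilon>0$ there is an open set $\Omega_\varepsilon$ with $A\subseteq\Omega_\varepsilon\subset\subset\Omega$ and $\mathrm{cap}_\Omega(\Omega_\varepsilon\setminus A)<\varepsilon$ (this does not depend on the choice of $\Omega$). A generic set $A\subseteq\mathbb R^N$ is quasi-open if its intersection with every ball is a bounded quasi-open set. A property holds quasi-everywhere (q.e.) if it holds outside a set of zero capacity. For a quasi-open set $A$, $W^{1,2}_0(A)$ is the space of $u\in W^{1,2}(\mathbb R^N)$ whose quasi-continuous representative vanishes q.e. outside $A$ (the usual space if $A$ is open), and $\lambda_1(A)\le\lambda_2(A)\le\cdots$ are the eigenvalues of the Dirichlet Laplacian on $A$, counted with multiplicity, given by $$\lambda_j(A)=\inf_{K_j}\ \max_{w\in K_j\setminus\{0\}}\frac{\int_A|Dw|^2}{\int_A w^2},$$ where $K_j$ ranges over the $j$-dimensional subspaces of $W^{1,2}_0(A)$ (the infimum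 is a minimum if $A$ has finite measure; $\lambda_j(A)=+\infty$ if there are no such subspaces). *)

theory Defs
  imports "HOL-Analysis.Analysis"
begin

definition compactly_contained :: "'a::euclidean_space set \<Rightarrow> 'a set \<Rightarrow> bool" where
  "compactly_contained V \<Omega> \<longleftrightarrow> compact (closure V) \<and> closure V \<subseteq> \<Omega>"

definition partial_derivative :: "'a::euclidean_space \<Rightarrow> ('a \<Rightarrow> real) \<Rightarrow> 'a \<Rightarrow> real" where
  "partial_derivative b f x = frechet_derivative f (at x) b"

primrec continuously_differentiable :: "nat \<Rightarrow> ('a::euclidean_space \<Rightarrow> real) \<Rightarrow> bool" where
  "continuously_differentiable 0 f \<longleftrightarrow> continuous_on UNIV f"
| "continuously_differentiable (Suc m) f \<longleftrightarrow>
     (\<forall>x. f differentiable (at x)) \<and>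
     (\<forall>b\<in>Basis. continuously_differentiable m (partial_derivative b f))"

definition test_function :: "'a::euclidean_space set \<Rightarrow> ('a \<Rightarrow> real) \<Rightarrow> bool" where
  "test_function \<Omega> \<phi> \<longleftrightarrow>
     (\<forall>m. continuously_differentiable m \<phi>) \<and> compactly_contained {x. \<phi> x \<noteq> 0} \<Omega>"

text \<open>Elements of Lebesgue and Sobolev spaces on an open set \<Omega> are represented by functions
  on the whole space whose values outside \<Omega> are irrelevant; two functions represent the same
  element iff they agree almost everywhere on \<Omega>.  The measure is the completed Lebesgue
  measure, because quasi-open sets are Lebesgue measurable but need not be Borel.\<close>

definition locally_integrable ::
    "'a::euclidean_space set \<Rightarrow> ('a \<Rightarrow> 'b::euclidean_space) \<Rightarrow> bool" where
  "locally_integrable \<Omega> f \<longleftrightarrow> (\<forall>C. compact C \<and> C \<subseteq> \<Omega> \<longrightarrow> set_integrable lebesgue C f)"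

definition square_integrable ::
    "'a::euclidean_space set \<Rightarrow> ('a \<Rightarrow> 'b::euclidean_space) \<Rightarrow> bool" where
  "square_integrable \<Omega> f \<longleftrightarrow>
     set_borel_measurable lebesgue \<Omega> f \<and> set_integrable lebesgue \<Omega> (\<lambda>x. (norm (f x))\<^sup>2)"

definition has_weak_gradient ::
    "'a::euclidean_space set \<Rightarrow> ('a \<Rightarrow> real) \<Rightarrow> ('a \<Rightarrow> 'a) \<Rightarrow> bool" where
  "has_weak_gradient \<Omega> u G \<longleftrightarrow>
     locally_integrable \<Omega> u \<and> locally_integrable \<Omega> G \<and>
     (\<forall>\<phi>. test_function \<Omega> \<phi> \<longrightarrow>
        (\<forall>b\<in>Basis. set_lebesgue_integral lebesgue \<Omega> (\<lambda>x. u x * partial_derivative b \<phi> x)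
                 = - set_lebesgue_integral lebesgue \<Omega> (\<lambda>x. (G x \<bullet> b) * \<phi> x)))"

text \<open>The weak gradient is unique up to null subsets of \<Omega>; the choice fixes a representative.\<close>

definition weak_gradient :: "'a::euclidean_space set \<Rightarrow> ('a \<Rightarrow> real) \<Rightarrow> 'a \<Rightarrow> 'a" where
  "weak_gradient \<Omega> u = (SOME G. has_weak_gradient \<Omega> u G)"

definition W12 :: "'a::euclidean_space set \<Rightarrow> ('a \<Rightarrow> real) set" where
  "W12 \<Omega> = {u. square_integrable \<Omega> u \<and>
               (\<exists>G. has_weak_gradient \<Omega> u G \<and> square_integrable \<Omega> G)}"

definition W12_norm :: "'a::euclidean_space set \<Rightarrow> ('a \<Rightarrow> real) \<Rightarrow> real" where
  "W12_norm \<Omega> u = sqrt (set_lebesgue_integral lebesgue \<Omega> (\<lambda>x. (u x)\<^sup>2) +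
                        set_lebesgue_integral lebesgue \<Omega> (\<lambda>x. (norm (weak_gradient \<Omega> u x))\<^sup>2))"

definition W012_open :: "'a::euclidean_space set \<Rightarrow> ('a \<Rightarrow> real) set" where
  "W012_open \<Omega> = {u \<in> W12 \<Omega>. \<exists>\<phi>. (\<forall>n. test_function \<Omega> (\<phi> n)) \<and>
                                (\<lambda>n. W12_norm \<Omega> (\<lambda>x. \<phi> n x - u x)) \<longlonglongrightarrow> 0}"

definition capacity :: "'a::euclidean_space set \<Rightarrow> 'a set \<Rightarrow> ereal" where
  "capacity \<Omega> V =
     (INF \<phi> \<in> {\<phi> \<in> W012_open \<Omega>. \<exists>U. open U \<and> V \<subseteq> U \<and> U \<subseteq> \<Omega> \<and>
                                     (AE x in lebesgue. x \<in> U \<longrightarrow> 1 \<le> \<phi> x)}.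
        ereal (set_lebesgue_integral lebesgue \<Omega> (\<lambda>x. (norm (weak_gradient \<Omega> \<phi> x))\<^sup>2)))"

text \<open>In the definitions below the ambient open set \<Omega> is universally quantified.  The
  notions do not depend on \<Omega> as long as it is bounded, and the capacity decreases when \<Omega>
  grows, so this amounts to using any one bounded \<Omega>.  Asking for some \<Omega> instead would be
  wrong: in the plane every bounded set has capacity zero relative to \<Omega> = UNIV.\<close>

definition bounded_quasi_open :: "'a::euclidean_space set \<Rightarrow> bool" where
  "bounded_quasi_open A \<longleftrightarrow> bounded A \<and>
     (\<forall>\<Omega>. open \<Omega> \<and> compactly_contained A \<Omega> \<longrightarrow>
        (\<forall>\<epsilon>>0. \<exists>\<Omega>'. open \<Omega>' \<and> A \<subseteq> \<Omega>' \<and> compactly_contained \<Omega>' \<Omega> \<and>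
                    capacity \<Omega> (\<Omega>' - A) < ereal \<epsilon>))"

definition quasi_open :: "'a::euclidean_space set \<Rightarrow> bool" where
  "quasi_open A \<longleftrightarrow> (\<forall>x r. bounded_quasi_open (A \<inter> ball x r))"

definition zero_capacity :: "'a::euclidean_space set \<Rightarrow> bool" where
  "zero_capacity E \<longleftrightarrow>
     (\<forall>x r \<Omega>. open \<Omega> \<and> compactly_contained (E \<inter> ball x r) \<Omega> \<longrightarrow>
        capacity \<Omega> (E \<inter> ball x r) = 0)"

definition quasi_continuous :: "('a::euclidean_space \<Rightarrow> real) \<Rightarrow> bool" where
  "quasi_continuous u \<longleftrightarrow>
     (\<forall>x r \<Omega>. open \<Omega> \<and> compactly_contained (ball x r) \<Omega> \<longrightarrow>
        (\<forall>\<epsilon>>0. \<exists>U. open U \<and> U \<subseteq> ball x r \<and> capacity \<Omega> U < ereal \<epsilon> \<and>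
                   continuous_on (ball x r - U) u))"

text \<open>The quasi-continuous representative \<open>v\<close> of \<open>u\<close> exists and is unique up to sets of
  zero capacity.\<close>

definition W012 :: "'a::euclidean_space set \<Rightarrow> ('a \<Rightarrow> real) set" where
  "W012 A = {u \<in> W12 UNIV. \<exists>v. quasi_continuous v \<and> (AE x in lebesgue. v x = u x) \<and>
                              zero_capacity {x. x \<notin> A \<and> v x \<noteq> 0}}"

text \<open>A \<open>j\<close>-dimensional space of functions modulo almost everywhere equality, given as the
  set of all representatives of its elements.\<close>

definition ae_subspace_of_dim :: "nat \<Rightarrow> ('a::euclidean_space \<Rightarrow> real) set \<Rightarrow> bool" where
  "ae_subspace_of_dim j K \<longleftrightarrow>
     (\<exists>u::nat \<Rightarrow> 'a \<Rightarrow> real.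
        (\<forall>c::nat \<Rightarrow> real.
           (AE x in lebesgue. (\<Sum>i<j. c i * u i x) = 0) \<longrightarrow> (\<forall>i<j. c i = 0)) \<and>
        K = {w. \<exists>c::nat \<Rightarrow> real. AE x in lebesgue. w x = (\<Sum>i<j. c i * u i x)})"

definition rayleigh_quotient :: "'a::euclidean_space set \<Rightarrow> ('a \<Rightarrow> real) \<Rightarrow> real" where
  "rayleigh_quotient A w =
     set_lebesgue_integral lebesgue A (\<lambda>x. (norm (weak_gradient UNIV w x))\<^sup>2) /
     set_lebesgue_integral lebesgue A (\<lambda>x. (w x)\<^sup>2)"

text \<open>The inner supremum is a maximum because \<open>K\<close> is finite-dimensional; the outer infimum
  is \<open>\<infinity>\<close> if there is no admissible \<open>K\<close>.\<close>

definition dirichlet_eigenvalue :: "nat \<Rightarrow> 'a::euclidean_space set \<Rightarrow> ereal" where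
  "dirichlet_eigenvalue j A =
     (INF K \<in> {K. ae_subspace_of_dim j K \<and> K \<subseteq> W012 A}.
        SUP w \<in> {w \<in> K. \<not> (AE x in lebesgue. w x = 0)}. ereal (rayleigh_quotient A w))"

end

theory Submission
  imports Defs
begin

text \<open>
  No eigenfunctions are needed: from any \<open>u\<close> in \<open>W012 A\<close> whose Rayleigh quotient is below \<open>R\<close> one
  builds a \<open>k\<close>-dimensional space of functions \<open>\<zeta> * u\<close> on which the quotient is at most a constant
  times \<open>R\<close>.  The factors \<open>\<zeta>\<close> are \<open>k\<close> smooth bumps, periodic in one coordinate with
  period proportional to \<open>1 / sqrt R\<close>, with disjoint supports and all translates of each other; their
  gradients are of order \<open>sqrt R\<close>, so multiplying by them costs only a constant factor in the numerator.
  The translation estimate \<open>L2norm (u (x + h b) - u x) \<le> h * L2norm (D\<^sub>b u)\<close> shows that all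
  these bumps carry comparable parts of the mass of \<open>u\<close>, since \<open>u\<close> cannot concentrate at scales much
  smaller than \<open>1 / sqrt R\<close>.  This bounds the denominator from below.

  The set \<open>A\<close> enters the Rayleigh quotient only through the fact that \<open>u\<close> and its weak gradient
  vanish almost everywhere outside \<open>A\<close>.
\<close>

section \<open>Smooth functions\<close>

text \<open>The infimum behind \<open>dirichlet_eigenvalue 1 A\<close> need not be attained, so the
  argument runs on a function whose quotient is merely below \<open>R\<close>; strictness gives
  \<open>R > 0\<close>, which the scale 1 / sqrt R requires. Of 2k equally spaced translates of one
  bump, all together cover the space and hence capture the mass, while those of even index have
  disjoint supports; comparing each with the bump of index 0 transfers the covering bound to every
  single one. The longer part of the work comes from the definitions. Membership in
  \<open>W012 A\<close> is expressed through capacity, so two facts about sets of zero capacity are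
  required: they are Lebesgue null, and their subsets have zero capacity again. A capacity bound
  controls only the gradient of an admissible function, whereas both facts need control of the
  function itself; the Poincare inequality on balls supplies it. Weak gradients are known only
  through test functions and are handled by duality: density of test functions in \<open>L2\<close>,
  the fundamental lemma, and the mean value theorem for the integral of \<open>u\<close> against a
  translated test function.\<close>

definition smooth :: "('a::euclidean_space \<Rightarrow> real) \<Rightarrow> bool" where
  "smooth f \<longleftrightarrow> (\<forall>m. continuously_differentiable m f)"

definition gradient :: "('a::euclidean_space \<Rightarrow> real) \<Rightarrow> 'a \<Rightarrow> 'a" where
  "gradient f x = (\<Sum>b\<in>Basis. partial_derivative b f x *\<^sub>R b)"

lemma partial_derivative_eqI:
  "(f has_derivative f') (at x) \<Longrightarrow> partial_derivative b f x = f' b"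
  by (simp add: partial_derivative_def frechet_derivative_at[symmetric])

text \<open>Order 0 follows because differentiability implies continuity. The product rule needs
  this step: it leaves one factor undifferentiated, which then has to count at the lower
  order.\<close>

lemma continuously_differentiable_Suc_imp:
  "continuously_differentiable (Suc m) f \<Longrightarrow> continuously_differentiable m f"
proof (induction m arbitrary: f)
  case 0
  then show ?case
    by (auto intro!: differentiable_imp_continuous_on simp: differentiable_on_def)
next
  case (Suc m)
  then show ?case by (metis continuously_differentiable.simps(2))
qed

lemma partial_derivative_const: "partial_derivative b (\<lambda>x. c) x = 0"
  by (rule partial_derivative_eqI) (auto intro!: derivative_eq_intros)

lemma continuously_differentiable_const: "continuously_differentiable m (\<lambda>x. c)"
proof (induction m arbitrary: c)
  case (Suc m)
  have "partial_derivative b (\<lambda>x::'a. c) = (\<lambda>x. 0)" for b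
    by (simp add: fun_eq_iff partial_derivative_const)
  then show ?case using Suc by simp
qed simp

lemma partial_derivative_inner: "partial_derivative b (\<lambda>x. x \<bullet> c) x = b \<bullet> c"
  by (rule partial_derivative_eqI) (auto intro!: derivative_eq_intros)

lemma continuously_differentiable_inner: "continuously_differentiable m (\<lambda>x. x \<bullet> c)"
proof (cases m)
  case (Suc n)
  have "partial_derivative b (\<lambda>x. x \<bullet> c) = (\<lambda>x. b \<bullet> c)" for b
    by (simp add: fun_eq_iff partial_derivative_inner)
  then show ?thesis using Suc by (simp add: continuously_differentiable_const)
qed (simp add: continuous_intros)

lemma differentiable_has_derivative_partial:
  assumes "f differentiable (at x)"
  shows "(f has_derivative (\<lambda>h. partial_derivative h f x)) (at x)"
  using assms by (simp add: partial_derivative_def frechet_derivative_works)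

lemma partial_derivative_add:
  assumes "f differentiable (at x)" "g differentiable (at x)"
  shows "partial_derivative b (\<lambda>x. f x + g x) x = partial_derivative b f x + partial_derivative b g x"
  by (rule partial_derivative_eqI[OF has_derivative_add[OF assms[THEN differentiable_has_derivative_partial]]])

lemma partial_derivative_mult:
  assumes "f differentiable (at x)" "g differentiable (at x)"
  shows "partial_derivative b (\<lambda>x. f x * g x) x = f x * partial_derivative b g x + partial_derivative b f x * g x"
  by (rule partial_derivative_eqI[OF has_derivative_mult[OF assms[THEN differentiable_has_derivative_partial]]])

lemma continuously_differentiable_add:
  "continuously_differentiable m f \<Longrightarrow> continuously_differentiable m g
    \<Longrightarrow> continuously_differentiable m (\<lambda>x. f x + g x)"
proof (induction m arbitrary: f g)
  case 0
  then show ?case by (auto intro: continuous_intros)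
next
  case (Suc m)
  then have "partial_derivative b (\<lambda>x. f x + g x) = (\<lambda>x. partial_derivative b f x + partial_derivative b g x)" for b
    by (auto simp: fun_eq_iff partial_derivative_add)
  with Suc show ?case by simp
qed

lemma continuously_differentiable_mult:
  "continuously_differentiable m f \<Longrightarrow> continuously_differentiable m g
    \<Longrightarrow> continuously_differentiable m (\<lambda>x. f x * g x)"
proof (induction m arbitrary: f g)
  case 0
  then show ?case by (auto intro: continuous_intros)
next
  case (Suc m)
  then have eq: "partial_derivative b (\<lambda>x. f x * g x) = (\<lambda>x. f x * partial_derivative b g x + partial_derivative b f x * g x)" for b
    by (auto simp: fun_eq_iff partial_derivative_mult)
  have "continuously_differentiable m f" "continuously_differentiable m g"
    using Suc.prems continuously_differentiable_Suc_imp by blast+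
  then have "continuously_differentiable m (\<lambda>x. f x * partial_derivative b g x + partial_derivative b f x * g x)"
    if "b \<in> Basis" for b
    using Suc that by (intro continuously_differentiable_add Suc.IH) auto
  with Suc.prems show ?case
    by (simp add: eq)
qed

lemma has_derivative_compose_real:
  assumes "(h has_real_derivative h') (at (g x))" "g differentiable (at x)"
  shows "((\<lambda>x. h (g x)) has_derivative (\<lambda>v. h' * partial_derivative v g x)) (at x)"
proof -
  have "(h has_derivative (\<lambda>v. h' * v)) (at (g x))"
    using assms(1) by (simp add: has_field_derivative_def)
  from has_derivative_compose[OF differentiable_has_derivative_partial[OF assms(2)] this]
  show ?thesis by simp
qed

text \<open>The chain rule turns \<open>h\<close> into its derivative, which must again be smooth
  for an induction to work. A family \<open>F\<close> closed under differentiation provides this: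
  each step stays in \<open>F\<close>, up to a partial derivative of \<open>g\<close> as a
  factor.\<close>

lemma continuously_differentiable_compose:
  assumes F: "\<And>h. h \<in> F \<Longrightarrow> \<exists>h'\<in>F. \<forall>t. (h has_real_derivative h' t) (at t)"
    and "h \<in> F" and "\<forall>m. continuously_differentiable m g"
  shows "continuously_differentiable m (\<lambda>x. h (g x))"
  using \<open>h \<in> F\<close>
proof (induction m arbitrary: h)
  case 0
  then obtain h' where "\<forall>t. (h has_real_derivative h' t) (at t)" using F by blast
  then have "continuous_on UNIV h"
    using DERIV_isCont continuous_at_imp_continuous_on by blast
  moreover have "continuous_on UNIV g" using assms(3) continuously_differentiable.simps(1) by blast
  ultimately show ?case
    by (simp add: continuous_on_compose2)
next
  case (Suc m)
  then obtain h' where h': "\<forall>t. (h has_real_derivative h' t) (at t)" "h' \<in> F" using F by blast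
  have g: "g differentiable (at x)" for x using assms(3) continuously_differentiable.simps(2) by blast
  have "((\<lambda>x. h (g x)) has_derivative (\<lambda>v. h' (g x) * partial_derivative v g x)) (at x)" for x
    using h' g by (intro has_derivative_compose_real) auto
  then have "(\<lambda>x. h (g x)) differentiable (at x)"
    and "partial_derivative b (\<lambda>x. h (g x)) x = h' (g x) * partial_derivative b g x" for x b
    by (auto simp: differentiable_def intro: partial_derivative_eqI)
  moreover have "continuously_differentiable m (\<lambda>x. h' (g x) * partial_derivative b g x)"
    if "b \<in> Basis" for b
    using Suc.IH[OF h'(2)] assms(3) that
    by (intro continuously_differentiable_mult) (auto dest: spec[of _ "Suc m"])
  moreover have "partial_derivative b (\<lambda>x. h (g x)) = (\<lambda>x. h' (g x) * partial_derivative b g x)" for b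
    using calculation(2) by blast
  ultimately show ?case by simp
qed

lemma smooth_const [intro, simp]: "smooth (\<lambda>x. d)"
  and smooth_inner [intro, simp]: "smooth (\<lambda>x::'a::euclidean_space. x \<bullet> c)"
  and smooth_add [intro]: "smooth f \<Longrightarrow> smooth g \<Longrightarrow> smooth (\<lambda>x. f x + g x)"
  and smooth_mult [intro]: "smooth f \<Longrightarrow> smooth g \<Longrightarrow> smooth (\<lambda>x. f x * g x)"
  by (simp_all add: smooth_def continuously_differentiable_const continuously_differentiable_inner
      continuously_differentiable_add continuously_differentiable_mult)

lemma smooth_diff [intro]: 
  assumes "smooth f" "smooth g" shows "smooth (\<lambda>x. f x - g x)"
  using smooth_add[OF assms(1) smooth_mult[OF smooth_const[of "-1"] assms(2)]] by simp

lemma smooth_sum: "(\<And>i. i \<in> I \<Longrightarrow> smooth (f i)) \<Longrightarrow> smooth (\<lambda>x. \<Sum>i\<in>I. f i x)"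
  by (induction I rule: infinite_finite_induct) auto

lemma smooth_prod: "(\<And>i. i \<in> I \<Longrightarrow> smooth (f i)) \<Longrightarrow> smooth (\<lambda>x. \<Prod>i\<in>I. f i x)"
  by (induction I rule: infinite_finite_induct) auto

lemma smooth_compose:
  assumes "\<And>h. h \<in> F \<Longrightarrow> \<exists>h'\<in>F. \<forall>t. (h has_real_derivative h' t) (at t)"
    and "h \<in> F" and "smooth g"
  shows "smooth (\<lambda>x. h (g x))"
  using continuously_differentiable_compose[of F h g] assms by (simp add: smooth_def)

lemma smooth_cos: "smooth g \<Longrightarrow> smooth (\<lambda>x. cos (g x))"
proof -
  \<comment> \<open>Differentiation advances the phase by pi / 2, so the shifted cosines form a
    family closed under differentiation.\<close>
  have d: "((\<lambda>t. cos (t + a)) has_real_derivative cos (t + (a + pi / 2))) (at t)" for a t :: real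
    by (auto intro!: derivative_eq_intros simp: cos_add sin_add)
  assume "smooth g"
  have "smooth (\<lambda>x. (\<lambda>t. cos (t + 0)) (g x))"
  proof (rule smooth_compose[of "range (\<lambda>a t. cos (t + a))" "\<lambda>t. cos (t + 0)" g])
    fix h :: "real \<Rightarrow> real" assume "h \<in> range (\<lambda>a t. cos (t + a))"
    then obtain a where "h = (\<lambda>t. cos (t + a))" by blast
    then show "\<exists>h'\<in>range (\<lambda>a t. cos (t + a)). \<forall>t. (h has_real_derivative h' t) (at t)"
      using d[of a] by (intro bexI[of _ "\<lambda>t. cos (t + (a + pi / 2))"]) auto
  qed (use \<open>smooth g\<close> in blast)+
  then show ?thesis by simp
qed

lemma smooth_imp_differentiable: "smooth f \<Longrightarrow> f differentiable (at x)"
  unfolding smooth_def using continuously_differentiable.simps(2) by blast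

lemma smooth_imp_continuous: "smooth f \<Longrightarrow> continuous_on S f"
  unfolding smooth_def using continuously_differentiable.simps(1) continuous_on_subset by blast

lemma smooth_partial: "smooth f \<Longrightarrow> b \<in> Basis \<Longrightarrow> smooth (partial_derivative b f)"
  unfolding smooth_def using continuously_differentiable.simps(2) by blast

lemma smooth_has_derivative:
  assumes "smooth f" shows "(f has_derivative (\<lambda>h. h \<bullet> gradient f x)) (at x)"
proof -
  have "(f has_derivative (\<lambda>h. partial_derivative h f x)) (at x)"
    using assms differentiable_has_derivative_partial smooth_imp_differentiable by blast
  moreover have "partial_derivative h f x = h \<bullet> gradient f x" for h
  proof -
    interpret linear "\<lambda>h. partial_derivative h f x"
      using calculation has_derivative_linear by blast
    have "partial_derivative h f x = partial_derivative (\<Sum>b\<in>Basis. (h \<bullet> b) *\<^sub>R b) f x"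
      by (simp add: euclidean_representation)
    also have "\<dots> = h \<bullet> gradient f x"
      by (simp only: sum scale gradient_def inner_sum_right)
         (simp add: mult.commute)
    finally show ?thesis .
  qed
  ultimately show ?thesis by simp
qed

lemma gradient_inner: "b \<in> Basis \<Longrightarrow> gradient f x \<bullet> b = partial_derivative b f x"
  by (simp add: gradient_def inner_sum_left_Basis)

lemma gradient_eqI:
  assumes "(f has_derivative (\<lambda>h. h \<bullet> v)) (at x)" shows "gradient f x = v"
  by (rule euclidean_eqI) (simp add: gradient_inner partial_derivative_eqI[OF assms] inner_commute[of v])

lemma smooth_gradient_continuous: "smooth f \<Longrightarrow> continuous_on S (gradient f)"
  unfolding gradient_def by (intro continuous_intros smooth_imp_continuous smooth_partial)

lemma partial_derivative_translate:
  assumes "f differentiable (at (x + a))"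
  shows "partial_derivative b (\<lambda>x. f (x + a)) x = partial_derivative b f (x + a)"
proof (rule partial_derivative_eqI)
  have "((\<lambda>x. x + a) has_derivative (\<lambda>h. h)) (at x)" by (auto intro!: derivative_eq_intros)
  from has_derivative_compose[OF this differentiable_has_derivative_partial[OF assms]]
  show "((\<lambda>x. f (x + a)) has_derivative (\<lambda>h. partial_derivative h f (x + a))) (at x)" .
qed

lemma smooth_translate:
  assumes "smooth f" shows "smooth (\<lambda>x. f (x + a))"
proof -
  have "continuously_differentiable m (\<lambda>x. f (x + a))" if "smooth f" for m f
    using that
  proof (induction m arbitrary: f)
    case 0
    have "continuous_on UNIV f" using 0 smooth_imp_continuous by blast
    then show ?case by (auto intro!: continuous_intros continuous_on_compose2[of UNIV f])
  next
    case (Suc m)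
    have d: "f differentiable (at x)" for x using Suc.prems smooth_imp_differentiable by blast
    have "(\<lambda>x. f (x + a)) differentiable (at x)" for x
      using d[of "x + a"] differentiable_chain_at[of "\<lambda>x. x + a" x f] by (simp add: o_def)
    moreover have "partial_derivative b (\<lambda>x. f (x + a)) = (\<lambda>x. partial_derivative b f (x + a))" for b
      using d by (simp add: fun_eq_iff partial_derivative_translate)
    ultimately show ?case
      using Suc.IH[OF smooth_partial[OF Suc.prems]] by simp
  qed
  then show ?thesis using assms unfolding smooth_def by blast
qed

text \<open>The products of \<open>exp (- 1 / t)\<close> with a polynomial in \<open>1 / t\<close>, extended by zero, form
  a family that is closed under differentiation.\<close>

definition flat_exp :: "real poly \<Rightarrow> real \<Rightarrow> real" where
  "flat_exp p t = (if t > 0 then poly p (inverse t) * exp (- inverse t) else 0)"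

lemma tendsto_poly_div_exp: "((\<lambda>y. poly p y * exp (- y)) \<longlongrightarrow> (0::real)) at_top"
proof -
  have "((\<lambda>y. \<Sum>i\<le>degree p. coeff p i * (y ^ i / exp y)) \<longlongrightarrow> (\<Sum>i\<le>degree p. coeff p i * 0)) at_top"
    by (intro tendsto_intros tendsto_power_div_exp_0)
  then show ?thesis
    by (simp add: poly_altdef sum_distrib_right exp_minus divide_inverse mult.assoc)
qed

text \<open>The derivative of p(1/t) exp(-1/t) is (1/t)^2 (p - p')(1/t) exp(-1/t); the two
  \<open>pCons 0\<close> are the factor (1/t)^2. At 0 the difference quotient from the right is y
  p(y) exp(-y) with y the reciprocal of the increment, and this tends to 0 as y grows.\<close>

lemma flat_exp_derivative:
  "(flat_exp p has_real_derivative flat_exp (pCons 0 (pCons 0 (p - pderiv p))) t) (at t)"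
proof -
  consider "t > 0" | "t < 0" | "t = 0" by linarith
  then show ?thesis
  proof cases
    case 1
    have "((\<lambda>t. poly p (inverse t) * exp (- inverse t)) has_real_derivative
        poly p (inverse t) * (exp (- inverse t) * (inverse t * inverse t))
        + poly (pderiv p) (inverse t) * (- (inverse t * inverse t)) * exp (- inverse t)) (at t)"
      using 1 by (auto intro!: derivative_eq_intros DERIV_chain2[OF poly_DERIV])
    then have "((\<lambda>t. poly p (inverse t) * exp (- inverse t)) has_real_derivative
        flat_exp (pCons 0 (pCons 0 (p - pderiv p))) t) (at t)"
      using 1 by (simp add: flat_exp_def algebra_simps)
    then show ?thesis
      by (rule DERIV_cong_ev[OF refl _ refl, THEN iffD1, rotated])
         (use 1 in \<open>auto simp: flat_exp_def elim!: eventually_mono[OF order_tendstoD(1)[OF tendsto_ident_at]] intro!: eventually_nhds_in_open[of "{0<..}" t, THEN eventually_mono]\<close>)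
  next
    case 2
    have "((\<lambda>t. 0) has_real_derivative 0) (at t)" by simp
    then have "(flat_exp p has_real_derivative 0) (at t)"
      by (rule DERIV_cong_ev[OF refl _ refl, THEN iffD1, rotated])
         (use 2 in \<open>auto simp: flat_exp_def intro!: eventually_nhds_in_open[of "{..<0}" t, THEN eventually_mono]\<close>)
    then show ?thesis using 2 by (simp add: flat_exp_def)
  next
    case 3
    have "((\<lambda>h. (poly (pCons 0 p) (inverse h) * exp (- inverse h))) \<longlongrightarrow> 0) (at_right 0)"
      using tendsto_poly_div_exp[of "pCons 0 p"] filterlim_inverse_at_top_right
      by (rule filterlim_compose)
    then have "((\<lambda>h. flat_exp p h / h) \<longlongrightarrow> 0) (at_right 0)"
      by (rule Lim_transform_eventually)
         (auto simp: eventually_at_filter flat_exp_def field_simps)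
    moreover have "((\<lambda>h. flat_exp p h / h) \<longlongrightarrow> 0) (at_left 0)"
      by (rule Lim_transform_eventually[of "\<lambda>x. 0"])
         (auto simp: eventually_at_filter flat_exp_def)
    ultimately have "((\<lambda>h. flat_exp p h / h) \<longlongrightarrow> 0) (at 0)"
      using filterlim_split_at by blast
    then show ?thesis using 3 by (simp add: DERIV_def flat_exp_def)
  qed
qed

section \<open>The smooth step from 0 towards 1\<close>

abbreviation bump :: "real \<Rightarrow> real" where
  "bump \<equiv> flat_exp 1"

lemma bump_zero_iff [simp]: "bump t = 0 \<longleftrightarrow> t \<le> 0"
  and bump_nonneg [simp]: "bump t \<ge> 0"
  and bump_le_1 [simp]: "bump t \<le> 1"
  by (auto simp: flat_exp_def)

lemma bump_mono: "s \<le> t \<Longrightarrow> bump s \<le> bump t"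
  by (auto simp: flat_exp_def le_imp_inverse_le)

lemma smooth_bump: "smooth g \<Longrightarrow> smooth (\<lambda>x. bump (g x))"
proof -
  assume "smooth g"
  show ?thesis
  proof (rule smooth_compose[of "range flat_exp" bump g])
    fix h :: "real \<Rightarrow> real" assume "h \<in> range flat_exp"
    then obtain p where "h = flat_exp p" by blast
    then show "\<exists>h'\<in>range flat_exp. \<forall>t. (h has_real_derivative h' t) (at t)"
      using flat_exp_derivative[of p] by (intro bexI[of _ "flat_exp (pCons 0 (pCons 0 (p - pderiv p)))"]) auto
  qed (use \<open>smooth g\<close> in auto)
qed

lemma bump_derivative:
  obtains d where "\<And>t. (bump has_real_derivative d t) (at t)" "\<And>t. \<bar>d t\<bar> \<le> 2"
proof
  show "(bump has_real_derivative flat_exp (pCons 0 (pCons 0 (1 - pderiv 1))) t) (at t)" for t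
    by (rule flat_exp_derivative)
  \<comment> \<open>Here y = 1/t, and exp y \<ge> 1 + y + y^2 / 2 gives the bound. This 2 reappears
    in the gradient bound 2t of the periodic bumps.\<close>
  have "y * y * exp (- y) \<le> 2" if "y > 0" for y :: real
    using exp_lower_Taylor_quadratic[of y] that by (simp add: exp_minus field_simps power2_eq_square)
  then show "\<bar>flat_exp (pCons 0 (pCons 0 (1 - pderiv 1))) t\<bar> \<le> 2" for t
    by (auto simp: flat_exp_def mult.assoc abs_mult)
qed

text \<open>\<open>bump\<close> tends to 1 at infinity and vanishes on the nonpositive half-line.
  Applied after a nonnegative smooth function, the rescaled bumps are smooth approximations of the
  indicator of its positivity set; indicators are reached this way both in the density proof and in
  the fundamental lemma.\<close>

lemma bump_scale_tendsto: "(\<lambda>n. bump (real n * t)) \<longlonglongrightarrow> (if t > 0 then 1 else 0)"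
proof (cases "t > 0")
  case True
  have "(\<lambda>n. exp (- (inverse t * inverse (real n)))) \<longlonglongrightarrow> exp (- (inverse t * 0))"
    by (intro tendsto_intros lim_inverse_n)
  then have "(\<lambda>n. exp (- (inverse t * inverse (real n)))) \<longlonglongrightarrow> 1" by simp
  moreover have "\<forall>\<^sub>F n in sequentially. exp (- (inverse t * inverse (real n))) = bump (real n * t)"
    using eventually_gt_at_top[of 0] by eventually_elim (use True in \<open>auto simp: flat_exp_def field_simps\<close>)
  ultimately show ?thesis using True by (simp add: Lim_transform_eventually)
next
  case False
  then have "real n * t \<le> 0" for n by (simp add: mult_nonneg_nonpos)
  then have "(\<lambda>n. bump (real n * t)) = (\<lambda>n. 0)" by (simp only: bump_zero_iff fun_eq_iff) simp
  with False show ?thesis by simp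
qed

section \<open>Square integrable functions\<close>

text \<open>\<open>lebesgue\<close> is complete, so measurability of \<open>f\<close> alone passes
  to every function that agrees with it almost everywhere.\<close>

lemma lebesgue_cong_AE:
  fixes f g :: "'a::euclidean_space \<Rightarrow> real"
  assumes f: "f \<in> borel_measurable lebesgue" and ae: "AE x in lebesgue. f x = g x"
  shows "integrable lebesgue f \<longleftrightarrow> integrable lebesgue g" "(LINT x|lebesgue. f x) = (LINT x|lebesgue. g x)"
  using integrable_cong_AE[OF f borel_measurable_AE[OF f ae] ae]
    integral_cong_AE[OF f borel_measurable_AE[OF f ae] ae] by auto

lemma translation_measurable: "(\<lambda>x. x + a) \<in> lebesgue \<rightarrow>\<^sub>M (lebesgue :: 'a::euclidean_space measure)"
  and distr_translation: "distr lebesgue lebesgue (\<lambda>x. x + a) = (lebesgue :: 'a measure)"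
proof -
  \<comment> \<open>A translation is the affine map whose scale factors are all 1, which brings in
    the transformation rule for the completed measure.\<close>
  have T: "(\<lambda>x::'a. a + (\<Sum>j\<in>Basis. (1 * (x \<bullet> j)) *\<^sub>R j)) = (\<lambda>x. x + a)"
    by (simp add: euclidean_representation add.commute)
  show "(\<lambda>x. x + a) \<in> lebesgue \<rightarrow>\<^sub>M (lebesgue :: 'a measure)"
    using lebesgue_affine_measurable[of "\<lambda>_. 1" a] unfolding T by simp
  show "distr lebesgue lebesgue (\<lambda>x. x + a) = (lebesgue :: 'a measure)"
    using lebesgue_affine_euclidean[of "\<lambda>_. 1" a] unfolding T by (simp add: density_1)
qed

lemma borel_measurable_translation:
  "f \<in> borel_measurable lebesgue \<Longrightarrow> (\<lambda>x::'a::euclidean_space. f (x + a)) \<in> borel_measurable lebesgue"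
  by (rule measurable_compose[OF translation_measurable])

lemma integrable_translation:
  fixes f :: "'a::euclidean_space \<Rightarrow> 'b::{banach, second_countable_topology}"
  assumes "integrable lebesgue f" shows "integrable lebesgue (\<lambda>x. f (x + a))"
  using assms integrable_distr_eq[OF translation_measurable, of f a] by (simp add: distr_translation)

lemma integral_translation:
  fixes f :: "'a::euclidean_space \<Rightarrow> 'b::{banach, second_countable_topology}"
  assumes "f \<in> borel_measurable lebesgue"
  shows "integral\<^sup>L lebesgue (\<lambda>x. f (x + a)) = integral\<^sup>L lebesgue f"
  using assms integral_distr[OF translation_measurable, of f a] by (simp add: distr_translation)

section \<open>Square integrable functions on the whole space and their norm inequalities\<close>

definition L2 :: "('a::euclidean_space \<Rightarrow> real) set" where
  "L2 = {f \<in> borel_measurable lebesgue. integrable lebesgue (\<lambda>x. (f x)\<^sup>2)}"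

definition L2norm :: "('a::euclidean_space \<Rightarrow> real) \<Rightarrow> real" where
  "L2norm f = sqrt (LINT x|lebesgue. (f x)\<^sup>2)"

lemma L2_measurable: "f \<in> L2 \<Longrightarrow> f \<in> borel_measurable lebesgue"
  and L2_integrable: "f \<in> L2 \<Longrightarrow> integrable lebesgue (\<lambda>x. (f x)\<^sup>2)"
  by (auto simp: L2_def)

lemma L2norm_nonneg [simp]: "L2norm f \<ge> 0"
  and L2norm_power2: "(L2norm f)\<^sup>2 = (LINT x|lebesgue. (f x)\<^sup>2)"
  by (auto simp: L2norm_def)

lemma L2_mult_integrable:
  assumes "f \<in> L2" "g \<in> L2" shows "integrable lebesgue (\<lambda>x. f x * g x)"
proof (rule Bochner_Integration.integrable_bound)
  show "integrable lebesgue (\<lambda>x. (f x)\<^sup>2 + (g x)\<^sup>2)"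
    using assms by (auto simp: L2_def)
  show "(\<lambda>x. f x * g x) \<in> borel_measurable lebesgue"
    using assms by (auto simp: L2_def)
  have "\<bar>f x * g x\<bar> \<le> (f x)\<^sup>2 + (g x)\<^sup>2" for x
    using sum_squares_bound[of "\<bar>f x\<bar>" "\<bar>g x\<bar>"] abs_ge_zero[of "f x * g x"]
    unfolding abs_mult power2_abs by linarith
  then show "AE x in lebesgue. norm (f x * g x) \<le> norm ((f x)\<^sup>2 + (g x)\<^sup>2)"
    by simp
qed

lemma L2_add: assumes "f \<in> L2" "g \<in> L2" shows "(\<lambda>x. f x + g x) \<in> L2"
proof -
  have "integrable lebesgue (\<lambda>x. (f x)\<^sup>2 + (g x)\<^sup>2 + 2 * (f x * g x))"
    using L2_mult_integrable[OF assms] assms by (auto simp: L2_def)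
  then show ?thesis using assms by (auto simp: L2_def power2_sum mult.assoc)
qed

lemma L2_cmult: "f \<in> L2 \<Longrightarrow> (\<lambda>x. c * f x) \<in> L2"
  by (auto simp: L2_def power_mult_distrib)

lemma L2_diff: assumes "f \<in> L2" "g \<in> L2" shows "(\<lambda>x. f x - g x) \<in> L2"
  using L2_add[OF assms(1) L2_cmult[OF assms(2), of "-1"]] by simp

lemma L2_bounded_mult:
  assumes "f \<in> L2" "\<rho> \<in> borel_measurable lebesgue" "\<And>x. \<bar>\<rho> x\<bar> \<le> C"
  shows "(\<lambda>x. \<rho> x * f x) \<in> L2" and "L2norm (\<lambda>x. \<rho> x * f x) \<le> C * L2norm f"
proof -
  have C: "C \<ge> 0" using assms(3)[of 0] by linarith
  have le: "(\<rho> x * f x)\<^sup>2 \<le> C\<^sup>2 * (f x)\<^sup>2" for x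
    unfolding power_mult_distrib using assms(3)[of x]
    by (intro mult_right_mono) (auto simp: abs_le_square_iff[symmetric])
  have int: "integrable lebesgue (\<lambda>x. (\<rho> x * f x)\<^sup>2)"
    by (rule Bochner_Integration.integrable_bound[of _ "\<lambda>x. C\<^sup>2 * (f x)\<^sup>2"])
       (use assms le in \<open>auto simp: L2_def\<close>)
  then show "(\<lambda>x. \<rho> x * f x) \<in> L2" using assms by (auto simp: L2_def)
  have "(LINT x|lebesgue. (\<rho> x * f x)\<^sup>2) \<le> (LINT x|lebesgue. C\<^sup>2 * (f x)\<^sup>2)"
    by (rule integral_mono[OF int]) (use assms le in \<open>auto simp: L2_def\<close>)
  then show "L2norm (\<lambda>x. \<rho> x * f x) \<le> C * L2norm f"
    unfolding L2norm_def using C real_sqrt_le_mono by (fastforce simp: real_sqrt_mult)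
qed

text \<open>The squared norm of f + t g is a polynomial a + 2 b t + c t^2 without negative values;
  evaluating it at suitable \<open>t\<close> bounds the middle coefficient.\<close>

lemma L2_Cauchy_Schwarz:
  assumes "f \<in> L2" "g \<in> L2"
  shows "\<bar>LINT x|lebesgue. f x * g x\<bar> \<le> L2norm f * L2norm g"
proof -
  define a b c where "a = (L2norm f)\<^sup>2" "b = (LINT x|lebesgue. f x * g x)" "c = (L2norm g)\<^sup>2"
  note abc = this
  have pos: "0 \<le> a + 2 * t * b + t\<^sup>2 * c" for t
  proof -
    have "0 \<le> (LINT x|lebesgue. (f x + t * g x)\<^sup>2)" by simp
    also have "\<dots> = (LINT x|lebesgue. (f x)\<^sup>2 + (2 * t) * (f x * g x) + t\<^sup>2 * (g x)\<^sup>2)"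
      by (intro Bochner_Integration.integral_cong) (auto simp: power2_eq_square algebra_simps)
    also have "\<dots> = a + 2 * t * b + t\<^sup>2 * c"
      using assms L2_mult_integrable[OF assms] by (simp add: abc L2norm_power2 L2_integrable)
    finally show ?thesis .
  qed
  have "b\<^sup>2 \<le> a * c"
  proof (cases "c = 0")
    case True
    have "b = 0"
    proof (rule ccontr)
      assume "b \<noteq> 0"
      \<comment> \<open>For c = 0 the polynomial is linear, and at this \<open>t\<close> it takes
        the value -1.\<close>
      then show False using pos[of "- (a + 1) / (2 * b)"] True by (simp add: field_simps)
    qed
    then show ?thesis using True by simp
  next
    case False
    then have "c > 0" by (simp add: abc)
    then show ?thesis using pos[of "- b / c"] by (simp add: field_simps power2_eq_square)
  qed
  then show ?thesis unfolding abc
    by (metis L2norm_nonneg abs_le_square_iff abs_of_nonneg mult_nonneg_nonneg power_mult_distrib)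
qed

lemma L2norm_triangle:
  assumes "f \<in> L2" "g \<in> L2" shows "L2norm (\<lambda>x. f x + g x) \<le> L2norm f + L2norm g"
proof (rule power2_le_imp_le)
  have "(L2norm (\<lambda>x. f x + g x))\<^sup>2 = (LINT x|lebesgue. (f x)\<^sup>2 + 2 * (f x * g x) + (g x)\<^sup>2)"
    unfolding L2norm_power2
    by (intro Bochner_Integration.integral_cong) (auto simp: power2_eq_square algebra_simps)
  also have "\<dots> = (L2norm f)\<^sup>2 + 2 * (LINT x|lebesgue. f x * g x) + (L2norm g)\<^sup>2"
    using assms L2_mult_integrable[OF assms] by (simp add: L2norm_power2 L2_integrable)
  also have "\<dots> \<le> (L2norm f + L2norm g)\<^sup>2"
    using L2_Cauchy_Schwarz[OF assms] by (simp add: power2_sum)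
  finally show "(L2norm (\<lambda>x. f x + g x))\<^sup>2 \<le> (L2norm f + L2norm g)\<^sup>2" .
qed simp

lemma L2norm_cmult: "L2norm (\<lambda>x. c * f x) = \<bar>c\<bar> * L2norm f"
  by (simp add: L2norm_def power_mult_distrib real_sqrt_mult)

lemma L2norm_minus_commute: "L2norm (\<lambda>x. f x - g x) = L2norm (\<lambda>x. g x - f x)"
  by (simp add: L2norm_def power2_commute)

lemma L2norm_triangle_diff:
  assumes "f \<in> L2" "g \<in> L2" shows "L2norm f \<le> L2norm g + L2norm (\<lambda>x. f x - g x)"
  using L2norm_triangle[OF assms(2) L2_diff[OF assms]] by simp

lemma L2_translation:
  assumes "f \<in> L2"
  shows "(\<lambda>x. f (x + a)) \<in> L2" and "L2norm (\<lambda>x. f (x + a)) = L2norm f"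
  using assms borel_measurable_translation[of f a] integrable_translation[of "\<lambda>x. (f x)\<^sup>2" a]
    integral_translation[of "\<lambda>x. (f x)\<^sup>2" a]
  by (auto simp: L2_def L2norm_def)

text \<open>Both \<open>f\<close> and the \<open>s i\<close> are bounded by \<open>w\<close>, so the
  squared differences are bounded by the integrable 4 w^2 and ordinary dominated convergence applies
  to them.\<close>

lemma L2_dominated_convergence:
  fixes f :: "'a::euclidean_space \<Rightarrow> real"
  assumes f: "f \<in> borel_measurable lebesgue" and s: "\<And>i. s i \<in> borel_measurable lebesgue"
    and w: "w \<in> L2" and lim: "\<And>x. (\<lambda>i. s i x) \<longlonglongrightarrow> f x" and le: "\<And>i x. \<bar>s i x\<bar> \<le> w x"
  shows "f \<in> L2" "s i \<in> L2" "(\<lambda>i. L2norm (\<lambda>x. f x - s i x)) \<longlonglongrightarrow> 0"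
proof -
  have w0: "w x \<ge> 0" for x using le[of 0 x] by linarith
  have fle: "\<bar>f x\<bar> \<le> w x" for x
    by (rule LIMSEQ_le_const2[OF tendsto_rabs[OF lim]]) (use le in blast)
  have sq: "g \<in> L2" if "g \<in> borel_measurable lebesgue" "\<And>x. \<bar>g x\<bar> \<le> w x" for g
  proof -
    have "integrable lebesgue (\<lambda>x. (g x)\<^sup>2)"
      by (rule Bochner_Integration.integrable_bound[OF L2_integrable[OF w]])
         (use that w0 in \<open>auto simp: abs_le_square_iff[symmetric]\<close>)
    then show ?thesis using that by (simp add: L2_def)
  qed
  show "f \<in> L2" "s i \<in> L2" using sq f s fle le by blast+
  have "(\<lambda>i. LINT x|lebesgue. (f x - s i x)\<^sup>2) \<longlonglongrightarrow> (\<integral>x. 0 \<partial>(lebesgue :: 'a measure))"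
  proof (rule integral_dominated_convergence[where w = "\<lambda>x. 4 * (w x)\<^sup>2"])
    show "integrable lebesgue (\<lambda>x. 4 * (w x)\<^sup>2)" using w by (simp add: L2_def)
    show "AE x in lebesgue. (\<lambda>i. (f x - s i x)\<^sup>2) \<longlonglongrightarrow> 0"
    proof (rule AE_I2)
      fix x
      have "(\<lambda>i. (f x - s i x)\<^sup>2) \<longlonglongrightarrow> (f x - f x)\<^sup>2"
        by (intro tendsto_intros lim)
      then show "(\<lambda>i. (f x - s i x)\<^sup>2) \<longlonglongrightarrow> 0" by simp
    qed
    have "\<bar>f x - s i x\<bar> \<le> 2 * w x" for i x using fle[of x] le[of i x] by linarith
    then have "\<bar>f x - s i x\<bar>\<^sup>2 \<le> (2 * w x)\<^sup>2" for i x
      by (intro power_mono) auto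
    then show "AE x in lebesgue. norm ((f x - s i x)\<^sup>2) \<le> 4 * (w x)\<^sup>2" for i
      by (simp add: power_mult_distrib)
  qed (use f s in auto)
  then have "(\<lambda>i. sqrt (LINT x|lebesgue. (f x - s i x)\<^sup>2)) \<longlonglongrightarrow> sqrt 0"
    by (intro tendsto_real_sqrt) simp
  then show "(\<lambda>i. L2norm (\<lambda>x. f x - s i x)) \<longlonglongrightarrow> 0" by (simp add: L2norm_def)
qed

section \<open>Test functions\<close>

lemma test_functionE:
  assumes "test_function \<Omega> \<phi>"
  obtains K where "smooth \<phi>" "compact K" "K \<subseteq> \<Omega>" "\<And>x. x \<notin> K \<Longrightarrow> \<phi> x = 0"
proof (rule that)
  show "\<phi> x = 0" if "x \<notin> closure {x. \<phi> x \<noteq> 0}" for x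
    using that subsetD[OF closure_subset, of x "{x. \<phi> x \<noteq> 0}"] by auto
qed (use assms in \<open>auto simp: test_function_def smooth_def compactly_contained_def\<close>)

lemma test_functionI:
  assumes "smooth \<phi>" "compact K" "K \<subseteq> \<Omega>" "\<And>x. x \<notin> K \<Longrightarrow> \<phi> x = 0"
  shows "test_function \<Omega> \<phi>"
proof -
  have K: "closure {x. \<phi> x \<noteq> 0} \<subseteq> K"
    using assms(2,4) by (intro closure_minimal) (auto intro: compact_imp_closed)
  then have "compact (closure {x. \<phi> x \<noteq> 0})"
    using compact_Int_closed[OF assms(2) closed_closure, of "{x. \<phi> x \<noteq> 0}"]
    by (simp add: Int_absorb1)
  then show ?thesis
    using K assms(1,3) unfolding test_function_def smooth_def compactly_contained_def by blast
qed

lemma test_function_smooth: "test_function \<Omega> \<phi> \<Longrightarrow> smooth \<phi>"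
  by (simp add: test_function_def smooth_def)

lemma test_function_subset: "test_function \<Omega> \<phi> \<Longrightarrow> \<Omega> \<subseteq> \<Omega>' \<Longrightarrow> test_function \<Omega>' \<phi>"
  by (auto simp: test_function_def compactly_contained_def)

lemma partial_derivative_zero_outside:
  assumes "closed K" "\<And>x. x \<notin> K \<Longrightarrow> \<phi> x = 0" "x \<notin> K"
  shows "partial_derivative b \<phi> x = 0"
proof (rule partial_derivative_eqI)
  have "((\<lambda>x. 0) has_derivative (\<lambda>h. 0)) (at x)" by simp
  then show "(\<phi> has_derivative (\<lambda>h. 0)) (at x)"
    by (rule has_derivative_transform_within_open[of _ _ _ _ "- K"]) (use assms in auto)
qed

lemma gradient_zero_outside:
  assumes "closed K" "\<And>x. x \<notin> K \<Longrightarrow> \<phi> x = 0" "x \<notin> K" shows "gradient \<phi> x = 0"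
  using partial_derivative_zero_outside[OF assms] by (simp add: gradient_def)

lemma test_function_partial:
  assumes "test_function \<Omega> \<phi>" "b \<in> Basis" shows "test_function \<Omega> (partial_derivative b \<phi>)"
proof -
  obtain K where K: "smooth \<phi>" "compact K" "K \<subseteq> \<Omega>" "\<And>x. x \<notin> K \<Longrightarrow> \<phi> x = 0"
    using test_functionE[OF assms(1)] by metis
  have "partial_derivative b \<phi> x = 0" if "x \<notin> K" for x
    by (rule partial_derivative_zero_outside[OF compact_imp_closed[OF K(2)] _ that]) (rule K(4))
  then show ?thesis
    using K(2,3) by (intro test_functionI[OF smooth_partial[OF K(1) assms(2)]])
qed

lemma test_function_mult_smooth:
  assumes "test_function \<Omega> \<phi>" "smooth \<zeta>" shows "test_function \<Omega> (\<lambda>x. \<zeta> x * \<phi> x)"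
  using assms by (elim test_functionE) (rule test_functionI, auto)

lemma test_function_cmult: "test_function \<Omega> \<phi> \<Longrightarrow> test_function \<Omega> (\<lambda>x. c * \<phi> x)"
  by (rule test_function_mult_smooth) auto

lemma test_function_zero: "test_function \<Omega> (\<lambda>x. 0)"
  by (rule test_functionI[of _ "{}"]) auto

lemma test_function_add:
  assumes "test_function \<Omega> \<phi>" "test_function \<Omega> \<psi>" shows "test_function \<Omega> (\<lambda>x. \<phi> x + \<psi> x)"
proof -
  obtain K L where "smooth \<phi>" "compact K" "K \<subseteq> \<Omega>" "\<And>x. x \<notin> K \<Longrightarrow> \<phi> x = 0"
    "smooth \<psi>" "compact L" "L \<subseteq> \<Omega>" "\<And>x. x \<notin> L \<Longrightarrow> \<psi> x = 0"
    using test_functionE[OF assms(1)] test_functionE[OF assms(2)] by metis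
  then show ?thesis by (intro test_functionI[of _ "K \<union> L"]) auto
qed

lemma test_function_sum:
  "(\<And>i. i \<in> I \<Longrightarrow> test_function \<Omega> (\<phi> i)) \<Longrightarrow> test_function \<Omega> (\<lambda>x. \<Sum>i\<in>I. \<phi> i x)"
  by (induction I rule: infinite_finite_induct) (auto intro: test_function_zero test_function_add)

lemma test_function_bump_scale:
  assumes "test_function \<Omega> \<zeta>" shows "test_function \<Omega> (\<lambda>x. bump (c * \<zeta> x))"
  using assms
proof (elim test_functionE)
  fix K assume "smooth \<zeta>" "compact K" "K \<subseteq> \<Omega>" "\<And>x. x \<notin> K \<Longrightarrow> \<zeta> x = 0"
  then show ?thesis
    by (intro test_functionI[of _ K] smooth_bump smooth_mult) auto
qed

lemma test_function_translate:
  assumes "test_function UNIV \<phi>" shows "test_function UNIV (\<lambda>x. \<phi> (x + a))"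
proof -
  obtain K where "smooth \<phi>" "compact K" "\<And>x. x \<notin> K \<Longrightarrow> \<phi> x = 0"
    using test_functionE[OF assms] by metis
  then show ?thesis
    by (intro test_functionI[of _ "(\<lambda>x. x - a) ` K"] smooth_translate compact_translation_subtract)
      (auto simp: image_iff, metis add_diff_cancel)
qed

lemma continuous_measurable_lebesgue:
  fixes f :: "'a::euclidean_space \<Rightarrow> 'b::{topological_space}"
  shows "continuous_on UNIV f \<Longrightarrow> f \<in> borel_measurable lebesgue"
  by (intro measurable_completion) (simp add: borel_measurable_continuous_onI)

lemma smooth_measurable: "smooth f \<Longrightarrow> f \<in> borel_measurable lebesgue"
  by (intro continuous_measurable_lebesgue smooth_imp_continuous)

lemma test_function_bounded:
  assumes "test_function \<Omega> \<phi>"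
  obtains B where "B \<ge> 0" "\<And>x. \<bar>\<phi> x\<bar> \<le> B" "\<And>x. norm (gradient \<phi> x) \<le> B"
proof -
  obtain K where K: "smooth \<phi>" "compact K" "\<And>x. x \<notin> K \<Longrightarrow> \<phi> x = 0"
    using test_functionE[OF assms] by metis
  have "bounded (\<phi> ` K)" "bounded (gradient \<phi> ` K)"
    using K smooth_imp_continuous smooth_gradient_continuous
    by (blast intro: compact_imp_bounded compact_continuous_image)+
  then obtain B1 B2 where "\<And>x. x \<in> K \<Longrightarrow> \<bar>\<phi> x\<bar> \<le> B1" "\<And>x. x \<in> K \<Longrightarrow> norm (gradient \<phi> x) \<le> B2"
    unfolding bounded_iff by auto
  moreover have "\<phi> x = 0" "gradient \<phi> x = 0" if "x \<notin> K" for x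
    using K that gradient_zero_outside compact_imp_closed by blast+
  ultimately have "\<bar>\<phi> x\<bar> \<le> max 0 (max B1 B2)" "norm (gradient \<phi> x) \<le> max 0 (max B1 B2)" for x
    by (cases "x \<in> K"; force simp: le_max_iff_disj)+
  then show ?thesis by (intro that[of "max 0 (max B1 B2)"]) auto
qed

lemma integrable_indicator_compact: "compact K \<Longrightarrow> integrable lebesgue (indicator K :: 'a::euclidean_space \<Rightarrow> real)"
  using lmeasurable_compact lmeasurable_iff_integrable by blast

lemma indicator_L2: "S \<in> lmeasurable \<Longrightarrow> (\<lambda>x. c * indicator S x) \<in> L2"
  by (rule L2_cmult) (auto simp: L2_def lmeasurable_iff_integrable power2_eq_square simp flip: indicator_inter_arith)

lemma test_function_L2: assumes "test_function \<Omega> \<phi>" shows "\<phi> \<in> L2"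
proof -
  obtain K where K: "smooth \<phi>" "compact K" "\<And>x. x \<notin> K \<Longrightarrow> \<phi> x = 0"
    using test_functionE[OF assms] by metis
  obtain B where B: "\<And>x. \<bar>\<phi> x\<bar> \<le> B" using test_function_bounded[OF assms] by metis
  have "(\<lambda>x. \<phi> x * (1 * indicator K x)) \<in> L2"
    using B smooth_measurable[OF K(1)] indicator_L2[OF lmeasurable_compact[OF K(2)], of 1]
    by (intro L2_bounded_mult(1)[of "\<lambda>x. 1 * indicator K x" \<phi> B]) simp_all
  also have "(\<lambda>x. \<phi> x * (1 * indicator K x)) = \<phi>"
    using K(3) by (auto simp: fun_eq_iff indicator_def)
  finally show ?thesis .
qed

lemma locally_integrable_mult_test:
  assumes "locally_integrable \<Omega> g" "test_function \<Omega> \<phi>"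
  shows "integrable lebesgue (\<lambda>x. g x * \<phi> x)"
proof -
  obtain K where K: "smooth \<phi>" "compact K" "K \<subseteq> \<Omega>" "\<And>x. x \<notin> K \<Longrightarrow> \<phi> x = 0"
    using test_functionE[OF assms(2)] by metis
  obtain B where B: "\<And>x. \<bar>\<phi> x\<bar> \<le> B" using test_function_bounded[OF assms(2)] by metis
  have i: "integrable lebesgue (\<lambda>x. indicator K x *\<^sub>R g x)"
    using assms K by (auto simp: locally_integrable_def set_integrable_def)
  have "integrable lebesgue (\<lambda>x. (indicator K x *\<^sub>R g x) * \<phi> x)"
  proof (rule Bochner_Integration.integrable_bound)
    show "integrable lebesgue (\<lambda>x. B * (indicator K x *\<^sub>R g x))" using i by simp
    show "(\<lambda>x. (indicator K x *\<^sub>R g x) * \<phi> x) \<in> borel_measurable lebesgue"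
      using i smooth_measurable[OF K(1)] by (intro borel_measurable_times) auto
    show "AE x in lebesgue. norm (indicator K x *\<^sub>R g x * \<phi> x) \<le> norm (B * indicator K x *\<^sub>R g x)"
    proof (rule AE_I2)
      fix x have "\<bar>\<phi> x\<bar> \<le> \<bar>B\<bar>" using B[of x] by linarith
      then show "norm (indicator K x *\<^sub>R g x * \<phi> x) \<le> norm (B * indicator K x *\<^sub>R g x)"
        by (simp add: abs_mult mult.commute mult_right_mono)
    qed
  qed
  moreover have "(\<lambda>x. (indicator K x *\<^sub>R g x) * \<phi> x) = (\<lambda>x. g x * \<phi> x)"
    using K(4) by (auto simp: fun_eq_iff indicator_def)
  ultimately show ?thesis by simp
qed

text \<open>A product over the coordinates of one-sided bumps that vanish at the two faces. The
  exact positivity set matters: after rescaling inside \<open>bump\<close> the limit is the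
  indicator of the open box.\<close>

lemma box_test_function:
  assumes "cbox a c \<subseteq> \<Omega>"
  obtains \<zeta> where "test_function \<Omega> \<zeta>" "\<And>x. \<zeta> x \<ge> 0" "\<And>x. \<zeta> x > 0 \<longleftrightarrow> x \<in> box a c"
proof
  define \<zeta> where "\<zeta> = (\<lambda>x. \<Prod>b\<in>Basis. bump (x \<bullet> b - a \<bullet> b) * bump (c \<bullet> b - x \<bullet> b))"
  show "\<zeta> x > 0 \<longleftrightarrow> x \<in> box a c" for x
  proof -
    have "\<zeta> x \<noteq> 0 \<longleftrightarrow> x \<in> box a c"
      by (auto simp: \<zeta>_def mem_box not_le)
    moreover have "\<zeta> x \<ge> 0" by (auto simp: \<zeta>_def intro!: prod_nonneg)
    ultimately show ?thesis by linarith
  qed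
  show "\<zeta> x \<ge> 0" for x by (auto simp: \<zeta>_def intro!: prod_nonneg)
  have "smooth \<zeta>" unfolding \<zeta>_def
    by (intro smooth_prod smooth_mult smooth_bump smooth_diff smooth_const smooth_inner)
  moreover have "\<zeta> x = 0" if "x \<notin> cbox a c" for x
    using that unfolding \<zeta>_def by (force simp: mem_box)
  ultimately show "test_function \<Omega> \<zeta>"
    using assms by (intro test_functionI[of _ "cbox a c"]) auto
qed

text \<open>Finitely many open boxes with closures in \<open>\<Omega>\<close> cover
  \<open>K\<close>, and their nonnegative box functions add up to a function that is positive on
  \<open>K\<close>.\<close>

lemma compact_test_function:
  assumes "compact K" "K \<subseteq> \<Omega>" "open \<Omega>"
  obtains \<zeta> where "test_function \<Omega> \<zeta>" "\<And>x. \<zeta> x \<ge> 0" "\<And>x. x \<in> K \<Longrightarrow> \<zeta> x > 0"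
proof -
  have "\<exists>a c. x \<in> box a c \<and> cbox a c \<subseteq> \<Omega>" if "x \<in> K" for x
  proof -
    obtain a c where "x \<in> box a c" "cbox a c \<subseteq> \<Omega>"
      using open_contains_cbox[OF assms(3) subsetD[OF assms(2) \<open>x \<in> K\<close>]] by metis
    then show ?thesis by blast
  qed
  then obtain a c where ac: "\<And>x. x \<in> K \<Longrightarrow> x \<in> box (a x) (c x)" "\<And>x. x \<in> K \<Longrightarrow> cbox (a x) (c x) \<subseteq> \<Omega>"
    by metis
  obtain F where F: "F \<subseteq> K" "finite F" "K \<subseteq> (\<Union>x\<in>F. box (a x) (c x))"
    using compactE_image[OF assms(1), of K "\<lambda>x. box (a x) (c x)"] ac(1) by blast
  have "\<exists>\<zeta>. test_function \<Omega> \<zeta> \<and> (\<forall>x. \<zeta> x \<ge> 0) \<and> (\<forall>x. \<zeta> x > 0 \<longleftrightarrow> x \<in> box (a y) (c y))" if "y \<in> F" for y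
    using box_test_function[OF ac(2), of y] that F(1) by (metis subsetD)
  then obtain \<zeta> where \<zeta>: "\<And>y. y \<in> F \<Longrightarrow> test_function \<Omega> (\<zeta> y)" "\<And>x y. y \<in> F \<Longrightarrow> \<zeta> y x \<ge> 0"
    "\<And>x y. y \<in> F \<Longrightarrow> \<zeta> y x > 0 \<longleftrightarrow> x \<in> box (a y) (c y)" by metis
  show thesis
  proof (rule that[of "\<lambda>x. \<Sum>y\<in>F. \<zeta> y x"])
    show "test_function \<Omega> (\<lambda>x. \<Sum>y\<in>F. \<zeta> y x)" using \<zeta>(1) by (rule test_function_sum)
    show "(\<Sum>y\<in>F. \<zeta> y x) \<ge> 0" for x using \<zeta>(2) by (rule sum_nonneg)
    show "(\<Sum>y\<in>F. \<zeta> y x) > 0" if "x \<in> K" for x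
    proof -
      obtain y where "y \<in> F" "x \<in> box (a y) (c y)" using F \<open>x \<in> K\<close> by blast
      then show ?thesis using \<zeta> F(2) by (intro sum_pos2[of F y]) auto
    qed
  qed
qed

text \<open>Admissibility for the capacity asks for values at least 1 on an open neighbourhood,
  hence the set \<open>V\<close> where a function positive on \<open>K\<close> exceeds half its
  minimum over \<open>K\<close>; multiplying by 2 over this minimum lifts it above 1 there.\<close>

lemma cutoff_function:
  assumes "compact K" "K \<subseteq> \<Omega>" "open \<Omega>"
  obtains \<zeta> V where "test_function \<Omega> \<zeta>" "\<And>x. \<zeta> x \<ge> 0" "open V" "K \<subseteq> V" "V \<subseteq> \<Omega>" "\<And>x. x \<in> V \<Longrightarrow> \<zeta> x \<ge> 1"
proof (cases "K = {}")
  case True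
  then show ?thesis using that[of "\<lambda>x. 0" "{}"] test_function_zero by auto
next
  case False
  obtain \<zeta> where \<zeta>: "test_function \<Omega> \<zeta>" "\<And>x. \<zeta> x \<ge> 0" "\<And>x. x \<in> K \<Longrightarrow> \<zeta> x > 0"
    using compact_test_function[OF assms] by metis
  have cont: "continuous_on S \<zeta>" for S using \<zeta>(1) smooth_imp_continuous test_function_smooth by blast
  obtain z where z: "z \<in> K" "\<And>x. x \<in> K \<Longrightarrow> \<zeta> z \<le> \<zeta> x"
    using continuous_attains_inf[OF assms(1) False cont] by blast
  define V where "V = {x. \<zeta> z / 2 < \<zeta> x}"
  have pos: "\<zeta> z > 0" using \<zeta> z by blast
  have "open V" unfolding V_def using cont by (intro open_Collect_less continuous_intros)
  moreover have "K \<subseteq> V" using z pos unfolding V_def by force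
  moreover have "V \<subseteq> \<Omega>"
  proof
    fix x assume "x \<in> V"
    then have "\<zeta> x \<noteq> 0" using pos unfolding V_def by auto
    then show "x \<in> \<Omega>" using \<zeta>(1) by (meson subsetD test_functionE)
  qed
  ultimately show ?thesis
    using \<zeta> pos by (intro that[of "\<lambda>x. (2 / \<zeta> z) * \<zeta> x" V] test_function_cmult)
       (auto simp: V_def field_simps)
qed

subsection \<open>Density of test functions\<close>

text \<open>A predicate for membership in the closure of the test functions, because density is
  proved in stages: it is stable under linear combinations and under limits in
  \<open>L2\<close>.\<close>

definition approximable :: "('a::euclidean_space \<Rightarrow> real) \<Rightarrow> bool" where
  "approximable f \<longleftrightarrow> f \<in> L2 \<and>
     (\<forall>\<epsilon>>0. \<exists>\<phi>. test_function UNIV \<phi> \<and> L2norm (\<lambda>x. f x - \<phi> x) < \<epsilon>)"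

lemma approximable_limit:
  assumes f: "f \<in> L2" and ex: "\<And>\<epsilon>. \<epsilon> > 0 \<Longrightarrow> \<exists>g. approximable g \<and> L2norm (\<lambda>x. f x - g x) < \<epsilon>"
  shows "approximable f"
  unfolding approximable_def
proof (intro conjI allI impI f)
  fix \<epsilon> :: real assume "\<epsilon> > 0"
  obtain g where g: "approximable g" "L2norm (\<lambda>x. f x - g x) < \<epsilon> / 2"
    using ex[of "\<epsilon> / 2"] \<open>\<epsilon> > 0\<close> by auto
  obtain \<phi> where \<phi>: "test_function UNIV \<phi>" "L2norm (\<lambda>x. g x - \<phi> x) < \<epsilon> / 2" "g \<in> L2"
    using g(1) \<open>\<epsilon> > 0\<close> by (auto simp: approximable_def dest: spec[of _ "\<epsilon> / 2"])
  have "L2norm (\<lambda>x. (f x - g x) + (g x - \<phi> x)) \<le> L2norm (\<lambda>x. f x - g x) + L2norm (\<lambda>x. g x - \<phi> x)"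
    using f \<phi>(3) test_function_L2[OF \<phi>(1)] by (intro L2norm_triangle L2_diff)
  then have "L2norm (\<lambda>x. f x - \<phi> x) < \<epsilon>" using g \<phi> by simp
  then show "\<exists>\<phi>. test_function UNIV \<phi> \<and> L2norm (\<lambda>x. f x - \<phi> x) < \<epsilon>" using \<phi> by blast
qed

lemma approximable_test: "test_function UNIV \<phi> \<Longrightarrow> approximable \<phi>"
  unfolding approximable_def using test_function_L2 by (auto intro!: exI[of _ \<phi>] simp: L2norm_def)

lemma approximable_sequence:
  assumes "f \<in> L2" "\<And>i::nat. approximable (s i)" "(\<lambda>i. L2norm (\<lambda>x. f x - s i x)) \<longlonglongrightarrow> 0"
  shows "approximable f"
proof (rule approximable_limit[OF assms(1)])
  fix \<epsilon> :: real assume "\<epsilon> > 0"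
  then have "\<forall>\<^sub>F i in sequentially. L2norm (\<lambda>x. f x - s i x) < \<epsilon>"
    using order_tendstoD(2)[OF assms(3)] by blast
  then obtain i where "L2norm (\<lambda>x. f x - s i x) < \<epsilon>" by (auto simp: eventually_sequentially)
  then show "\<exists>g. approximable g \<and> L2norm (\<lambda>x. f x - g x) < \<epsilon>" using assms(2) by blast
qed

lemma approximable_add_cmult:
  assumes "approximable f" "approximable g" shows "approximable (\<lambda>x. f x + c * g x)"
  unfolding approximable_def
proof (intro conjI allI impI)
  have fg: "f \<in> L2" "g \<in> L2" using assms by (auto simp: approximable_def)
  then show "(\<lambda>x. f x + c * g x) \<in> L2" by (intro L2_add L2_cmult)
  fix \<epsilon> :: real assume "\<epsilon> > 0"
  then have "\<epsilon> / 2 > 0" "\<epsilon> / 2 / (\<bar>c\<bar> + 1) > 0" by simp_all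
  then obtain \<phi> \<psi> where \<phi>: "test_function UNIV \<phi>" "L2norm (\<lambda>x. f x - \<phi> x) < \<epsilon> / 2"
    and \<psi>: "test_function UNIV \<psi>" "L2norm (\<lambda>x. g x - \<psi> x) < \<epsilon> / 2 / (\<bar>c\<bar> + 1)"
    using assms unfolding approximable_def by meson
  have "\<bar>c\<bar> * L2norm (\<lambda>x. g x - \<psi> x) \<le> (\<bar>c\<bar> + 1) * L2norm (\<lambda>x. g x - \<psi> x)"
    by (intro mult_right_mono) auto
  also have "\<dots> < \<epsilon> / 2" using \<psi>(2) by (simp add: field_simps)
  finally have "L2norm (\<lambda>x. c * (g x - \<psi> x)) < \<epsilon> / 2" by (simp only: L2norm_cmult)
  moreover have "L2norm (\<lambda>x. (f x - \<phi> x) + c * (g x - \<psi> x)) \<le> L2norm (\<lambda>x. f x - \<phi> x) + L2norm (\<lambda>x. c * (g x - \<psi> x))"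
    using fg test_function_L2[OF \<phi>(1)] test_function_L2[OF \<psi>(1)] by (intro L2norm_triangle L2_diff L2_cmult)
  ultimately have "L2norm (\<lambda>x. f x + c * g x - (\<phi> x + c * \<psi> x)) < \<epsilon>" using \<phi> by (simp add: algebra_simps)
  then show "\<exists>\<phi>. test_function UNIV \<phi> \<and> L2norm (\<lambda>x. f x + c * g x - \<phi> x) < \<epsilon>"
    using test_function_add[OF \<phi>(1) test_function_cmult[OF \<psi>(1)]] by blast
qed

lemma approximable_sum:
  assumes "\<And>i. i \<in> I \<Longrightarrow> approximable (f i)"
  shows "approximable (\<lambda>x. \<Sum>i\<in>I. c i * f i x)"
  using assms
proof (induction I rule: infinite_finite_induct)
  case (insert i I)
  then show ?case
    using approximable_add_cmult[of "\<lambda>x. \<Sum>i\<in>I. c i * f i x" "f i" "c i"] by (simp add: add.commute)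
qed (auto intro: approximable_test test_function_zero)

text \<open>The test functions \<open>bump (i * \<zeta> x)\<close> tend to the indicator, dominated
  by the indicator of a compact set outside which \<zeta> vanishes.\<close>

lemma approximable_positivity_set:
  assumes \<zeta>: "test_function UNIV \<zeta>" "\<And>x. \<zeta> x \<ge> 0"
  shows "approximable (indicator {x. \<zeta> x > 0})"
proof -
  obtain K where K: "smooth \<zeta>" "compact K" "\<And>x. x \<notin> K \<Longrightarrow> \<zeta> x = 0"
    using test_functionE[OF \<zeta>(1)] by metis
  have w: "(\<lambda>x. 1 * indicator K x) \<in> L2" using indicator_L2 lmeasurable_compact[OF K(2)] by blast
  have 1: "indicator {x. \<zeta> x > 0} \<in> borel_measurable lebesgue"
    using smooth_measurable[OF K(1)] by measurable
  have 2: "(\<lambda>x. bump (real i * \<zeta> x)) \<in> borel_measurable lebesgue" for i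
    by (intro smooth_measurable smooth_bump smooth_mult K smooth_const)
  have 3: "(\<lambda>i. bump (real i * \<zeta> x)) \<longlonglongrightarrow> indicator {x. \<zeta> x > 0} x" for x
    using bump_scale_tendsto[of "\<zeta> x"] by (auto simp: indicator_def split: if_splits)
  have 4: "\<bar>bump (real i * \<zeta> x)\<bar> \<le> 1 * indicator K x" for i x
    using K(3)[of x] by (auto simp: indicator_def simp del: bump_zero_iff) (auto simp: flat_exp_def)
  note lim = L2_dominated_convergence[OF 1 2 w 3 4]
  show ?thesis
    by (rule approximable_sequence[OF lim(1) _ lim(3)])
       (intro approximable_test test_function_bump_scale \<zeta>)
qed

text \<open>Regularity of Lebesgue measure puts \<open>S\<close> between a compact \<open>T\<close>
  and an open \<open>U\<close> of almost the same measure. A test function of \<open>U\<close> that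
  is positive on \<open>T\<close> has its positivity set \<open>V\<close> between the same two, so
  \<open>S\<close> and \<open>V\<close> differ only inside U - T.\<close>

lemma approximable_indicator:
  assumes S: "S \<in> sets lebesgue" "bounded S"
  shows "approximable (\<lambda>x. indicator S x)"
proof (rule approximable_limit)
  have Sl: "S \<in> lmeasurable" using S bounded_set_imp_lmeasurable by blast
  then show "(\<lambda>x. indicator S x) \<in> L2" using indicator_L2[of S 1] by simp
  fix \<epsilon> :: real assume "\<epsilon> > 0"
  \<comment> \<open>Two exceptional sets of measure below \<epsilon>^2 / 4 keep the squared distance
    below \<epsilon>^2.\<close>
  then have e: "\<epsilon>\<^sup>2 / 4 > 0" by simp
  obtain U where U: "open U" "S \<subseteq> U" "(U - S) \<in> lmeasurable" "emeasure lebesgue (U - S) < ennreal (\<epsilon>\<^sup>2 / 4)"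
    using sets_lebesgue_outer_open[OF S(1) e] .
  obtain T where T: "closed T" "T \<subseteq> S" "(S - T) \<in> lmeasurable" "emeasure lebesgue (S - T) < ennreal (\<epsilon>\<^sup>2 / 4)"
    using sets_lebesgue_inner_closed[OF S(1) e] .
  have "compact T" using T S(2) bounded_subset compact_eq_bounded_closed by blast
  then obtain \<zeta> where \<zeta>: "test_function U \<zeta>" "\<And>x. \<zeta> x \<ge> 0" "\<And>x. x \<in> T \<Longrightarrow> \<zeta> x > 0"
    using compact_test_function[of T U] T U by (metis order_trans)
  define V where "V = {x. \<zeta> x > 0}"
  have V: "T \<subseteq> V" "V \<subseteq> U"
    using \<zeta> test_functionE[OF \<zeta>(1)] unfolding V_def by (auto, metis less_irrefl subsetD)
  have VS: "approximable (indicator V)"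
    unfolding V_def using approximable_positivity_set \<zeta> test_function_subset by blast
  define W where "W = (U - S) \<union> (S - T)"
  have W: "W \<in> lmeasurable" using U T by (simp add: W_def fmeasurable.Un)
  have le: "(indicator S x - indicator V x)\<^sup>2 \<le> (indicator W x :: real)" for x
    using V T U by (auto simp: W_def indicator_def)
  have "(L2norm (\<lambda>x. indicator S x - indicator V x))\<^sup>2 \<le> (LINT x|lebesgue. indicator W x)"
    unfolding L2norm_power2
  proof (rule integral_mono)
    show "integrable lebesgue (\<lambda>x. (indicator S x - indicator V x :: real)\<^sup>2)"
      using L2_diff[of "indicator S" "indicator V"] VS indicator_L2[OF Sl, of 1]
      by (intro L2_integrable) (auto simp: approximable_def)
  qed (use W le in \<open>auto simp: lmeasurable_iff_integrable\<close>)
  also have "\<dots> = measure lebesgue W" using W by simp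
  also have "\<dots> \<le> measure lebesgue (U - S) + measure lebesgue (S - T)"
    unfolding W_def using U T by (intro measure_Un_le) (auto dest: fmeasurableD)
  also have "\<dots> < \<epsilon>\<^sup>2 / 4 + \<epsilon>\<^sup>2 / 4"
  proof (intro add_strict_mono)
    have "ennreal (measure lebesgue (U - S)) < ennreal (\<epsilon>\<^sup>2 / 4)"
      "ennreal (measure lebesgue (S - T)) < ennreal (\<epsilon>\<^sup>2 / 4)"
      using U T by (simp_all add: emeasure_eq_measure2)
    then show "measure lebesgue (U - S) < \<epsilon>\<^sup>2 / 4" "measure lebesgue (S - T) < \<epsilon>\<^sup>2 / 4"
      using e by (simp_all add: ennreal_less_iff)
  qed
  also have "\<dots> \<le> \<epsilon>\<^sup>2" by simp
  finally have "L2norm (\<lambda>x. indicator S x - indicator V x) < \<epsilon>"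
    using \<open>\<epsilon> > 0\<close> by (meson less_eq_real_def power_less_imp_less_base)
  then show "\<exists>g. approximable g \<and> L2norm (\<lambda>x. indicator S x - g x) < \<epsilon>" using VS by blast
qed

text \<open>Simple functions bounded by 2 |f| converge to \<open>f\<close>. Their level sets may be
  unbounded, so each function is truncated to a ball before it is written as a combination of
  indicators of bounded sets.\<close>

lemma L2_approximable:
  fixes f :: "'a::euclidean_space \<Rightarrow> real"
  assumes f: "f \<in> L2" shows "approximable f"
proof -
  obtain F where F: "\<And>i. simple_function lebesgue (F i)" "\<And>x. (\<lambda>i. F i x) \<longlonglongrightarrow> f x"
    "\<And>i x. dist (F i x) 0 \<le> 2 * dist (f x) 0"
    using borel_measurable_implies_sequence_metric[OF L2_measurable[OF f], of 0] by auto
  define s where "s = (\<lambda>i x. indicator (cball 0 (real i)) x * F i x)"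
  have Fm: "F i \<in> borel_measurable lebesgue" for i using F(1) borel_measurable_simple_function by blast
  have 1: "s i \<in> borel_measurable lebesgue" for i unfolding s_def using Fm[of i] by (intro borel_measurable_times borel_measurable_indicator) auto
  have w: "(\<lambda>x. 2 * \<bar>f x\<bar>) \<in> L2" using f by (intro L2_cmult) (auto simp: L2_def)
  have 2: "(\<lambda>i. s i x) \<longlonglongrightarrow> f x" for x
  proof (rule Lim_transform_eventually[OF F(2)])
    obtain n :: nat where "norm x \<le> n" using real_arch_simple by blast
    then show "\<forall>\<^sub>F i in sequentially. F i x = s i x"
      unfolding eventually_sequentially s_def by (intro exI[of _ n]) auto
  qed
  have 3: "\<bar>s i x\<bar> \<le> 2 * \<bar>f x\<bar>" for i x using F(3)[of i x] by (auto simp: s_def indicator_def dist_norm)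
  note lim = L2_dominated_convergence[OF L2_measurable[OF f] 1 w 2 3]
  have "approximable (s i)" for i
  proof -
    have fin: "finite (range (F i))" using F(1) by (simp add: simple_function_def)
    have "approximable (\<lambda>x. \<Sum>y\<in>range (F i). y * indicator (cball 0 (real i) \<inter> {x. F i x = y}) x)"
    proof (intro approximable_sum approximable_indicator)
      fix y
      have "{x \<in> space lebesgue. F i x = y} \<in> sets lebesgue" using Fm by measurable
      then show "cball 0 (real i) \<inter> {x. F i x = y} \<in> sets lebesgue" by (auto intro: sets.Int)
    qed (auto intro: bounded_subset[OF bounded_cball])
    also have "(\<lambda>x. \<Sum>y\<in>range (F i). y * indicator (cball 0 (real i) \<inter> {x. F i x = y}) x) = s i"
    proof
      fix x
      have "(\<Sum>y\<in>range (F i). y * indicator (cball 0 (real i) \<inter> {x. F i x = y}) x)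
          = (\<Sum>y\<in>range (F i). if y = F i x then y * indicator (cball 0 (real i)) x else 0)"
        by (intro sum.cong) (auto simp: indicator_def)
      also have "\<dots> = s i x" using fin by (simp add: s_def)
      finally show "(\<Sum>y\<in>range (F i). y * indicator (cball 0 (real i) \<inter> {x. F i x = y}) x) = s i x" .
    qed
    finally show ?thesis .
  qed
  then show ?thesis by (rule approximable_sequence[OF f _ lim(3)])
qed

text \<open>The hypothesis is used for a test function \<phi> close to \<open>f\<close> itself,
  where the pairing is almost the squared norm of \<open>f\<close>.\<close>

lemma L2norm_le_by_duality:
  assumes f: "f \<in> L2" and C: "C \<ge> 0"
    and le: "\<And>\<phi>. test_function UNIV \<phi> \<Longrightarrow> \<bar>LINT x|lebesgue. f x * \<phi> x\<bar> \<le> C * L2norm \<phi>"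
  shows "L2norm f \<le> C"
proof (rule ccontr)
  assume "\<not> ?thesis"
  then have less: "C < L2norm f" by simp
  \<comment> \<open>Chosen so that (C + L2norm f) \<eta> is half of L2norm f (L2norm f - C); the
    resulting bound for the squared norm of \<open>f\<close> is then strictly smaller than this
    squared norm.\<close>
  define \<eta> where "\<eta> = L2norm f * (L2norm f - C) / (2 * (C + L2norm f))"
  have "\<eta> > 0" unfolding \<eta>_def using less C by (intro divide_pos_pos mult_pos_pos) auto
  then obtain \<phi> where \<phi>: "test_function UNIV \<phi>" "L2norm (\<lambda>x. f x - \<phi> x) < \<eta>"
    using L2_approximable[OF f] by (auto simp: approximable_def)
  note \<phi>2 = test_function_L2[OF \<phi>(1)]
  have "(L2norm f)\<^sup>2 = (LINT x|lebesgue. f x * \<phi> x + f x * (f x - \<phi> x))"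
    unfolding L2norm_power2 by (intro Bochner_Integration.integral_cong) (auto simp: power2_eq_square algebra_simps)
  also have "\<dots> = (LINT x|lebesgue. f x * \<phi> x) + (LINT x|lebesgue. f x * (f x - \<phi> x))"
    using f \<phi>2 L2_diff[OF f \<phi>2] L2_mult_integrable by (intro Bochner_Integration.integral_add) blast+
  also have "\<dots> \<le> C * L2norm \<phi> + L2norm f * L2norm (\<lambda>x. f x - \<phi> x)"
    using le[OF \<phi>(1)] L2_Cauchy_Schwarz[OF f L2_diff[OF f \<phi>2]] by linarith
  also have "\<dots> \<le> C * (L2norm f + \<eta>) + L2norm f * \<eta>"
  proof (intro add_mono mult_left_mono C)
    have "L2norm \<phi> \<le> L2norm f + L2norm (\<lambda>x. \<phi> x - f x)" by (rule L2norm_triangle_diff[OF \<phi>2 f])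
    then show "L2norm \<phi> \<le> L2norm f + \<eta>" using \<phi>(2) L2norm_minus_commute[of \<phi> f] by linarith
  qed (use \<phi>(2) in auto)
  also have "\<dots> = C * L2norm f + (C + L2norm f) * \<eta>"
    by (simp add: algebra_simps)
  also have "(C + L2norm f) * \<eta> = L2norm f * (L2norm f - C) / 2"
  proof -
    have "z * (y / (2 * z)) = y / 2" if "z \<noteq> 0" for y z :: real using that by simp
    from this[of "C + L2norm f"] show ?thesis using less C unfolding \<eta>_def by auto
  qed
  also have "C * L2norm f + L2norm f * (L2norm f - C) / 2 < (L2norm f)\<^sup>2"
  proof -
    have "0 < L2norm f * (L2norm f - C)" using less C by (intro mult_pos_pos) auto
    then show ?thesis by (simp add: power2_eq_square field_simps)
  qed
  finally show False by simp
qed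

subsection \<open>The fundamental lemma\<close>

text \<open>Boxes are stable under intersection and generate the Borel sets, so a Dynkin argument
  extends the hypothesis to all Borel sets; integrating over the sets where \<open>f\<close> is
  positive or negative then forces f = 0.\<close>

lemma integral_zero_on_boxes_imp_AE_zero:
  fixes f :: "'a::euclidean_space \<Rightarrow> real"
  assumes f: "integrable lebesgue f"
    and box: "\<And>a c. (LINT x|lebesgue. indicator (box a c) x * f x) = 0"
  shows "AE x in lebesgue. f x = 0"
proof -
  define G where "G = range (\<lambda>(a, b). box a b :: 'a set)"
  have sets: "sets borel = sigma_sets UNIV G"
    unfolding G_def by (subst borel_eq_box) (simp add: sets_measure_of)
  have borel: "A \<in> sets lebesgue" if "A \<in> sigma_sets UNIV G" for A
    using that unfolding sets[symmetric] by simp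
  have int: "integrable lebesgue (\<lambda>x. indicator A x * f x)" if "A \<in> sigma_sets UNIV G" for A
    using integrable_real_mult_indicator[OF borel[OF that] f] by (simp add: mult.commute)
  \<comment> \<open>Complements in the Dynkin argument need the integral over the whole space, which
    is exhausted by boxes.\<close>
  have UNIV: "(LINT x|lebesgue. f x) = 0"
  proof -
    define B where "B = (\<lambda>n. box (- (real n *\<^sub>R One)) (real n *\<^sub>R One) :: 'a set)"
    have "(\<lambda>n. LINT x|lebesgue. indicator (B n) x * f x) \<longlonglongrightarrow> (LINT x|lebesgue. f x)"
    proof (rule integral_dominated_convergence[where w = "\<lambda>x. \<bar>f x\<bar>"])
      show "AE x in lebesgue. (\<lambda>n. indicator (B n) x * f x) \<longlonglongrightarrow> f x"
      proof (rule AE_I2)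
        fix x :: 'a
        obtain n :: nat where n: "norm x < n" using reals_Archimedean2 by blast
        have "x \<in> B m" if "m \<ge> n" for m
        proof -
          have "\<bar>x \<bullet> b\<bar> < m" if "b \<in> Basis" for b
            using Basis_le_norm[OF that, of x] n \<open>m \<ge> n\<close> by linarith
          then show ?thesis by (auto simp: B_def mem_box abs_less_iff minus_less_iff)
        qed
        then have "\<forall>m\<ge>n. f x = indicator (B m) x * f x" by simp
        then have "\<forall>\<^sub>F m in sequentially. f x = indicator (B m) x * f x"
          unfolding eventually_sequentially by blast
        then show "(\<lambda>n. indicator (B n) x * f x) \<longlonglongrightarrow> f x"
          by (rule Lim_transform_eventually[OF tendsto_const])
      qed
      show "(\<lambda>x. indicator (B n) x * f x) \<in> borel_measurable lebesgue" for n
        using f by (intro borel_measurable_times borel_measurable_indicator) (auto simp: B_def)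
    qed (use f in \<open>auto simp: indicator_def\<close>)
    then show ?thesis unfolding B_def by (simp add: box LIMSEQ_const_iff)
  qed
  have zero: "(LINT x|lebesgue. indicator A x * f x) = 0" if A: "A \<in> sets borel" for A
  proof -
    have "A \<in> sigma_sets UNIV G" using A sets by simp
    have G_Pow: "G \<subseteq> Pow UNIV" by simp
    have Int: "Int_stable G"
      unfolding Int_stable_def G_def by (auto simp: box_Int_box)
    show ?thesis
      using Int G_Pow \<open>A \<in> sigma_sets UNIV G\<close>
    proof (induction rule: sigma_sets_induct_disjoint)
      case (basic A)
      then show ?case using box by (auto simp: G_def)
    next
      case (compl A)
      have "(LINT x|lebesgue. indicator (UNIV - A) x * f x) = (LINT x|lebesgue. f x - indicator A x * f x)"
        by (intro Bochner_Integration.integral_cong) (auto simp: indicator_def)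
      then show ?case using compl int f UNIV by simp
    next
      case (union A)
      have "set_integrable lebesgue (\<Union>i. A i) f"
        unfolding set_integrable_def using int[OF sigma_sets.Union, of A] union(2) by (simp add: image_subset_iff)
      then have "(LINT x:(\<Union>i. A i)|lebesgue. f x) = (\<Sum>i. (LINT x:(A i)|lebesgue. f x))"
        using union(1,2) by (intro lebesgue_integral_countable_add borel) (auto simp: disjoint_family_on_def)
      then show ?case using union by (simp add: set_lebesgue_integral_def)
    qed (auto simp: G_def)
  qed
  \<comment> \<open>\<open>zero\<close> speaks of Borel sets while \<open>f\<close> is only Lebesgue
    measurable, so the sign sets are those of a Borel version of \<open>f\<close>.\<close>
  obtain f' where f': "f' \<in> borel_measurable lborel" "AE x in lborel. f x = f' x"
    using completion_ex_borel_measurable_real[of f lborel] f by auto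
  have ae: "AE x in lebesgue. f x = f' x" using f'(2) by (rule AE_completion)
  have nonneg_zero: "AE x in lebesgue. indicator A x * g x = 0"
    if "A \<in> sets borel" "integrable lebesgue g" "AE x in lebesgue. indicator A x * g x \<ge> 0"
      "(LINT x|lebesgue. indicator A x * g x) = 0" for A and g :: "'a \<Rightarrow> real"
  proof -
    have "integrable lebesgue (\<lambda>x. indicator A x * g x)"
      using integrable_mult_indicator[of A lebesgue g] that by simp
    from integral_nonneg_eq_0_iff_AE[OF this that(3)] show ?thesis using that(4) by simp
  qed
  have "{x. f' x > 0} \<in> sets borel" "{x. f' x < 0} \<in> sets borel"
    using f'(1) by auto
  then have "AE x in lebesgue. indicator {x. f' x > 0} x * f x = 0"
    and "AE x in lebesgue. indicator {x. f' x < 0} x * (- f x) = 0"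
    using f zero[of "{x. f' x > 0}"] zero[of "{x. f' x < 0}"] ae
    by (intro nonneg_zero; auto simp: indicator_def elim!: eventually_mono)+
  with ae show ?thesis
    by eventually_elim (auto simp: indicator_def split: if_splits)
qed

text \<open>Testing with \<open>bump (n * \<zeta> x)\<close>, where \<zeta> is positive exactly on a
  box, and letting n grow gives a vanishing integral over every open box whose closed box lies in
  \<open>\<Omega>\<close>.\<close>

lemma fundamental_lemma:
  fixes g :: "'a::euclidean_space \<Rightarrow> real"
  assumes "open \<Omega>" and g: "locally_integrable \<Omega> g"
    and zero: "\<And>\<phi>. test_function \<Omega> \<phi> \<Longrightarrow> (LINT x|lebesgue. g x * \<phi> x) = 0"
  shows "AE x in lebesgue. x \<in> \<Omega> \<longrightarrow> g x = 0"
proof -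
  have boxi: "integrable lebesgue (\<lambda>x. indicator (box p q) x * g x)" if pq: "cbox p q \<subseteq> \<Omega>" for p q
  proof -
    have "integrable lebesgue (\<lambda>x. indicator (cbox p q) x *\<^sub>R g x)"
      using g pq by (auto simp: locally_integrable_def set_integrable_def)
    then have "integrable lebesgue (\<lambda>x. indicator (box p q) x *\<^sub>R (indicator (cbox p q) x *\<^sub>R g x))"
      by (rule integrable_mult_indicator[rotated]) simp
    moreover have "(\<lambda>x. indicator (box p q) x *\<^sub>R (indicator (cbox p q) x *\<^sub>R g x)) = (\<lambda>x. indicator (box p q) x * g x)"
      using box_subset_cbox by (auto simp: fun_eq_iff indicator_def)
    ultimately show ?thesis by (simp only:)
  qed
  have box: "(LINT x|lebesgue. indicator (box p q) x * g x) = 0" if pq: "cbox p q \<subseteq> \<Omega>" for p q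
  proof -
    obtain \<zeta> where \<zeta>: "test_function \<Omega> \<zeta>" "\<And>x. \<zeta> x \<ge> 0" "\<And>x. \<zeta> x > 0 \<longleftrightarrow> x \<in> box p q"
      using box_test_function[OF pq] by metis
    have i: "integrable lebesgue (\<lambda>x. indicator (cbox p q) x *\<^sub>R g x)"
      using g pq by (auto simp: locally_integrable_def set_integrable_def)
    have z: "\<zeta> x = 0" if "x \<notin> box p q" for x using \<zeta>(2,3)[of x] that by linarith
    have "(\<lambda>n. LINT x|lebesgue. g x * bump (real n * \<zeta> x)) \<longlonglongrightarrow> (LINT x|lebesgue. indicator (box p q) x * g x)"
    proof (rule integral_dominated_convergence[where w = "\<lambda>x. \<bar>indicator (cbox p q) x *\<^sub>R g x\<bar>"])
      show "(\<lambda>x. indicator (box p q) x * g x) \<in> borel_measurable lebesgue" using boxi[OF pq] by auto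
      show "(\<lambda>x. g x * bump (real n * \<zeta> x)) \<in> borel_measurable lebesgue" for n
        by (rule borel_measurable_integrable[OF locally_integrable_mult_test[OF g test_function_bump_scale[OF \<zeta>(1)]]])
      show "integrable lebesgue (\<lambda>x. \<bar>indicator (cbox p q) x *\<^sub>R g x\<bar>)" using i by (rule integrable_abs)
      show "AE x in lebesgue. (\<lambda>n. g x * bump (real n * \<zeta> x)) \<longlonglongrightarrow> indicator (box p q) x * g x"
      proof (rule AE_I2)
        fix x
        have "(\<lambda>n. g x * bump (real n * \<zeta> x)) \<longlonglongrightarrow> g x * (if \<zeta> x > 0 then 1 else 0)"
          by (intro tendsto_mult tendsto_const bump_scale_tendsto)
        then show "(\<lambda>n. g x * bump (real n * \<zeta> x)) \<longlonglongrightarrow> indicator (box p q) x * g x"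
          using \<zeta>(3)[of x] by (auto simp: indicator_def split: if_splits)
      qed
      show "AE x in lebesgue. norm (g x * bump (real n * \<zeta> x)) \<le> \<bar>indicator (cbox p q) x *\<^sub>R g x\<bar>" for n
      proof (rule AE_I2)
        fix x
        show "norm (g x * bump (real n * \<zeta> x)) \<le> \<bar>indicator (cbox p q) x *\<^sub>R g x\<bar>"
        proof (cases "x \<in> cbox p q")
          case True
          then show ?thesis using bump_le_1 by (simp add: abs_mult mult_left_le)
        next
          case False
          then have "\<zeta> x = 0" using z box_subset_cbox by blast
          then have "bump (real n * \<zeta> x) = 0" by simp
          then show ?thesis by (simp only:) simp
        qed
      qed
    qed
    then show ?thesis
      using zero[OF test_function_bump_scale[OF \<zeta>(1)]] by (simp add: LIMSEQ_const_iff)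
  qed
  have cbox: "AE x in lebesgue. x \<in> cbox a c \<longrightarrow> g x = 0" if ac: "cbox a c \<subseteq> \<Omega>" for a c
  proof -
    have "AE x in lebesgue. indicator (box a c) x * g x = 0"
    proof (rule integral_zero_on_boxes_imp_AE_zero[OF boxi[OF ac]])
      fix a' c'
      obtain p q where pq: "box a' c' \<inter> box a c = box p q" using box_Int_box by blast
      have eq: "(\<lambda>x. indicator (box a' c') x * (indicator (box a c) x * g x)) = (\<lambda>x. indicator (box p q) x * g x)"
        unfolding pq[symmetric] by (auto simp: fun_eq_iff indicator_def)
      show "(LINT x|lebesgue. indicator (box a' c') x * (indicator (box a c) x * g x)) = 0"
      \<comment> \<open>If \<open>box p q\<close> is empty, \<open>cbox p q\<close> may still be
        nonempty and leave \<open>\<Omega>\<close>; only in the other case is it the closure of the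
        open box and hence inside \<open>cbox a c\<close>.\<close>
      proof (cases "box p q = {}")
        case True
        then show ?thesis unfolding eq by simp
      next
        case False
        then have "cbox p q = closure (box p q)" by (simp add: closure_box)
        also have "\<dots> \<subseteq> cbox a c"
          using pq box_subset_cbox by (intro closure_minimal) auto
        finally show ?thesis unfolding eq using box ac by blast
      qed
    qed
    moreover have "AE x in lebesgue. x \<notin> cbox a c - box a c"
      using negligible_frontier_interval[of a c] by (intro AE_not_in) (simp add: negligible_iff_null_sets)
    ultimately show ?thesis by eventually_elim (auto simp: indicator_def)
  qed
  \<comment> \<open>Boxes with rational corners exhaust \<open>\<Omega>\<close> and are countable,
    so their exceptional null sets can be united.\<close>
  let ?a = "\<lambda>f. \<Sum>(i::'a)\<in>Basis. fst (f i) *\<^sub>R i" and ?b = "\<lambda>f. \<Sum>(i::'a)\<in>Basis. snd (f i) *\<^sub>R i"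
  let ?I = "{f \<in> Basis \<rightarrow>\<^sub>E \<rat> \<times> \<rat>. cbox (?a f) (?b f) \<subseteq> \<Omega>}"
  have "countable (Basis \<rightarrow>\<^sub>E \<rat> \<times> \<rat> :: ('a \<Rightarrow> real \<times> real) set)"
    by (intro countable_PiE countable_SIGMA countable_rat) auto
  then have "countable ?I" by (rule countable_subset[rotated]) auto
  then have "AE x in lebesgue. \<forall>f\<in>?I. x \<in> cbox (?a f) (?b f) \<longrightarrow> g x = 0"
    unfolding AE_ball_countable[OF \<open>countable ?I\<close>] using cbox by blast
  then show ?thesis
    using open_UNION_cbox[OF \<open>open \<Omega>\<close>] by (auto elim!: eventually_mono)
qed

section \<open>Weak gradients\<close>

subsection \<open>Differentiation under the integral sign\<close>

lemma smooth_translate_difference_le: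
  assumes "smooth \<phi>" "\<And>x. norm (gradient \<phi> x) \<le> B"
  shows "\<bar>\<phi> (x - s *\<^sub>R e) - \<phi> x\<bar> \<le> B * norm e * \<bar>s\<bar>"
proof -
  have "norm (\<phi> (x - s *\<^sub>R e) - \<phi> x) \<le> B * norm ((x - s *\<^sub>R e) - x)"
  proof (rule differentiable_bound[of UNIV \<phi> "\<lambda>x h. h \<bullet> gradient \<phi> x"])
    show "onorm (\<lambda>h. h \<bullet> gradient \<phi> x) \<le> B" for x
    proof (rule onorm_le)
      fix h
      have "norm (h \<bullet> gradient \<phi> x) \<le> norm h * norm (gradient \<phi> x)" by (simp add: Cauchy_Schwarz_ineq2)
      also have "\<dots> \<le> B * norm h" using mult_left_mono[OF assms(2)[of x] norm_ge_zero[of h]] by (simp add: mult.commute)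
      finally show "norm (h \<bullet> gradient \<phi> x) \<le> B * norm h" .
    qed
  qed (use assms smooth_has_derivative in auto)
  then show ?thesis by (simp add: mult_ac)
qed

text \<open>Outside a ball enlarged by norm e, both \<open>x\<close> and the shifted point miss the
  support; inside, the mean value bound applies. So one compactly supported function dominates all
  difference quotients with |s| \<le> 1, even after multiplication by |u| for a locally integrable
  \<open>u\<close>.\<close>

lemma test_function_translate_difference:
  fixes \<phi> :: "'a::euclidean_space \<Rightarrow> real"
  assumes "test_function UNIV \<phi>"
  obtains C K where "compact K" "C \<ge> 0"
    "\<And>x s. \<bar>s\<bar> \<le> 1 \<Longrightarrow> \<bar>\<phi> (x - s *\<^sub>R e) - \<phi> x\<bar> \<le> \<bar>s\<bar> * (C * indicator K x)"
proof -
  obtain K where K: "smooth \<phi>" "compact K" "\<And>x. x \<notin> K \<Longrightarrow> \<phi> x = 0"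
    using test_functionE[OF assms] by metis
  obtain B where B: "B \<ge> 0" "\<And>x. norm (gradient \<phi> x) \<le> B" using test_function_bounded[OF assms] by metis
  obtain R where R: "\<And>x. x \<in> K \<Longrightarrow> norm x \<le> R" using compact_imp_bounded[OF K(2)] by (auto simp: bounded_iff)
  show thesis
  proof (rule that[of "cball 0 (R + norm e)" "B * norm e"])
    fix x :: 'a and s :: real assume s: "\<bar>s\<bar> \<le> 1"
    show "\<bar>\<phi> (x - s *\<^sub>R e) - \<phi> x\<bar> \<le> \<bar>s\<bar> * (B * norm e * indicator (cball 0 (R + norm e)) x)"
    proof (cases "x \<in> cball 0 (R + norm e)")
      case True
      then show ?thesis using smooth_translate_difference_le[OF K(1) B(2), of x s e] by (simp add: mult.commute)
    next
      case False
      have "norm x \<le> norm (x - s *\<^sub>R e) + norm (s *\<^sub>R e)"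
        using norm_triangle_ineq[of "x - s *\<^sub>R e" "s *\<^sub>R e"] by simp
      moreover have "norm (s *\<^sub>R e) \<le> norm e" using s by (simp add: mult_left_le_one_le)
      moreover have "norm x > R + norm e" using False by simp
      ultimately have "x \<notin> K" "x - s *\<^sub>R e \<notin> K"
        using R[of x] R[of "x - s *\<^sub>R e"] norm_ge_zero[of e] by (smt (verit))+
      then show ?thesis using K(3) B(1) by (simp add: indicator_def)
    qed
  qed (use B in auto)
qed

text \<open>\<open>u\<close> is merely locally integrable, so the shift and the derivative are put
  on \<phi>.\<close>

lemma tendsto_integral_difference_quotient:
  fixes u :: "'a::euclidean_space \<Rightarrow> real"
  assumes u: "locally_integrable UNIV u" and \<phi>: "test_function UNIV \<phi>"
  shows "((\<lambda>s. LINT x|lebesgue. u x * ((\<phi> (x - s *\<^sub>R e) - \<phi> x) / s)) \<longlongrightarrow>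
    - (LINT x|lebesgue. u x * (e \<bullet> gradient \<phi> x))) (at 0)"
proof -
  let ?d = "\<lambda>x. e \<bullet> gradient \<phi> x"
  let ?q = "\<lambda>s x. (\<phi> (x - s *\<^sub>R e) - \<phi> x) / s"
  have sm: "smooth \<phi>" using test_function_smooth \<phi> .
  have um: "integrable lebesgue (\<lambda>x. indicator K x *\<^sub>R u x)" if "compact K" for K
    using u that by (simp add: locally_integrable_def set_integrable_def)
  obtain C K where CK: "compact K" "C \<ge> 0"
    "\<And>x s. \<bar>s\<bar> \<le> 1 \<Longrightarrow> \<bar>\<phi> (x - s *\<^sub>R e) - \<phi> x\<bar> \<le> \<bar>s\<bar> * (C * indicator K x)"
    using test_function_translate_difference[OF \<phi>] by metis
  have meas: "(\<lambda>x. u x * \<psi> x) \<in> borel_measurable lebesgue" if "test_function UNIV \<psi>" for \<psi>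
    using locally_integrable_mult_test[OF u that] by auto
  have tq: "test_function UNIV (\<lambda>x. ?q s x)" for s
    using test_function_cmult[OF test_function_add[OF test_function_translate[OF \<phi>, of "- s *\<^sub>R e"] test_function_cmult[OF \<phi>, of "-1"]], of "1 / s"]
    by simp
  have tg: "test_function UNIV (\<lambda>x. e \<bullet> gradient \<phi> x)"
    unfolding gradient_def inner_sum_right inner_scaleR_right
    by (intro test_function_sum, subst mult.commute) (intro test_function_cmult test_function_partial \<phi>)
  \<comment> \<open>The domination is available for |s| \<le> 1, which restricts the limit to an
    interval; it is taken along sequences to fit dominated convergence.\<close>
  have "((\<lambda>s. LINT x|lebesgue. u x * ?q s x) \<longlongrightarrow>
    (LINT x|lebesgue. - (u x * ?d x))) (at 0 within {-1<..<1})"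
    unfolding tendsto_at_iff_sequentially comp_def
  proof (intro allI impI)
    fix X :: "nat \<Rightarrow> real" assume X: "\<forall>i. X i \<in> {-1<..<1} - {0}" "X \<longlonglongrightarrow> 0"
    show "(\<lambda>i. LINT x|lebesgue. u x * ?q (X i) x) \<longlonglongrightarrow>
      (LINT x|lebesgue. - (u x * ?d x))"
    proof (rule integral_dominated_convergence[where w = "\<lambda>x. C * \<bar>indicator K x *\<^sub>R u x\<bar>"])
      show "(\<lambda>x. - (u x * ?d x)) \<in> borel_measurable lebesgue"
        using meas[OF tg] by simp
      show "(\<lambda>x. u x * ?q (X i) x) \<in> borel_measurable lebesgue" for i
        by (rule meas[OF tq])
      show "integrable lebesgue (\<lambda>x. C * \<bar>indicator K x *\<^sub>R u x\<bar>)"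
        using integrable_abs[OF um[OF CK(1)]] by simp
      show "AE x in lebesgue. (\<lambda>i. u x * ?q (X i) x) \<longlonglongrightarrow> - (u x * ?d x)"
      proof (rule AE_I2)
        fix x
        have "((\<lambda>s. x - s *\<^sub>R e) has_derivative (\<lambda>s. - (s *\<^sub>R e))) (at 0)"
          by (auto intro!: derivative_eq_intros)
        moreover have "(\<phi> has_derivative (\<lambda>h. h \<bullet> gradient \<phi> x)) (at (x - 0 *\<^sub>R e))"
          using smooth_has_derivative[OF sm, of x] by simp
        ultimately have "((\<lambda>s. \<phi> (x - s *\<^sub>R e)) has_derivative (\<lambda>s. - (s *\<^sub>R e) \<bullet> gradient \<phi> x)) (at 0)"
          by (rule has_derivative_compose)
        then have "((\<lambda>s. \<phi> (x - s *\<^sub>R e)) has_real_derivative - (e \<bullet> gradient \<phi> x)) (at 0)"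
          unfolding has_field_derivative_def by (rule has_derivative_eq_rhs) (simp add: fun_eq_iff)
        then have "((\<lambda>s. ?q s x) \<longlongrightarrow> - (e \<bullet> gradient \<phi> x)) (at 0)"
          by (simp add: DERIV_def)
        moreover have "filterlim X (at 0) sequentially"
          using X by (auto simp: filterlim_at)
        ultimately have "(\<lambda>i. ?q (X i) x) \<longlonglongrightarrow> - (e \<bullet> gradient \<phi> x)"
          by (rule filterlim_compose)
        then have "(\<lambda>i. u x * ?q (X i) x) \<longlonglongrightarrow> u x * - (e \<bullet> gradient \<phi> x)"
          by (rule tendsto_mult_left)
        then show "(\<lambda>i. u x * ?q (X i) x) \<longlonglongrightarrow> - (u x * ?d x)"
          by simp
      qed
      show "AE x in lebesgue. norm (u x * ?q (X i) x) \<le> C * \<bar>indicator K x *\<^sub>R u x\<bar>" for i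
      proof (rule AE_I2)
        fix x
        have i: "\<bar>X i\<bar> \<le> 1" "X i \<noteq> 0" using X(1)[rule_format, of i] by auto
        have "\<bar>?q (X i) x\<bar> \<le> C * indicator K x"
          using CK(3)[OF i(1), of x] i(2) by (simp add: field_simps)
        then have "\<bar>u x\<bar> * \<bar>?q (X i) x\<bar> \<le> \<bar>u x\<bar> * (C * indicator K x)"
          by (rule mult_left_mono) simp
        then show "norm (u x * ?q (X i) x) \<le> C * \<bar>indicator K x *\<^sub>R u x\<bar>"
          by (simp add: abs_mult mult_ac)
      qed
    qed
  qed
  then show ?thesis
    by (simp add: at_within_open[of 0 "{-1<..<1}"])
qed

text \<open>The difference quotient at \<open>h\<close> is the one at 0 for the test function
  already translated by \<open>h\<close> in direction \<open>e\<close>.\<close>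

lemma DERIV_integral_translate:
  fixes u :: "'a::euclidean_space \<Rightarrow> real"
  assumes u: "locally_integrable UNIV u" and \<phi>: "test_function UNIV \<phi>"
  shows "((\<lambda>h. LINT x|lebesgue. u x * \<phi> (x - h *\<^sub>R e)) has_real_derivative
    - (LINT x|lebesgue. u x * (e \<bullet> gradient (\<lambda>x. \<phi> (x - h *\<^sub>R e)) x))) (at h)"
proof -
  define \<psi> where "\<psi> = (\<lambda>s x. \<phi> (x - s *\<^sub>R e))"
  have \<psi>: "test_function UNIV (\<psi> s)" for s
    using test_function_translate[OF \<phi>, of "- s *\<^sub>R e"] by (simp add: \<psi>_def)
  have int: "integrable lebesgue (\<lambda>x. u x * \<psi> s x)" for s
    using locally_integrable_mult_test[OF u \<psi>] .
  have "((LINT x|lebesgue. u x * \<psi> (h + s) x) - (LINT x|lebesgue. u x * \<psi> h x)) / s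
      = (LINT x|lebesgue. u x * ((\<psi> h (x - s *\<^sub>R e) - \<psi> h x) / s))" for s
  proof -
    have "(\<lambda>x. u x * ((\<psi> h (x - s *\<^sub>R e) - \<psi> h x) / s)) = (\<lambda>x. (u x * \<psi> (h + s) x - u x * \<psi> h x) / s)"
      by (simp add: fun_eq_iff \<psi>_def algebra_simps)
    then show ?thesis using int by simp
  qed
  note eq = this
  show ?thesis
    using tendsto_integral_difference_quotient[OF u \<psi>[of h], of e]
    unfolding eq[symmetric] unfolding DERIV_def \<psi>_def .
qed

lemma locally_integrable_continuous:
  fixes f :: "'a::euclidean_space \<Rightarrow> 'b::euclidean_space"
  assumes "continuous_on UNIV f" shows "locally_integrable \<Omega> f"
  unfolding locally_integrable_def set_integrable_def
proof (intro allI impI)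
  fix C assume "compact C \<and> C \<subseteq> \<Omega>"
  then have "integrable lborel (\<lambda>x. indicator C x *\<^sub>R f x)"
    using assms by (intro borel_integrable_compact) (auto intro: continuous_on_subset)
  then show "integrable lebesgue (\<lambda>x. indicator C x *\<^sub>R f x)"
    using integrable_completion borel_measurable_integrable by blast
qed

text \<open>The integral of a translate of \<phi> does not depend on the shift, so its derivative is
  0; differentiation under the integral sign with u = 1 identifies this derivative.\<close>

lemma integral_partial_derivative:
  assumes \<phi>: "test_function \<Omega> \<phi>" and b: "b \<in> Basis"
  shows "(LINT x|lebesgue. partial_derivative b \<phi> x) = 0"
proof -
  have \<phi>': "test_function UNIV \<phi>" using \<phi> test_function_subset by blast
  have "(LINT x|lebesgue. \<phi> (x - h *\<^sub>R b)) = (LINT x|lebesgue. \<phi> x)" for h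
    using integral_translation[of \<phi> "- h *\<^sub>R b"] smooth_measurable test_function_smooth[OF \<phi>] by auto
  then have "((\<lambda>h. LINT x|lebesgue. 1 * \<phi> (x - h *\<^sub>R b)) has_real_derivative 0) (at 0)"
    by simp
  from DERIV_unique[OF this DERIV_integral_translate[OF locally_integrable_continuous[OF continuous_on_const] \<phi>']]
  show ?thesis using b by (simp add: inner_commute[of b] gradient_inner)
qed

lemma set_integral_mult_test:
  fixes g :: "'a::euclidean_space \<Rightarrow> real"
  assumes "test_function \<Omega> \<phi>"
  shows "(LINT x:\<Omega>|lebesgue. g x * \<phi> x) = (LINT x|lebesgue. g x * \<phi> x)"
proof -
  have "\<phi> x = 0" if "x \<notin> \<Omega>" for x using test_functionE[OF assms] that by (metis subsetD)
  then show ?thesis unfolding set_lebesgue_integral_def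
    by (intro Bochner_Integration.integral_cong) (auto simp: indicator_def)
qed

section \<open>Uniqueness, linearity and product rule of weak gradients\<close>

lemma has_weak_gradient_iff:
  "has_weak_gradient \<Omega> u G \<longleftrightarrow> locally_integrable \<Omega> u \<and> locally_integrable \<Omega> G \<and>
     (\<forall>\<phi>. test_function \<Omega> \<phi> \<longrightarrow> (\<forall>b\<in>Basis. (LINT x|lebesgue. u x * partial_derivative b \<phi> x)
        = - (LINT x|lebesgue. (G x \<bullet> b) * \<phi> x)))"
  unfolding has_weak_gradient_def by (auto simp: set_integral_mult_test test_function_partial)

lemma locally_integrable_inner:
  "locally_integrable \<Omega> G \<Longrightarrow> locally_integrable \<Omega> (\<lambda>x. G x \<bullet> b)"
  unfolding locally_integrable_def set_integrable_def
  using integrable_inner_left[of b lebesgue] by (fastforce simp: inner_scaleR_left[symmetric] simp del: inner_scaleR_left)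

lemma locally_integrable_diff:
  "locally_integrable \<Omega> f \<Longrightarrow> locally_integrable \<Omega> g \<Longrightarrow> locally_integrable \<Omega> (\<lambda>x. f x - g x)"
  unfolding locally_integrable_def by (auto intro: set_integral_diff)

text \<open>The fundamental lemma applies to each component of G - H. It makes the
  \<open>SOME\<close> in \<open>weak_gradient\<close> harmless: every choice agrees almost
  everywhere on \<open>\<Omega>\<close>.\<close>

lemma weak_gradient_unique:
  fixes u :: "'a::euclidean_space \<Rightarrow> real"
  assumes "open \<Omega>" "has_weak_gradient \<Omega> u G" "has_weak_gradient \<Omega> u H"
  shows "AE x in lebesgue. x \<in> \<Omega> \<longrightarrow> G x = H x"
proof -
  have GH: "locally_integrable \<Omega> G" "locally_integrable \<Omega> H" using assms by (auto simp: has_weak_gradient_iff)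
  have "AE x in lebesgue. x \<in> \<Omega> \<longrightarrow> G x \<bullet> b - H x \<bullet> b = 0" if b: "b \<in> Basis" for b
  proof (rule fundamental_lemma[OF assms(1)])
    show "locally_integrable \<Omega> (\<lambda>x. G x \<bullet> b - H x \<bullet> b)"
      by (intro locally_integrable_diff locally_integrable_inner GH)
    fix \<phi> assume \<phi>: "test_function \<Omega> \<phi>"
    have "(LINT x|lebesgue. (G x \<bullet> b - H x \<bullet> b) * \<phi> x) = (LINT x|lebesgue. (G x \<bullet> b) * \<phi> x - (H x \<bullet> b) * \<phi> x)"
      by (simp add: left_diff_distrib)
    also have "\<dots> = (LINT x|lebesgue. (G x \<bullet> b) * \<phi> x) - (LINT x|lebesgue. (H x \<bullet> b) * \<phi> x)"
      by (intro Bochner_Integration.integral_diff locally_integrable_mult_test[OF _ \<phi>] locally_integrable_inner GH)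
    also have "\<dots> = 0" using assms(2,3) \<phi> b unfolding has_weak_gradient_iff by (metis add.inverse_inverse diff_self)
    finally show "(LINT x|lebesgue. (G x \<bullet> b - H x \<bullet> b) * \<phi> x) = 0" .
  qed
  then have "AE x in lebesgue. \<forall>b\<in>Basis. x \<in> \<Omega> \<longrightarrow> G x \<bullet> b - H x \<bullet> b = 0"
    by (intro AE_ball_countable[THEN iffD2]) (auto intro: countable_finite)
  then show ?thesis by eventually_elim (auto intro: euclidean_eqI)
qed

lemma has_weak_gradient_diff:
  assumes "has_weak_gradient \<Omega> u G" "has_weak_gradient \<Omega> v H"
  shows "has_weak_gradient \<Omega> (\<lambda>x. u x - v x) (\<lambda>x. G x - H x)"
  unfolding has_weak_gradient_iff
proof (intro conjI allI impI ballI)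
  note loc = assms[unfolded has_weak_gradient_iff, THEN conjunct1]
    assms[unfolded has_weak_gradient_iff, THEN conjunct2, THEN conjunct1]
  show "locally_integrable \<Omega> (\<lambda>x. u x - v x)" "locally_integrable \<Omega> (\<lambda>x. G x - H x)"
    using loc by (auto intro: locally_integrable_diff)
  fix \<phi> b assume \<phi>: "test_function \<Omega> \<phi>" and b: "b \<in> (Basis :: 'a set)"
  note int = locally_integrable_mult_test[OF _ \<phi>] locally_integrable_mult_test[OF _ test_function_partial[OF \<phi> b]]
  show "(LINT x|lebesgue. (u x - v x) * partial_derivative b \<phi> x) = - (LINT x|lebesgue. ((G x - H x) \<bullet> b) * \<phi> x)"
    using assms \<phi> b int loc
    by (simp add: has_weak_gradient_iff left_diff_distrib inner_diff_left locally_integrable_inner)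
qed

lemma test_function_has_weak_gradient:
  assumes \<phi>: "test_function \<Omega> \<phi>" shows "has_weak_gradient \<Omega> \<phi> (gradient \<phi>)"
  unfolding has_weak_gradient_iff
proof (intro conjI allI impI ballI)
  have sm: "smooth \<phi>" using \<phi> test_function_smooth by blast
  show "locally_integrable \<Omega> \<phi>" "locally_integrable \<Omega> (gradient \<phi>)"
    using sm by (auto intro: locally_integrable_continuous smooth_imp_continuous smooth_gradient_continuous)
  fix \<psi> b assume \<psi>: "test_function \<Omega> \<psi>" and b: "b \<in> (Basis :: 'a set)"
  have "0 = (LINT x|lebesgue. partial_derivative b (\<lambda>x. \<phi> x * \<psi> x) x)"
    using integral_partial_derivative[OF test_function_mult_smooth[OF \<psi> sm] b] by simp
  also have "\<dots> = (LINT x|lebesgue. \<phi> x * partial_derivative b \<psi> x + partial_derivative b \<phi> x * \<psi> x)"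
    using \<phi> \<psi> by (simp add: partial_derivative_mult smooth_imp_differentiable test_function_smooth)
  also have "\<dots> = (LINT x|lebesgue. \<phi> x * partial_derivative b \<psi> x) + (LINT x|lebesgue. partial_derivative b \<phi> x * \<psi> x)"
    using \<phi> \<psi> b by (intro Bochner_Integration.integral_add L2_mult_integrable test_function_L2) (auto intro: test_function_partial)
  finally show "(LINT x|lebesgue. \<phi> x * partial_derivative b \<psi> x) = - (LINT x|lebesgue. (gradient \<phi> x \<bullet> b) * \<psi> x)"
    using b by (simp add: gradient_inner)
qed

text \<open>One statement for the products of the Leibniz rule: real with real, real with vector,
  vector with real. On a compact subset \<open>C\<close> of \<open>\<Omega>\<close> only the values
  of \<open>f\<close> on C \<inter> S count, which is a compact subset of \<open>\<Omega>'\<close>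
  where \<open>h\<close> is bounded.\<close>

lemma locally_integrable_bilinear:
  fixes f :: "'a::euclidean_space \<Rightarrow> 'b::euclidean_space" and h :: "'a \<Rightarrow> 'c::euclidean_space"
    and B :: "'c \<Rightarrow> 'b \<Rightarrow> 'd::euclidean_space"
  assumes B: "bounded_bilinear B" and f: "locally_integrable \<Omega>' f" and h: "continuous_on UNIV h"
    and S: "closed S" "\<And>x. x \<notin> S \<Longrightarrow> h x = 0" "S \<inter> \<Omega> \<subseteq> \<Omega>'"
  shows "locally_integrable \<Omega> (\<lambda>x. B (h x) (f x))"
  unfolding locally_integrable_def set_integrable_def
proof (intro allI impI)
  interpret bounded_bilinear B by (rule B)
  fix C assume C: "compact C \<and> C \<subseteq> \<Omega>"
  have K: "compact (C \<inter> S)" "C \<inter> S \<subseteq> \<Omega>'" using C S by (auto intro: compact_Int_closed)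
  have i: "integrable lebesgue (\<lambda>x. indicator (C \<inter> S) x *\<^sub>R f x)"
    using f K by (simp add: locally_integrable_def set_integrable_def)
  obtain M where M: "\<And>x. x \<in> C \<inter> S \<Longrightarrow> norm (h x) \<le> M"
    using compact_imp_bounded[OF compact_continuous_image[OF continuous_on_subset[OF h] K(1)]]
    by (auto simp: bounded_iff)
  obtain L where L: "L > 0" "\<And>a b. norm (B a b) \<le> norm a * norm b * L" using pos_bounded by blast
  have eq: "(\<lambda>x. indicator C x *\<^sub>R B (h x) (f x)) = (\<lambda>x. B (h x) (indicator (C \<inter> S) x *\<^sub>R f x))"
    using S(2) by (auto simp: fun_eq_iff indicator_def zero_left zero_right)
  show "integrable lebesgue (\<lambda>x. indicator C x *\<^sub>R B (h x) (f x))"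
    unfolding eq
  proof (rule Bochner_Integration.integrable_bound)
    show "integrable lebesgue (\<lambda>x. (\<bar>M\<bar> * L) *\<^sub>R (indicator (C \<inter> S) x *\<^sub>R f x))"
      by (intro integrable_scaleR_right) (rule i)
    show "(\<lambda>x. B (h x) (indicator (C \<inter> S) x *\<^sub>R f x)) \<in> borel_measurable lebesgue"
      using i continuous_measurable_lebesgue[OF h]
      by (intro borel_measurable_continuous_Pair[where H = B] continuous_on continuous_on_fst continuous_on_snd continuous_on_id) auto
    show "AE x in lebesgue. norm (B (h x) (indicator (C \<inter> S) x *\<^sub>R f x)) \<le> norm ((\<bar>M\<bar> * L) *\<^sub>R (indicator (C \<inter> S) x *\<^sub>R f x))"
    proof (rule AE_I2)
      fix x
      show "norm (B (h x) (indicator (C \<inter> S) x *\<^sub>R f x)) \<le> norm ((\<bar>M\<bar> * L) *\<^sub>R (indicator (C \<inter> S) x *\<^sub>R f x))"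
      proof (cases "x \<in> C \<inter> S")
        case True
        have "norm (B (h x) (f x)) \<le> norm (h x) * norm (f x) * L" by (rule L)
        also have "\<dots> \<le> \<bar>M\<bar> * norm (f x) * L"
          using M[OF True] L(1) by (intro mult_right_mono) auto
        finally show ?thesis using True L(1) by (simp add: mult_ac abs_mult)
      qed (simp add: zero_right)
    qed
  qed
qed

lemma locally_integrable_add:
  "locally_integrable \<Omega> f \<Longrightarrow> locally_integrable \<Omega> g \<Longrightarrow> locally_integrable \<Omega> (\<lambda>x. f x + g x)"
  unfolding locally_integrable_def by (auto intro: set_integral_add)

text \<open>The gradient of \<open>u\<close> is tested with \<zeta> \<phi>. The product may live on
  an \<open>\<Omega>\<close> other than the domain \<open>\<Omega>'\<close> of \<open>u\<close>, as
  \<zeta> vanishes off a closed \<open>S\<close> that meets \<open>\<Omega>\<close> only inside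
  \<open>\<Omega>'\<close>; cutting off an admissible function for the capacity relies on this
  change of domain.\<close>

lemma has_weak_gradient_mult:
  fixes u :: "'a::euclidean_space \<Rightarrow> real"
  assumes u: "has_weak_gradient \<Omega>' u G" and \<zeta>: "smooth \<zeta>"
    and S: "closed S" "\<And>x. x \<notin> S \<Longrightarrow> \<zeta> x = 0" "S \<inter> \<Omega> \<subseteq> \<Omega>'"
  shows "has_weak_gradient \<Omega> (\<lambda>x. \<zeta> x * u x) (\<lambda>x. \<zeta> x *\<^sub>R G x + u x *\<^sub>R gradient \<zeta> x)"
  unfolding has_weak_gradient_iff
proof (intro conjI allI impI ballI)
  have loc: "locally_integrable \<Omega>' u" "locally_integrable \<Omega>' G" using u by (auto simp: has_weak_gradient_iff)
  have g0: "gradient \<zeta> x = 0" if "x \<notin> S" for x using gradient_zero_outside[OF S(1) _ that] S(2) by blast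
  show "locally_integrable \<Omega> (\<lambda>x. \<zeta> x * u x)"
    by (rule locally_integrable_bilinear[OF bounded_bilinear_mult loc(1) smooth_imp_continuous[OF \<zeta>] S])
  have "locally_integrable \<Omega> (\<lambda>x. \<zeta> x *\<^sub>R G x)"
    by (rule locally_integrable_bilinear[OF bounded_bilinear_scaleR loc(2) smooth_imp_continuous[OF \<zeta>] S])
  moreover have "locally_integrable \<Omega> (\<lambda>x. u x *\<^sub>R gradient \<zeta> x)"
    using locally_integrable_bilinear[OF bounded_bilinear.flip[OF bounded_bilinear_scaleR] loc(1) smooth_gradient_continuous[OF \<zeta>] S(1) g0 S(3)] .
  ultimately show "locally_integrable \<Omega> (\<lambda>x. \<zeta> x *\<^sub>R G x + u x *\<^sub>R gradient \<zeta> x)"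
    by (rule locally_integrable_add)
  fix \<phi> b assume \<phi>: "test_function \<Omega> \<phi>" and b: "b \<in> (Basis :: 'a set)"
  obtain K where K: "smooth \<phi>" "compact K" "K \<subseteq> \<Omega>" "\<And>x. x \<notin> K \<Longrightarrow> \<phi> x = 0"
    using test_functionE[OF \<phi>] by metis
  \<comment> \<open>\<phi> itself need not be a test function on \<open>\<Omega>'\<close>, but its
    products with \<zeta> and the derivatives of \<zeta> are supported in this compact subset of
    \<open>\<Omega>'\<close>.\<close>
  have KS: "compact (K \<inter> S)" "K \<inter> S \<subseteq> \<Omega>'" using K S by (auto intro: compact_Int_closed)
  have p0: "partial_derivative b \<zeta> x = 0" if "x \<notin> S" for x
    using partial_derivative_zero_outside[OF S(1) _ that] S(2) by blast
  have t1: "test_function \<Omega>' (\<lambda>x. \<zeta> x * \<phi> x)"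
    by (rule test_functionI[OF smooth_mult[OF \<zeta> K(1)] KS]) (use S K in auto)
  have t2: "test_function \<Omega>' (\<lambda>x. partial_derivative b \<zeta> x * \<phi> x)"
    by (rule test_functionI[OF smooth_mult[OF smooth_partial[OF \<zeta> b] K(1)] KS]) (use p0 K in auto)
  have t3: "test_function \<Omega>' (\<lambda>x. \<zeta> x * partial_derivative b \<phi> x)"
    by (rule test_functionI[OF smooth_mult[OF \<zeta> smooth_partial[OF K(1) b]] KS])
       (use S K partial_derivative_zero_outside[OF compact_imp_closed[OF K(2)], of \<phi>] in auto)
  note int = locally_integrable_mult_test[OF loc(1) t2] locally_integrable_mult_test[OF loc(1) t3]
    locally_integrable_mult_test[OF locally_integrable_inner[OF loc(2)] t1, of b]
  have "(LINT x|lebesgue. u x * (\<zeta> x * partial_derivative b \<phi> x)) + (LINT x|lebesgue. u x * (partial_derivative b \<zeta> x * \<phi> x))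
      = (LINT x|lebesgue. u x * partial_derivative b (\<lambda>x. \<zeta> x * \<phi> x) x)"
    using int \<zeta> K by (simp add: partial_derivative_mult smooth_imp_differentiable distrib_left)
  also have "\<dots> = - (LINT x|lebesgue. (G x \<bullet> b) * (\<zeta> x * \<phi> x))"
    using u t1 b unfolding has_weak_gradient_iff by blast
  finally have "(LINT x|lebesgue. u x * (\<zeta> x * partial_derivative b \<phi> x))
      = - ((LINT x|lebesgue. (G x \<bullet> b) * (\<zeta> x * \<phi> x)) + (LINT x|lebesgue. u x * (partial_derivative b \<zeta> x * \<phi> x)))"
    by simp
  also have "(LINT x|lebesgue. (G x \<bullet> b) * (\<zeta> x * \<phi> x)) + (LINT x|lebesgue. u x * (partial_derivative b \<zeta> x * \<phi> x))
      = (LINT x|lebesgue. (G x \<bullet> b) * (\<zeta> x * \<phi> x) + u x * (partial_derivative b \<zeta> x * \<phi> x))"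
    using int by simp
  finally show "(LINT x|lebesgue. \<zeta> x * u x * partial_derivative b \<phi> x)
      = - (LINT x|lebesgue. ((\<zeta> x *\<^sub>R G x + u x *\<^sub>R gradient \<zeta> x) \<bullet> b) * \<phi> x)"
    using b by (simp add: inner_add_left gradient_inner algebra_simps)
qed

section \<open>Sobolev functions\<close>

definition sq_integral :: "'a::euclidean_space set \<Rightarrow> ('a \<Rightarrow> 'b::euclidean_space) \<Rightarrow> real" where
  "sq_integral \<Omega> f = (LINT x:\<Omega>|lebesgue. (norm (f x))\<^sup>2)"

lemma sq_integral_nonneg [simp]: "sq_integral \<Omega> f \<ge> 0"
  by (auto simp: sq_integral_def set_lebesgue_integral_def intro!: integral_nonneg_AE)

lemma square_integrable_measurable:
  "square_integrable \<Omega> f \<Longrightarrow> (\<lambda>x. indicator \<Omega> x *\<^sub>R f x) \<in> borel_measurable lebesgue"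
  and square_integrable_integrable:
  "square_integrable \<Omega> f \<Longrightarrow> integrable lebesgue (\<lambda>x. (norm (indicator \<Omega> x *\<^sub>R f x))\<^sup>2)"
  by (auto simp: square_integrable_def set_borel_measurable_def set_integrable_def power_mult_distrib
      indicator_def cong: if_cong elim!: back_subst[of "integrable lebesgue"])

lemma square_integrableI:
  assumes "(\<lambda>x. indicator \<Omega> x *\<^sub>R f x) \<in> borel_measurable lebesgue"
    and "integrable lebesgue (\<lambda>x. (norm (indicator \<Omega> x *\<^sub>R f x))\<^sup>2)"
  shows "square_integrable \<Omega> f"
proof -
  have "(\<lambda>x. (norm (indicator \<Omega> x *\<^sub>R f x))\<^sup>2) = (\<lambda>x. indicator \<Omega> x *\<^sub>R (norm (f x))\<^sup>2)"
    by (auto simp: fun_eq_iff indicator_def)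
  then show ?thesis
    using assms by (simp add: square_integrable_def set_borel_measurable_def set_integrable_def)
qed

lemma sq_integral_eq: "sq_integral \<Omega> f = (LINT x|lebesgue. (norm (indicator \<Omega> x *\<^sub>R f x))\<^sup>2)"
  unfolding sq_integral_def set_lebesgue_integral_def
  by (intro Bochner_Integration.integral_cong) (auto simp: indicator_def)

text \<open>The pointwise bound is squared with (p + q)^2 \<le> 2 p^2 + 2 q^2. The alternative
  \<open>f x = 0\<close> lets the comparison functions live on another set
  \<open>\<Omega>'\<close>.\<close>

lemma square_integrable_bound:
  fixes f :: "'a::euclidean_space \<Rightarrow> 'b::euclidean_space" and g :: "'a \<Rightarrow> 'c::euclidean_space" and h :: "'a \<Rightarrow> 'd::euclidean_space"
  assumes m: "(\<lambda>x. indicator \<Omega> x *\<^sub>R f x) \<in> borel_measurable lebesgue"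
    and g: "square_integrable \<Omega>' g" and h: "square_integrable \<Omega>' h"
    and c: "\<alpha> \<ge> 0" "\<beta> \<ge> 0"
    and le: "AE x in lebesgue. x \<in> \<Omega> \<longrightarrow> f x = 0 \<or> x \<in> \<Omega>' \<and> norm (f x) \<le> \<alpha> * norm (g x) + \<beta> * norm (h x)"
  shows "square_integrable \<Omega> f" "sq_integral \<Omega> f \<le> 2 * \<alpha>\<^sup>2 * sq_integral \<Omega>' g + 2 * \<beta>\<^sup>2 * sq_integral \<Omega>' h"
proof -
  let ?w = "\<lambda>x. 2 * \<alpha>\<^sup>2 * (norm (indicator \<Omega>' x *\<^sub>R g x))\<^sup>2 + 2 * \<beta>\<^sup>2 * (norm (indicator \<Omega>' x *\<^sub>R h x))\<^sup>2"
  have w: "integrable lebesgue ?w"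
    using square_integrable_integrable[OF g] square_integrable_integrable[OF h] by simp
  have le': "AE x in lebesgue. (norm (indicator \<Omega> x *\<^sub>R f x))\<^sup>2 \<le> ?w x"
    using le
  proof eventually_elim
    case (elim x)
    show ?case
    proof (cases "x \<in> \<Omega> \<and> f x \<noteq> 0")
      case True
      then have x: "x \<in> \<Omega>'" "norm (f x) \<le> \<alpha> * norm (g x) + \<beta> * norm (h x)" using elim by auto
      have "(norm (f x))\<^sup>2 \<le> (\<alpha> * norm (g x) + \<beta> * norm (h x))\<^sup>2" using x(2) by (intro power_mono) auto
      also have "\<dots> \<le> 2 * (\<alpha> * norm (g x))\<^sup>2 + 2 * (\<beta> * norm (h x))\<^sup>2"
        using sum_squares_bound[of "\<alpha> * norm (g x)" "\<beta> * norm (h x)"] by (simp add: power2_sum)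
      finally show ?thesis using True x by (simp add: power_mult_distrib)
    next
      case False
      then show ?thesis by auto
    qed
  qed
  have int: "integrable lebesgue (\<lambda>x. (norm (indicator \<Omega> x *\<^sub>R f x))\<^sup>2)"
  proof (rule Bochner_Integration.integrable_bound[OF w])
    show "(\<lambda>x. (norm (indicator \<Omega> x *\<^sub>R f x))\<^sup>2) \<in> borel_measurable lebesgue"
      using m by measurable
    show "AE x in lebesgue. norm ((norm (indicator \<Omega> x *\<^sub>R f x))\<^sup>2) \<le> norm (?w x)"
      using le'
    proof eventually_elim
      case (elim x)
      have "norm ((norm (indicator \<Omega> x *\<^sub>R f x))\<^sup>2) = (norm (indicator \<Omega> x *\<^sub>R f x))\<^sup>2"
        unfolding real_norm_def by (rule abs_of_nonneg) (rule zero_le_power2)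
      also note elim
      also have "?w x \<le> norm (?w x)" unfolding real_norm_def by (rule abs_ge_self)
      finally show ?case .
    qed
  qed
  then show "square_integrable \<Omega> f" using m by (rule square_integrableI[rotated])
  have "sq_integral \<Omega> f \<le> (LINT x|lebesgue. ?w x)"
    unfolding sq_integral_eq by (rule integral_mono_AE[OF int w le'])
  also have "\<dots> = 2 * \<alpha>\<^sup>2 * sq_integral \<Omega>' g + 2 * \<beta>\<^sup>2 * sq_integral \<Omega>' h"
    unfolding sq_integral_eq using square_integrable_integrable[OF g] square_integrable_integrable[OF h] by simp
  finally show "sq_integral \<Omega> f \<le> 2 * \<alpha>\<^sup>2 * sq_integral \<Omega>' g + 2 * \<beta>\<^sup>2 * sq_integral \<Omega>' h" .
qed

lemma square_integrable_cong_AE: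
  fixes f g :: "'a::euclidean_space \<Rightarrow> 'b::euclidean_space"
  assumes "square_integrable \<Omega> f" and ae: "AE x in lebesgue. x \<in> \<Omega> \<longrightarrow> f x = g x"
  shows "square_integrable \<Omega> g" "sq_integral \<Omega> g = sq_integral \<Omega> f"
proof -
  have ae': "AE x in lebesgue. indicator \<Omega> x *\<^sub>R f x = indicator \<Omega> x *\<^sub>R g x"
    using ae by eventually_elim (auto simp: indicator_def)
  have m: "(\<lambda>x. indicator \<Omega> x *\<^sub>R g x) \<in> borel_measurable lebesgue"
    using borel_measurable_AE[OF square_integrable_measurable[OF assms(1)] ae'] .
  have ae2: "AE x in lebesgue. (norm (indicator \<Omega> x *\<^sub>R f x))\<^sup>2 = (norm (indicator \<Omega> x *\<^sub>R g x))\<^sup>2"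
    using ae' by eventually_elim (simp only:)
  have m2: "(\<lambda>x. (norm (indicator \<Omega> x *\<^sub>R f x))\<^sup>2) \<in> borel_measurable lebesgue"
    using square_integrable_measurable[OF assms(1)] by measurable
  show "square_integrable \<Omega> g"
    using lebesgue_cong_AE(1)[OF m2 ae2] square_integrable_integrable[OF assms(1)]
    by (intro square_integrableI m) simp
  show "sq_integral \<Omega> g = sq_integral \<Omega> f"
    unfolding sq_integral_eq using lebesgue_cong_AE(2)[OF m2 ae2] by simp
qed

lemma square_integrable_diff:
  fixes f g :: "'a::euclidean_space \<Rightarrow> 'b::euclidean_space"
  assumes "square_integrable \<Omega> f" "square_integrable \<Omega> g"
  shows "square_integrable \<Omega> (\<lambda>x. f x - g x)"
proof (rule square_integrable_bound(1)[OF _ assms, of _ _ 1 1])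
  show "(\<lambda>x. indicator \<Omega> x *\<^sub>R (f x - g x)) \<in> borel_measurable lebesgue"
    unfolding scaleR_diff_right using assms by (intro borel_measurable_diff square_integrable_measurable)
qed (auto intro: norm_triangle_ineq4)

lemma sq_integral_le_diff:
  fixes f g :: "'a::euclidean_space \<Rightarrow> 'b::euclidean_space"
  assumes "square_integrable \<Omega> f" "square_integrable \<Omega> g"
  shows "sq_integral \<Omega> f \<le> 2 * sq_integral \<Omega> g + 2 * sq_integral \<Omega> (\<lambda>x. f x - g x)"
proof -
  have "norm (f x) \<le> norm (g x) + norm (f x - g x)" for x
    using norm_triangle_ineq[of "g x" "f x - g x"] by simp
  then show ?thesis
    using square_integrable_bound(2)[OF square_integrable_measurable[OF assms(1)] assms(2) square_integrable_diff[OF assms], of 1 1]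
    by simp
qed

lemma square_integrable_UNIV_iff: "square_integrable UNIV u \<longleftrightarrow> u \<in> L2"
  and sq_integral_UNIV: "sq_integral UNIV u = (L2norm u)\<^sup>2"
  for u :: "'a::euclidean_space \<Rightarrow> real"
  by (auto simp: square_integrable_def L2_def set_borel_measurable_def set_integrable_def
      sq_integral_eq L2norm_power2)

lemma test_function_square_integrable:
  fixes \<phi> :: "'a::euclidean_space \<Rightarrow> real"
  assumes "open \<Omega>" "test_function \<Omega> \<phi>"
  shows "square_integrable \<Omega> \<phi>" "square_integrable \<Omega> (gradient \<phi>)"
proof -
  obtain K where K: "smooth \<phi>" "compact K" "K \<subseteq> \<Omega>" "\<And>x. x \<notin> K \<Longrightarrow> \<phi> x = 0"
    using test_functionE[OF assms(2)] by metis
  obtain B where B: "B \<ge> 0" "\<And>x. \<bar>\<phi> x\<bar> \<le> B" "\<And>x. norm (gradient \<phi> x) \<le> B"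
    using test_function_bounded[OF assms(2)] by metis
  have g0: "gradient \<phi> x = 0" if "x \<notin> K" for x
    using gradient_zero_outside[OF compact_imp_closed[OF K(2)] _ that] K(4) by blast
  have sets: "\<Omega> \<in> sets lebesgue" using assms(1) by simp
  have one: "square_integrable K (\<lambda>x. 1 :: real)"
    unfolding square_integrable_def set_borel_measurable_def set_integrable_def
    using integrable_indicator_compact[OF K(2)] by auto
  have 1: "(\<lambda>x. indicator \<Omega> x *\<^sub>R \<phi> x) \<in> borel_measurable lebesgue"
    using sets smooth_measurable[OF K(1)] by (intro borel_measurable_scaleR borel_measurable_indicator)
  have 2: "(\<lambda>x. indicator \<Omega> x *\<^sub>R gradient \<phi> x) \<in> borel_measurable lebesgue"
    using sets continuous_measurable_lebesgue[OF smooth_gradient_continuous[OF K(1)]]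
    by (intro borel_measurable_scaleR borel_measurable_indicator)
  show "square_integrable \<Omega> \<phi>"
    by (rule square_integrable_bound(1)[OF 1 one one B(1) order.refl]) (use K B in auto)
  show "square_integrable \<Omega> (gradient \<phi>)"
    by (rule square_integrable_bound(1)[OF 2 one one B(1) order.refl]) (use g0 B in auto)
qed

lemma W12I: "square_integrable \<Omega> u \<Longrightarrow> has_weak_gradient \<Omega> u G \<Longrightarrow> square_integrable \<Omega> G \<Longrightarrow> u \<in> W12 \<Omega>"
  by (auto simp: W12_def)

lemma weak_gradient_works:
  fixes u :: "'a::euclidean_space \<Rightarrow> real"
  assumes "open \<Omega>" "u \<in> W12 \<Omega>"
  shows "square_integrable \<Omega> u" "has_weak_gradient \<Omega> u (weak_gradient \<Omega> u)"
    "square_integrable \<Omega> (weak_gradient \<Omega> u)"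
proof -
  obtain G where G: "has_weak_gradient \<Omega> u G" "square_integrable \<Omega> G" using assms(2) by (auto simp: W12_def)
  show "square_integrable \<Omega> u" using assms(2) by (auto simp: W12_def)
  show wg: "has_weak_gradient \<Omega> u (weak_gradient \<Omega> u)"
    unfolding weak_gradient_def using G(1) by (metis someI)
  show "square_integrable \<Omega> (weak_gradient \<Omega> u)"
    using square_integrable_cong_AE(1)[OF G(2) weak_gradient_unique[OF assms(1) G(1) wg]] .
qed

lemma weak_gradient_AE:
  assumes "open \<Omega>" "has_weak_gradient \<Omega> u G"
  shows "AE x in lebesgue. x \<in> \<Omega> \<longrightarrow> weak_gradient \<Omega> u x = G x"
  using weak_gradient_unique[OF assms(1) _ assms(2)] someI[of "has_weak_gradient \<Omega> u" G] assms(2)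
  by (simp add: weak_gradient_def)

lemma W12_diff:
  assumes "open \<Omega>" "u \<in> W12 \<Omega>" "v \<in> W12 \<Omega>"
  shows "(\<lambda>x. u x - v x) \<in> W12 \<Omega>"
    "AE x in lebesgue. x \<in> \<Omega> \<longrightarrow> weak_gradient \<Omega> (\<lambda>x. u x - v x) x = weak_gradient \<Omega> u x - weak_gradient \<Omega> v x"
proof -
  note u = weak_gradient_works[OF assms(1,2)] and v = weak_gradient_works[OF assms(1,3)]
  note d = has_weak_gradient_diff[OF u(2) v(2)]
  show "(\<lambda>x. u x - v x) \<in> W12 \<Omega>"
    using square_integrable_diff[OF u(1) v(1)] d square_integrable_diff[OF u(3) v(3)] by (rule W12I)
  show "AE x in lebesgue. x \<in> \<Omega> \<longrightarrow> weak_gradient \<Omega> (\<lambda>x. u x - v x) x = weak_gradient \<Omega> u x - weak_gradient \<Omega> v x"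
    by (rule weak_gradient_AE[OF assms(1) d])
qed

lemma test_function_W12:
  assumes "open \<Omega>" "test_function \<Omega> \<phi>"
  shows "\<phi> \<in> W12 \<Omega>" "AE x in lebesgue. x \<in> \<Omega> \<longrightarrow> weak_gradient \<Omega> \<phi> x = gradient \<phi> x"
  using W12I[OF test_function_square_integrable(1)[OF assms] test_function_has_weak_gradient[OF assms(2)]
      test_function_square_integrable(2)[OF assms]]
    weak_gradient_AE[OF assms(1) test_function_has_weak_gradient[OF assms(2)]] by blast+

lemma W12_norm_eq: "W12_norm \<Omega> u = sqrt (sq_integral \<Omega> u + sq_integral \<Omega> (weak_gradient \<Omega> u))"
  by (simp add: W12_norm_def sq_integral_def)

lemma W12_norm_tendsto_0:
  "(\<lambda>n. W12_norm \<Omega> (w n)) \<longlonglongrightarrow> 0 \<longleftrightarrow>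
    (\<lambda>n. sq_integral \<Omega> (w n)) \<longlonglongrightarrow> 0 \<and> (\<lambda>n. sq_integral \<Omega> (weak_gradient \<Omega> (w n))) \<longlonglongrightarrow> 0"
proof
  assume "(\<lambda>n. W12_norm \<Omega> (w n)) \<longlonglongrightarrow> 0"
  then have "(\<lambda>n. (W12_norm \<Omega> (w n))\<^sup>2) \<longlonglongrightarrow> 0\<^sup>2" by (rule tendsto_power)
  then have lim: "(\<lambda>n. sq_integral \<Omega> (w n) + sq_integral \<Omega> (weak_gradient \<Omega> (w n))) \<longlonglongrightarrow> 0"
    by (simp add: W12_norm_eq)
  show "(\<lambda>n. sq_integral \<Omega> (w n)) \<longlonglongrightarrow> 0 \<and> (\<lambda>n. sq_integral \<Omega> (weak_gradient \<Omega> (w n))) \<longlonglongrightarrow> 0"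
    by (intro conjI; rule tendsto_sandwich[OF _ _ tendsto_const lim]) auto
next
  assume "(\<lambda>n. sq_integral \<Omega> (w n)) \<longlonglongrightarrow> 0 \<and> (\<lambda>n. sq_integral \<Omega> (weak_gradient \<Omega> (w n))) \<longlonglongrightarrow> 0"
  then have "(\<lambda>n. sqrt (sq_integral \<Omega> (w n) + sq_integral \<Omega> (weak_gradient \<Omega> (w n)))) \<longlonglongrightarrow> sqrt (0 + 0)"
    by (intro tendsto_real_sqrt tendsto_add) auto
  then show "(\<lambda>n. W12_norm \<Omega> (w n)) \<longlonglongrightarrow> 0" by (simp add: W12_norm_eq)
qed

text \<open>Serves two settings: \<open>UNIV\<close> for both sets when a trial function is
  multiplied by bumps, and a ball \<open>\<Omega>'\<close> with a general \<open>\<Omega>\<close>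
  when an admissible function for the capacity is cut off.\<close>

lemma W12_mult:
  fixes u :: "'a::euclidean_space \<Rightarrow> real"
  assumes op: "open \<Omega>" "open \<Omega>'" and u: "u \<in> W12 \<Omega>'" and \<zeta>: "smooth \<zeta>"
    and S: "closed S" "\<And>x. x \<notin> S \<Longrightarrow> \<zeta> x = 0" "S \<inter> \<Omega> \<subseteq> \<Omega>'"
    and b: "\<And>x. \<bar>\<zeta> x\<bar> \<le> \<alpha>" "\<And>x. norm (gradient \<zeta> x) \<le> \<beta>"
  shows "(\<lambda>x. \<zeta> x * u x) \<in> W12 \<Omega>"
    "AE x in lebesgue. x \<in> \<Omega> \<longrightarrow> weak_gradient \<Omega> (\<lambda>x. \<zeta> x * u x) x = \<zeta> x *\<^sub>R weak_gradient \<Omega>' u x + u x *\<^sub>R gradient \<zeta> x"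
    "sq_integral \<Omega> (\<lambda>x. \<zeta> x * u x) \<le> 2 * \<alpha>\<^sup>2 * sq_integral \<Omega>' u"
    "sq_integral \<Omega> (weak_gradient \<Omega> (\<lambda>x. \<zeta> x * u x))
      \<le> 2 * \<alpha>\<^sup>2 * sq_integral \<Omega>' (weak_gradient \<Omega>' u) + 2 * \<beta>\<^sup>2 * sq_integral \<Omega>' u"
proof -
  note w = weak_gradient_works[OF op(2) u]
  let ?G = "weak_gradient \<Omega>' u" and ?H = "\<lambda>x. \<zeta> x *\<^sub>R weak_gradient \<Omega>' u x + u x *\<^sub>R gradient \<zeta> x"
  have ab: "\<alpha> \<ge> 0" "\<beta> \<ge> 0" using b(1)[of undefined] b(2)[of undefined] norm_ge_zero by (linarith, metis order_trans)
  have g0: "gradient \<zeta> x = 0" if "x \<notin> S" for x using gradient_zero_outside[OF S(1) _ that] S(2) by blast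
  have hw: "has_weak_gradient \<Omega> (\<lambda>x. \<zeta> x * u x) ?H"
    by (rule has_weak_gradient_mult[OF w(2) \<zeta> S])
  have sets: "\<Omega> \<in> sets lebesgue" using op by simp
  have \<Omega>: "indicator \<Omega> x * \<zeta> x * (indicator \<Omega>' x :: real) = indicator \<Omega> x * \<zeta> x"
    and \<Omega>g: "(indicator \<Omega> x * (indicator \<Omega>' x :: real)) *\<^sub>R gradient \<zeta> x = indicator \<Omega> x *\<^sub>R gradient \<zeta> x" for x
    using S(2,3) g0 by (auto simp: indicator_def)
  have "(\<lambda>x. indicator \<Omega> x *\<^sub>R (\<zeta> x * u x)) = (\<lambda>x. (indicator \<Omega> x * \<zeta> x) * (indicator \<Omega>' x *\<^sub>R u x))"
    using \<Omega> by (simp add: fun_eq_iff) (metis mult.assoc mult.commute)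
  then have m1: "(\<lambda>x. indicator \<Omega> x *\<^sub>R (\<zeta> x * u x)) \<in> borel_measurable lebesgue"
    using sets smooth_measurable[OF \<zeta>] square_integrable_measurable[OF w(1)]
    by (simp only: borel_measurable_times borel_measurable_indicator)
  have "(\<lambda>x. indicator \<Omega> x *\<^sub>R ?H x) = (\<lambda>x. (indicator \<Omega> x * \<zeta> x) *\<^sub>R (indicator \<Omega>' x *\<^sub>R ?G x)
      + (indicator \<Omega>' x *\<^sub>R u x) *\<^sub>R (indicator \<Omega> x *\<^sub>R gradient \<zeta> x))"
  proof
    fix x
    have "indicator \<Omega> x *\<^sub>R ?H x = (indicator \<Omega> x * \<zeta> x) *\<^sub>R ?G x + u x *\<^sub>R (indicator \<Omega> x *\<^sub>R gradient \<zeta> x)"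
      by (simp add: scaleR_add_right mult.commute)
    also have "\<dots> = (indicator \<Omega> x * \<zeta> x * indicator \<Omega>' x) *\<^sub>R ?G x + u x *\<^sub>R ((indicator \<Omega> x * indicator \<Omega>' x) *\<^sub>R gradient \<zeta> x)"
      unfolding \<Omega> \<Omega>g ..
    finally show "indicator \<Omega> x *\<^sub>R ?H x = (indicator \<Omega> x * \<zeta> x) *\<^sub>R (indicator \<Omega>' x *\<^sub>R ?G x)
      + (indicator \<Omega>' x *\<^sub>R u x) *\<^sub>R (indicator \<Omega> x *\<^sub>R gradient \<zeta> x)"
      by (simp add: mult_ac)
  qed
  then have m2: "(\<lambda>x. indicator \<Omega> x *\<^sub>R ?H x) \<in> borel_measurable lebesgue"
    using sets smooth_measurable[OF \<zeta>] square_integrable_measurable[OF w(1)] square_integrable_measurable[OF w(3)]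
      continuous_measurable_lebesgue[OF smooth_gradient_continuous[OF \<zeta>]]
    by (simp del: real_scaleR_def scaleR_scaleR)
  have le1: "AE x in lebesgue. x \<in> \<Omega> \<longrightarrow> \<zeta> x * u x = 0 \<or> x \<in> \<Omega>' \<and> norm (\<zeta> x * u x) \<le> \<alpha> * norm (u x) + 0 * norm (u x)"
    using S b by (intro AE_I2) (auto simp: abs_mult intro: mult_right_mono)
  have le2: "AE x in lebesgue. x \<in> \<Omega> \<longrightarrow> ?H x = 0 \<or> x \<in> \<Omega>' \<and> norm (?H x) \<le> \<alpha> * norm (?G x) + \<beta> * norm (u x)"
  proof (intro AE_I2 impI)
    fix x assume x: "x \<in> \<Omega>"
    have "norm (?H x) \<le> \<bar>\<zeta> x\<bar> * norm (?G x) + \<bar>u x\<bar> * norm (gradient \<zeta> x)"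
      using norm_triangle_ineq[of "\<zeta> x *\<^sub>R ?G x" "u x *\<^sub>R gradient \<zeta> x"] by simp
    also have "\<dots> \<le> \<alpha> * norm (?G x) + \<bar>u x\<bar> * \<beta>"
      using b by (intro add_mono mult_right_mono mult_left_mono) auto
    finally show "?H x = 0 \<or> x \<in> \<Omega>' \<and> norm (?H x) \<le> \<alpha> * norm (?G x) + \<beta> * norm (u x)"
      using S x g0[of x] by (cases "x \<in> S") (auto simp: mult.commute)
  qed
  note sq1 = square_integrable_bound[OF m1 w(1) w(1) ab(1) order.refl le1]
    and sq2 = square_integrable_bound[OF m2 w(3) w(1) ab le2]
  show "(\<lambda>x. \<zeta> x * u x) \<in> W12 \<Omega>" using sq1(1) hw sq2(1) by (rule W12I)
  show ae: "AE x in lebesgue. x \<in> \<Omega> \<longrightarrow> weak_gradient \<Omega> (\<lambda>x. \<zeta> x * u x) x = ?H x"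
    by (rule weak_gradient_AE[OF op(1) hw])
  show "sq_integral \<Omega> (\<lambda>x. \<zeta> x * u x) \<le> 2 * \<alpha>\<^sup>2 * sq_integral \<Omega>' u" using sq1(2) by simp
  have "sq_integral \<Omega> (weak_gradient \<Omega> (\<lambda>x. \<zeta> x * u x)) = sq_integral \<Omega> ?H"
    using ae by (intro square_integrable_cong_AE(2)[OF sq2(1)]) (auto elim!: eventually_mono)
  then show "sq_integral \<Omega> (weak_gradient \<Omega> (\<lambda>x. \<zeta> x * u x))
      \<le> 2 * \<alpha>\<^sup>2 * sq_integral \<Omega>' (weak_gradient \<Omega>' u) + 2 * \<beta>\<^sup>2 * sq_integral \<Omega>' u" using sq2(2) by simp
qed

subsection \<open>The Poincare inequality and capacity\<close>

text \<open>The partial derivative of x_b \<phi>^2 in direction b is \<phi>^2 + 2 x_b \<phi> D_b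
  \<phi> and has integral 0. As |x_b| \<le> r on \<open>\<Omega>\<close>, the mixed term is bounded
  by half of the integral of \<phi>^2, which is absorbed, and a multiple of the gradient
  integral.\<close>

lemma test_function_Poincare:
  fixes \<phi> :: "'a::euclidean_space \<Rightarrow> real"
  assumes \<Omega>: "open \<Omega>" "\<And>x. x \<in> \<Omega> \<Longrightarrow> norm x \<le> r" and \<phi>: "test_function \<Omega> \<phi>"
  shows "sq_integral \<Omega> \<phi> \<le> 4 * r\<^sup>2 * sq_integral \<Omega> (gradient \<phi>)"
proof -
  obtain b :: 'a where b: "b \<in> Basis" using nonempty_Basis by blast
  note sq = test_function_square_integrable[OF \<Omega>(1) \<phi>]
  have sm: "smooth \<phi>" using test_function_smooth \<phi> .
  have out: "\<phi> x = 0" if "x \<notin> \<Omega>" for x using test_functionE[OF \<phi>] that by (metis subsetD)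
  have \<phi>2: "test_function \<Omega> (\<lambda>x. \<phi> x * \<phi> x)" using test_function_mult_smooth[OF \<phi> sm] .
  have t: "test_function \<Omega> (\<lambda>x. (x \<bullet> b) * (\<phi> x * \<phi> x))" by (rule test_function_mult_smooth[OF \<phi>2 smooth_inner])
  have d: "partial_derivative b (\<lambda>x. (x \<bullet> b) * (\<phi> x * \<phi> x)) x
      = 2 * (x \<bullet> b) * \<phi> x * partial_derivative b \<phi> x + (\<phi> x)\<^sup>2" for x
    using b sm smooth_inner[of b]
    by (simp add: partial_derivative_mult smooth_imp_differentiable smooth_mult partial_derivative_inner
        power2_eq_square algebra_simps inner_same_Basis)
  have int: "integrable lebesgue (\<lambda>x. 2 * (x \<bullet> b) * \<phi> x * partial_derivative b \<phi> x)"
    using L2_mult_integrable[OF test_function_L2[OF test_function_mult_smooth[OF \<phi> smooth_mult[OF smooth_const smooth_inner]]] test_function_L2[OF test_function_partial[OF \<phi> b]], of 2 b]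
    by simp
  have i2: "integrable lebesgue (\<lambda>x. (norm (indicator \<Omega> x *\<^sub>R \<phi> x))\<^sup>2)"
    using square_integrable_integrable[OF sq(1)] .
  have i3: "integrable lebesgue (\<lambda>x. (norm (indicator \<Omega> x *\<^sub>R gradient \<phi> x))\<^sup>2)"
    using square_integrable_integrable[OF sq(2)] .
  have eq: "(\<phi> x)\<^sup>2 = (norm (indicator \<Omega> x *\<^sub>R \<phi> x))\<^sup>2" for x using out by (auto simp: indicator_def)
  have "(LINT x|lebesgue. 2 * (x \<bullet> b) * \<phi> x * partial_derivative b \<phi> x + (\<phi> x)\<^sup>2) = 0"
    using integral_partial_derivative[OF t b] unfolding d .
  then have "sq_integral \<Omega> \<phi> = (LINT x|lebesgue. - (2 * (x \<bullet> b) * \<phi> x * partial_derivative b \<phi> x))"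
    unfolding eq using int i2 by (simp add: sq_integral_eq)
  also have "\<dots> \<le> (LINT x|lebesgue. (1 / 2) * (norm (indicator \<Omega> x *\<^sub>R \<phi> x))\<^sup>2
      + (2 * r\<^sup>2) * (norm (indicator \<Omega> x *\<^sub>R gradient \<phi> x))\<^sup>2)"
  proof (rule integral_mono)
    fix x :: 'a
    show "- (2 * (x \<bullet> b) * \<phi> x * partial_derivative b \<phi> x) \<le> (1 / 2) * (norm (indicator \<Omega> x *\<^sub>R \<phi> x))\<^sup>2
      + (2 * r\<^sup>2) * (norm (indicator \<Omega> x *\<^sub>R gradient \<phi> x))\<^sup>2"
    proof (cases "x \<in> \<Omega>")
      case True
      let ?p = "partial_derivative b \<phi> x"
      \<comment> \<open>Young's inequality for the mixed term, with the weights that leave one half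
        of \<phi>^2.\<close>
      have "0 \<le> (\<phi> x + 2 * (x \<bullet> b) * ?p)\<^sup>2" by simp
      then have "- (2 * (x \<bullet> b) * \<phi> x * ?p) \<le> (1 / 2) * (\<phi> x)\<^sup>2 + 2 * ((x \<bullet> b)\<^sup>2 * ?p\<^sup>2)"
        by (simp add: power2_eq_square algebra_simps)
      also have "(x \<bullet> b)\<^sup>2 * ?p\<^sup>2 \<le> r\<^sup>2 * (norm (gradient \<phi> x))\<^sup>2"
      proof (intro mult_mono)
        have "\<bar>x \<bullet> b\<bar> \<le> r" using Basis_le_norm[OF b, of x] \<Omega>(2)[OF True] by linarith
        then show "(x \<bullet> b)\<^sup>2 \<le> r\<^sup>2" by (metis abs_ge_zero power2_abs power_mono)
        have "\<bar>?p\<bar> \<le> norm (gradient \<phi> x)" using Basis_le_norm[OF b, of "gradient \<phi> x"] b by (simp add: gradient_inner)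
        then show "?p\<^sup>2 \<le> (norm (gradient \<phi> x))\<^sup>2" by (metis abs_ge_zero power2_abs power_mono)
      qed auto
      finally show ?thesis using True by simp
    qed (use out in simp)
  qed (use int i2 i3 in auto)
  also have "\<dots> = (1 / 2) * sq_integral \<Omega> \<phi> + 2 * r\<^sup>2 * sq_integral \<Omega> (gradient \<phi>)"
    unfolding sq_integral_eq using i2 i3 by simp
  finally show ?thesis by simp
qed

text \<open>The inequality survives the limit of the approximating test functions. The 16 is 2 * 4 *
  2: the 4 of the smooth case and two passages between \<open>u\<close> and \<open>\<phi> n\<close>,
  each at the price of a factor 2.\<close>

lemma W012_open_Poincare:
  fixes u :: "'a::euclidean_space \<Rightarrow> real"
  assumes \<Omega>: "open \<Omega>" "\<And>x. x \<in> \<Omega> \<Longrightarrow> norm x \<le> r" and u: "u \<in> W012_open \<Omega>"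
  shows "sq_integral \<Omega> u \<le> 16 * r\<^sup>2 * sq_integral \<Omega> (weak_gradient \<Omega> u)"
proof -
  obtain \<phi> where \<phi>: "\<And>n. test_function \<Omega> (\<phi> n)" "u \<in> W12 \<Omega>"
    "(\<lambda>n. sq_integral \<Omega> (\<lambda>x. \<phi> n x - u x)) \<longlonglongrightarrow> 0"
    "(\<lambda>n. sq_integral \<Omega> (weak_gradient \<Omega> (\<lambda>x. \<phi> n x - u x))) \<longlonglongrightarrow> 0"
    using u unfolding W012_open_def mem_Collect_eq W12_norm_tendsto_0 by blast
  note w = weak_gradient_works[OF \<Omega>(1) \<phi>(2)]
  have le: "sq_integral \<Omega> u \<le> 8 * r\<^sup>2 * (2 * sq_integral \<Omega> (weak_gradient \<Omega> u)
      + 2 * sq_integral \<Omega> (weak_gradient \<Omega> (\<lambda>x. \<phi> n x - u x))) + 2 * sq_integral \<Omega> (\<lambda>x. \<phi> n x - u x)" for n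
  proof -
    note t = test_function_square_integrable[OF \<Omega>(1) \<phi>(1)[of n]]
    have "sq_integral \<Omega> (\<lambda>x. u x - \<phi> n x) = sq_integral \<Omega> (\<lambda>x. \<phi> n x - u x)"
      by (simp add: sq_integral_def abs_minus_commute power2_commute)
    then have 1: "sq_integral \<Omega> u \<le> 2 * sq_integral \<Omega> (\<phi> n) + 2 * sq_integral \<Omega> (\<lambda>x. \<phi> n x - u x)"
      using sq_integral_le_diff[OF w(1) t(1)] by simp
    have 2: "sq_integral \<Omega> (\<phi> n) \<le> 4 * r\<^sup>2 * sq_integral \<Omega> (gradient (\<phi> n))"
      by (rule test_function_Poincare[OF \<Omega> \<phi>(1)])
    have ae: "AE x in lebesgue. x \<in> \<Omega> \<longrightarrow> gradient (\<phi> n) x - weak_gradient \<Omega> u x = weak_gradient \<Omega> (\<lambda>x. \<phi> n x - u x) x"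
      using W12_diff(2)[OF \<Omega>(1) test_function_W12(1)[OF \<Omega>(1) \<phi>(1)] \<phi>(2), of n] test_function_W12(2)[OF \<Omega>(1) \<phi>(1)[of n]]
      by eventually_elim auto
    have "sq_integral \<Omega> (gradient (\<phi> n)) \<le> 2 * sq_integral \<Omega> (weak_gradient \<Omega> u)
        + 2 * sq_integral \<Omega> (\<lambda>x. gradient (\<phi> n) x - weak_gradient \<Omega> u x)"
      by (rule sq_integral_le_diff[OF t(2) w(3)])
    also have "sq_integral \<Omega> (\<lambda>x. gradient (\<phi> n) x - weak_gradient \<Omega> u x) = sq_integral \<Omega> (weak_gradient \<Omega> (\<lambda>x. \<phi> n x - u x))"
      using square_integrable_cong_AE(2)[OF square_integrable_diff[OF t(2) w(3)] ae] by simp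
    finally have "8 * r\<^sup>2 * sq_integral \<Omega> (gradient (\<phi> n)) \<le> 8 * r\<^sup>2 * (2 * sq_integral \<Omega> (weak_gradient \<Omega> u)
        + 2 * sq_integral \<Omega> (weak_gradient \<Omega> (\<lambda>x. \<phi> n x - u x)))" by (rule mult_left_mono) simp
    with 1 2 show ?thesis by linarith
  qed
  have "(\<lambda>n. 8 * r\<^sup>2 * (2 * sq_integral \<Omega> (weak_gradient \<Omega> u)
      + 2 * sq_integral \<Omega> (weak_gradient \<Omega> (\<lambda>x. \<phi> n x - u x))) + 2 * sq_integral \<Omega> (\<lambda>x. \<phi> n x - u x))
    \<longlonglongrightarrow> 8 * r\<^sup>2 * (2 * sq_integral \<Omega> (weak_gradient \<Omega> u) + 2 * 0) + 2 * 0"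
    by (intro tendsto_intros \<phi>)
  then have "sq_integral \<Omega> u \<le> 8 * r\<^sup>2 * (2 * sq_integral \<Omega> (weak_gradient \<Omega> u) + 2 * 0) + 2 * 0"
    by (rule LIMSEQ_le_const) (use le in blast)
  then show ?thesis by simp
qed

section \<open>Sets of zero capacity\<close>

lemma capacity_nonneg: "0 \<le> capacity \<Omega> V"
  unfolding capacity_def
  by (intro INF_greatest) (auto simp: sq_integral_def[symmetric])

lemma capacity_lessE:
  assumes "capacity \<Omega> V < ereal \<epsilon>"
  obtains u U where "u \<in> W012_open \<Omega>" "open U" "V \<subseteq> U" "U \<subseteq> \<Omega>"
    "AE x in lebesgue. x \<in> U \<longrightarrow> 1 \<le> u x" "sq_integral \<Omega> (weak_gradient \<Omega> u) < \<epsilon>"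
  using assms unfolding capacity_def INF_less_iff by (auto simp: sq_integral_def[symmetric])

lemma capacity_le:
  assumes "u \<in> W012_open \<Omega>" "open U" "V \<subseteq> U" "U \<subseteq> \<Omega>" "AE x in lebesgue. x \<in> U \<longrightarrow> 1 \<le> u x"
  shows "capacity \<Omega> V \<le> ereal (sq_integral \<Omega> (weak_gradient \<Omega> u))"
  unfolding capacity_def sq_integral_def using assms by (intro INF_lower) blast

text \<open>The concentric ball of radius r + 1 contains the closure of E \<inter> ball c r and is
  bounded, so the Poincare inequality is available on it.\<close>

lemma zero_capacity_ball:
  assumes "zero_capacity E" "\<epsilon> > 0"
  obtains u U where "u \<in> W012_open (ball c (r + 1))" "open U" "E \<inter> ball c r \<subseteq> U" "U \<subseteq> ball c (r + 1)"
    "AE x in lebesgue. x \<in> U \<longrightarrow> 1 \<le> u x"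
    "sq_integral (ball c (r + 1)) (weak_gradient (ball c (r + 1)) u) < \<epsilon>"
proof -
  have "closure (E \<inter> ball c r) \<subseteq> cball c r" by (intro closure_minimal) auto
  then have "closure (E \<inter> ball c r) \<subseteq> ball c (r + 1)" by force
  moreover have "compact (closure (E \<inter> ball c r))" using bounded_subset[OF bounded_ball, of "E \<inter> ball c r" c r] by simp
  ultimately have "capacity (ball c (r + 1)) (E \<inter> ball c r) = 0"
    using assms(1) by (simp add: zero_capacity_def compactly_contained_def)
  then have "capacity (ball c (r + 1)) (E \<inter> ball c r) < ereal \<epsilon>" using assms(2) by simp
  from capacity_lessE[OF this] show thesis using that .
qed

lemma ball_norm_le: "x \<in> ball c (r + 1) \<Longrightarrow> norm x \<le> norm c + \<bar>r\<bar> + 1"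
proof -
  assume "x \<in> ball c (r + 1)"
  then have "norm (x - c) < r + 1" by (simp add: dist_norm norm_minus_commute)
  then show ?thesis using norm_triangle_ineq[of c "x - c"] by simp
qed

text \<open>An admissible \<open>u\<close> is at least 1 almost everywhere on an open
  \<open>U\<close> around the set, so the measure of \<open>U\<close> is at most the integral of
  u^2, and the Poincare inequality bounds this by a multiple of the small gradient integral.\<close>

lemma zero_capacity_imp_AE:
  fixes E :: "'a::euclidean_space set"
  assumes E: "zero_capacity E"
  shows "AE x in lebesgue. x \<notin> E"
proof -
  have "negligible (E \<inter> ball 0 r)" for r
  proof (rule negligible_outer_le[THEN iffD2, rule_format])
    fix \<epsilon> :: real assume "\<epsilon> > 0"
    let ?B = "ball (0::'a) (r + 1)"
    define R where "R = \<bar>r\<bar> + 1"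
    have R: "16 * R\<^sup>2 > 0" by (auto simp: R_def)
    then have e': "\<epsilon> / (16 * R\<^sup>2) > 0" using \<open>\<epsilon> > 0\<close> by (rule divide_pos_pos[rotated])
    obtain u U where u: "u \<in> W012_open ?B" "open U" "E \<inter> ball 0 r \<subseteq> U" "U \<subseteq> ?B"
      "AE x in lebesgue. x \<in> U \<longrightarrow> 1 \<le> u x" "sq_integral ?B (weak_gradient ?B u) < \<epsilon> / (16 * R\<^sup>2)"
      using zero_capacity_ball[OF E e', of 0 r] .
    have "sq_integral ?B u \<le> 16 * R\<^sup>2 * sq_integral ?B (weak_gradient ?B u)"
      using ball_norm_le[of _ "0::'a" r] by (intro W012_open_Poincare u) (auto simp: R_def)
    also have "\<dots> \<le> \<epsilon>" using u(6) R by (simp add: field_simps)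
    finally have le: "sq_integral ?B u \<le> \<epsilon>" .
    have sq: "square_integrable ?B u"
      using u(1) weak_gradient_works(1)[of ?B u] by (auto simp: W012_open_def)
    have U: "U \<in> lmeasurable"
      using u(2,4) bounded_subset[OF bounded_ball] by (intro lmeasurable_open) auto
    have "measure lebesgue U = (LINT x|lebesgue. indicator U x)" using U by simp
    also have "\<dots> \<le> sq_integral ?B u"
      unfolding sq_integral_eq
    proof (rule integral_mono_AE)
      show "integrable lebesgue (indicator U :: 'a \<Rightarrow> real)" using U by (simp add: lmeasurable_iff_integrable)
      show "integrable lebesgue (\<lambda>x. (norm (indicator ?B x *\<^sub>R u x))\<^sup>2)"
        by (rule square_integrable_integrable[OF sq])
      show "AE x in lebesgue. indicator U x \<le> (norm (indicator ?B x *\<^sub>R u x))\<^sup>2"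
        using u(5)
      proof eventually_elim
        case (elim x)
        then have "x \<in> U \<Longrightarrow> 1 \<le> (u x)\<^sup>2" by (simp add: one_le_power)
        then show ?case using u(4) by (auto simp: indicator_def)
      qed
    qed
    finally show "\<exists>T. E \<inter> ball 0 r \<subseteq> T \<and> T \<in> lmeasurable \<and> measure lebesgue T \<le> \<epsilon>"
      using u(3) U le by (intro exI[of _ U]) auto
  qed
  then have "negligible (\<Union>n. E \<inter> ball 0 (real n))" by (intro negligible_countable_Union[of "range _", simplified]) auto
  moreover have "(\<Union>n. E \<inter> ball 0 (real n)) = E" using reals_Archimedean2 by (auto simp: dist_norm)
  ultimately show ?thesis by (intro AE_not_in) (simp add: negligible_iff_null_sets)
qed

text \<open>Shrinking \<open>E\<close> admits more sets \<open>\<Omega>\<close>, so this is more than monotonicity of the capacity: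
  admissible functions have to be cut off to \<open>\<Omega>\<close>.\<close>

lemma zero_capacity_subset:
  fixes E :: "'a::euclidean_space set"
  assumes E: "zero_capacity E" and sub: "E' \<subseteq> E"
  shows "zero_capacity E'"
  unfolding zero_capacity_def
proof (intro allI impI)
  fix c :: 'a and r and \<Omega> assume asm: "open \<Omega> \<and> compactly_contained (E' \<inter> ball c r) \<Omega>"
  let ?B = "ball c (r + 1)" and ?K = "closure (E' \<inter> ball c r)"
  have "?K \<subseteq> cball c r" by (intro closure_minimal) auto
  then have K: "compact ?K" "?K \<subseteq> \<Omega> \<inter> ?B" "open (\<Omega> \<inter> ?B)" "open \<Omega>"
    using asm by (force simp: compactly_contained_def)+
  obtain \<zeta> V where \<zeta>: "test_function (\<Omega> \<inter> ?B) \<zeta>" "\<And>x. \<zeta> x \<ge> 0" "open V" "?K \<subseteq> V" "V \<subseteq> \<Omega> \<inter> ?B"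
    "\<And>x. x \<in> V \<Longrightarrow> \<zeta> x \<ge> 1" using cutoff_function[OF K(1-3)] by metis
  obtain S where S: "smooth \<zeta>" "compact S" "S \<subseteq> \<Omega> \<inter> ?B" "\<And>x. x \<notin> S \<Longrightarrow> \<zeta> x = 0"
    using test_functionE[OF \<zeta>(1)] by metis
  obtain \<beta> where \<beta>: "\<beta> \<ge> 0" "\<And>x. \<bar>\<zeta> x\<bar> \<le> \<beta>" "\<And>x. norm (gradient \<zeta> x) \<le> \<beta>"
    using test_function_bounded[OF \<zeta>(1)] by metis
  have SB: "S \<inter> \<Omega> \<subseteq> ?B" using S(3) by blast
  define R where "R = norm c + \<bar>r\<bar> + 1"
  \<comment> \<open>The cut-off yields 2 \<beta>^2 times the gradient integral and 2 \<beta>^2 times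
    the integral of u^2; the second costs another 16 R^2 by the Poincare inequality. The 1 keeps
    \<open>M\<close> positive when \<beta> = 0.\<close>
  define M where "M = 2 * \<beta>\<^sup>2 + 2 * \<beta>\<^sup>2 * (16 * R\<^sup>2) + 1"
  have M: "M > 0" unfolding M_def by (simp add: add_nonneg_pos)
  note mult = W12_mult[OF K(4) open_ball _ S(1) compact_imp_closed[OF S(2)] S(4) SB \<beta>(2,3)]
  have "capacity \<Omega> (E' \<inter> ball c r) \<le> ereal \<epsilon>" if "\<epsilon> > 0" for \<epsilon>
  proof -
    have e': "\<epsilon> / M > 0" using M \<open>\<epsilon> > 0\<close> by simp
    obtain u U where u: "u \<in> W012_open ?B" "open U" "E \<inter> ball c r \<subseteq> U" "U \<subseteq> ?B"
      "AE x in lebesgue. x \<in> U \<longrightarrow> 1 \<le> u x" "sq_integral ?B (weak_gradient ?B u) < \<epsilon> / M"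
      using zero_capacity_ball[OF E e', of c r] .
    obtain \<phi> where \<phi>: "\<And>n. test_function ?B (\<phi> n)" "u \<in> W12 ?B"
      "(\<lambda>n. sq_integral ?B (\<lambda>x. \<phi> n x - u x)) \<longlonglongrightarrow> 0"
      "(\<lambda>n. sq_integral ?B (weak_gradient ?B (\<lambda>x. \<phi> n x - u x))) \<longlonglongrightarrow> 0"
      using u(1) unfolding W012_open_def mem_Collect_eq W12_norm_tendsto_0 by blast
    have d: "(\<lambda>x. \<phi> n x - u x) \<in> W12 ?B" for n
      using W12_diff(1)[OF open_ball test_function_W12(1)[OF open_ball \<phi>(1)] \<phi>(2)] .
    have "(\<lambda>x. \<zeta> x * u x) \<in> W012_open \<Omega>"
      unfolding W012_open_def mem_Collect_eq W12_norm_tendsto_0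
    proof (intro conjI exI allI)
      show "(\<lambda>x. \<zeta> x * u x) \<in> W12 \<Omega>" by (rule mult(1)[OF \<phi>(2)])
      show "test_function \<Omega> (\<lambda>x. \<zeta> x * \<phi> n x)" for n
        using S test_function_smooth[OF \<phi>(1)] by (intro test_functionI[of _ S] smooth_mult) auto
      note lim1 = tendsto_mult_right_zero[OF \<phi>(3), of "2 * \<beta>\<^sup>2"]
      note lim2 = tendsto_add_zero[OF tendsto_mult_right_zero[OF \<phi>(4), of "2 * \<beta>\<^sup>2"] lim1]
      show "(\<lambda>n. sq_integral \<Omega> (\<lambda>x. \<zeta> x * \<phi> n x - \<zeta> x * u x)) \<longlonglongrightarrow> 0"
        using mult(3)[OF d] unfolding right_diff_distrib
        by (intro tendsto_sandwich[OF _ _ tendsto_const lim1]) auto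
      show "(\<lambda>n. sq_integral \<Omega> (weak_gradient \<Omega> (\<lambda>x. \<zeta> x * \<phi> n x - \<zeta> x * u x))) \<longlonglongrightarrow> 0"
        using mult(4)[OF d] unfolding right_diff_distrib
        by (intro tendsto_sandwich[OF _ _ tendsto_const lim2]) auto
    qed
    then have "capacity \<Omega> (E' \<inter> ball c r) \<le> ereal (sq_integral \<Omega> (weak_gradient \<Omega> (\<lambda>x. \<zeta> x * u x)))"
    proof (rule capacity_le[of _ _ "U \<inter> V"])
      show "open (U \<inter> V)" using u \<zeta> by blast
      show "E' \<inter> ball c r \<subseteq> U \<inter> V" using sub u(3) \<zeta>(4) closure_subset[of "E' \<inter> ball c r"] by blast
      show "U \<inter> V \<subseteq> \<Omega>" using \<zeta>(5) by blast
      show "AE x in lebesgue. x \<in> U \<inter> V \<longrightarrow> 1 \<le> \<zeta> x * u x"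
        using u(5)
      proof eventually_elim
        case (elim x)
        then show ?case using \<zeta>(6)[of x] mult_mono[of 1 "\<zeta> x" 1 "u x"] by auto
      qed
    qed
    also have "\<dots> \<le> ereal \<epsilon>"
    proof -
      have "sq_integral ?B u \<le> 16 * R\<^sup>2 * sq_integral ?B (weak_gradient ?B u)"
        using ball_norm_le[of _ c r] by (intro W012_open_Poincare u) (auto simp: R_def)
      then have "2 * \<beta>\<^sup>2 * sq_integral ?B u \<le> 2 * \<beta>\<^sup>2 * (16 * R\<^sup>2 * sq_integral ?B (weak_gradient ?B u))"
        by (rule mult_left_mono) simp
      with mult(4)[OF \<phi>(2)] have "sq_integral \<Omega> (weak_gradient \<Omega> (\<lambda>x. \<zeta> x * u x))
          \<le> (M - 1) * sq_integral ?B (weak_gradient ?B u)"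
        by (simp add: M_def algebra_simps)
      also have "\<dots> \<le> M * sq_integral ?B (weak_gradient ?B u)" by (intro mult_right_mono) auto
      also have "\<dots> \<le> \<epsilon>" using u(6) M by (simp add: field_simps)
      finally show ?thesis by simp
    qed
    finally show ?thesis .
  qed
  note le = this
  have "capacity \<Omega> (E' \<inter> ball c r) \<le> 0"
    by (rule ereal_le_epsilon2) (simp only: add_0_left le)
  then show "capacity \<Omega> (E' \<inter> ball c r) = 0" by (rule antisym[OF _ capacity_nonneg])
qed

subsection \<open>Translation estimates\<close>

lemma W12_partial_L2:
  fixes u :: "'a::euclidean_space \<Rightarrow> real"
  assumes "u \<in> W12 UNIV" "b \<in> Basis"
  shows "u \<in> L2" "(\<lambda>x. weak_gradient UNIV u x \<bullet> b) \<in> L2"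
    "(L2norm (\<lambda>x. weak_gradient UNIV u x \<bullet> b))\<^sup>2 \<le> sq_integral UNIV (weak_gradient UNIV u)"
proof -
  note w = weak_gradient_works[OF open_UNIV assms(1)]
  show "u \<in> L2" using w(1) by (simp add: square_integrable_UNIV_iff)
  have m: "weak_gradient UNIV u \<in> borel_measurable lebesgue" using square_integrable_measurable[OF w(3)] by simp
  have i: "integrable lebesgue (\<lambda>x. (norm (weak_gradient UNIV u x))\<^sup>2)"
    using square_integrable_integrable[OF w(3)] by simp
  have le: "(weak_gradient UNIV u x \<bullet> b)\<^sup>2 \<le> (norm (weak_gradient UNIV u x))\<^sup>2" for x
    using Basis_le_norm[OF assms(2), of "weak_gradient UNIV u x"] by (metis abs_ge_zero power2_abs power_mono)
  have i2: "integrable lebesgue (\<lambda>x. (weak_gradient UNIV u x \<bullet> b)\<^sup>2)"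
    by (rule Bochner_Integration.integrable_bound[OF i]) (use m le in auto)
  then show "(\<lambda>x. weak_gradient UNIV u x \<bullet> b) \<in> L2" using m by (auto simp: L2_def)
  show "(L2norm (\<lambda>x. weak_gradient UNIV u x \<bullet> b))\<^sup>2 \<le> sq_integral UNIV (weak_gradient UNIV u)"
    unfolding L2norm_power2 sq_integral_eq using i i2 le by (simp add: integral_mono)
qed

text \<open>A change of variables moves the shift of \<open>u\<close> onto \<phi>. The integral of
  \<open>u\<close> against the shifted \<phi> is differentiable in the shift, with derivative the
  weak partial derivative tested with that translate, so the mean value theorem for real functions
  applies.\<close>

lemma W12_difference_mean_value:
  fixes u :: "'a::euclidean_space \<Rightarrow> real"
  assumes u: "u \<in> W12 UNIV" and b: "b \<in> Basis" and \<phi>: "test_function UNIV \<phi>" and "h > 0"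
  obtains s where "0 < s" "s < h"
    "(LINT x|lebesgue. (u (x + h *\<^sub>R b) - u x) * \<phi> x)
      = h * (LINT x|lebesgue. (weak_gradient UNIV u x \<bullet> b) * \<phi> (x - s *\<^sub>R b))"
proof -
  note w = weak_gradient_works[OF open_UNIV u]
  have loc: "locally_integrable UNIV u" using w(2) by (simp add: has_weak_gradient_iff)
  have \<phi>s: "test_function UNIV (\<lambda>x. \<phi> (x - s *\<^sub>R b))" for s
    using test_function_translate[OF \<phi>, of "- s *\<^sub>R b"] by simp
  let ?H = "\<lambda>h. LINT x|lebesgue. u x * \<phi> (x - h *\<^sub>R b)"
  have der: "(?H has_real_derivative (LINT x|lebesgue. (weak_gradient UNIV u x \<bullet> b) * \<phi> (x - s *\<^sub>R b))) (at s)" for s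
  proof -
    have "- (LINT x|lebesgue. u x * (b \<bullet> gradient (\<lambda>x. \<phi> (x - s *\<^sub>R b)) x))
        = (LINT x|lebesgue. (weak_gradient UNIV u x \<bullet> b) * \<phi> (x - s *\<^sub>R b))"
      using w(2) \<phi>s[of s] b unfolding has_weak_gradient_iff
      by (simp add: inner_commute[of b] gradient_inner)
    then show ?thesis using DERIV_integral_translate[OF loc \<phi>, of b s] by simp
  qed
  obtain s where s: "0 < s" "s < h"
    "?H h - ?H 0 = (h - 0) * (LINT x|lebesgue. (weak_gradient UNIV u x \<bullet> b) * \<phi> (x - s *\<^sub>R b))"
    using MVT2[OF \<open>h > 0\<close> der] by blast
  have u2: "u \<in> L2" using W12_partial_L2(1)[OF u b] .
  note \<phi>2 = test_function_L2[OF \<phi>] and \<phi>s2 = test_function_L2[OF \<phi>s[of h]]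
  have "(LINT x|lebesgue. u (x + h *\<^sub>R b) * \<phi> x) = ?H h"
    using integral_translation[of "\<lambda>x. u x * \<phi> (x - h *\<^sub>R b)" "h *\<^sub>R b"] L2_mult_integrable[OF u2 \<phi>s2]
    by auto
  then have "(LINT x|lebesgue. (u (x + h *\<^sub>R b) - u x) * \<phi> x) = ?H h - ?H 0"
    using L2_mult_integrable[OF L2_translation(1)[OF u2] \<phi>2, of "h *\<^sub>R b"] L2_mult_integrable[OF u2 \<phi>2]
    by (simp add: left_diff_distrib)
  then show thesis using s that by simp
qed

text \<open>The translate of \<phi> in the mean value formula has the norm of \<phi>, so
  Cauchy-Schwarz gives the estimate in dual form.\<close>

lemma W12_translation_estimate:
  fixes u :: "'a::euclidean_space \<Rightarrow> real"
  assumes u: "u \<in> W12 UNIV" and b: "b \<in> Basis" and "h \<ge> 0"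
  shows "L2norm (\<lambda>x. u (x + h *\<^sub>R b) - u x) \<le> h * L2norm (\<lambda>x. weak_gradient UNIV u x \<bullet> b)"
proof (cases "h = 0")
  case True
  then show ?thesis by (simp add: L2norm_def)
next
  case False
  then have h: "h > 0" using assms by simp
  note u2 = W12_partial_L2[OF u b]
  show ?thesis
  proof (rule L2norm_le_by_duality)
    show "(\<lambda>x. u (x + h *\<^sub>R b) - u x) \<in> L2" by (intro L2_diff L2_translation u2)
    fix \<phi> :: "'a \<Rightarrow> real" assume \<phi>: "test_function UNIV \<phi>"
    obtain s where s: "(LINT x|lebesgue. (u (x + h *\<^sub>R b) - u x) * \<phi> x)
        = h * (LINT x|lebesgue. (weak_gradient UNIV u x \<bullet> b) * \<phi> (x - s *\<^sub>R b))"
      using W12_difference_mean_value[OF u b \<phi> h] by blast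
    have t: "(\<lambda>x. \<phi> (x - s *\<^sub>R b)) \<in> L2" "L2norm (\<lambda>x. \<phi> (x - s *\<^sub>R b)) = L2norm \<phi>"
      using L2_translation[OF test_function_L2[OF \<phi>], of "- s *\<^sub>R b"] by simp_all
    show "\<bar>LINT x|lebesgue. (u (x + h *\<^sub>R b) - u x) * \<phi> x\<bar> \<le> h * L2norm (\<lambda>x. weak_gradient UNIV u x \<bullet> b) * L2norm \<phi>"
      unfolding s using L2_Cauchy_Schwarz[OF u2(2) t(1)] h by (simp add: abs_mult t(2) mult.assoc)
  qed (use h in simp)
qed

lemma test_function_translation_estimate:
  fixes \<phi> :: "'a::euclidean_space \<Rightarrow> real"
  assumes \<phi>: "test_function UNIV \<phi>" and b: "b \<in> Basis" and s: "s \<ge> 0"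
  shows "L2norm (\<lambda>x. \<phi> (x - s *\<^sub>R b) - \<phi> x) \<le> s * L2norm (\<lambda>x. weak_gradient UNIV \<phi> x \<bullet> b)"
proof -
  have "(\<lambda>x. \<phi> (x - s *\<^sub>R b)) \<in> L2"
    using L2_translation(1)[OF test_function_L2[OF \<phi>], of "- s *\<^sub>R b"] by simp
  from L2_translation(2)[OF L2_diff[OF test_function_L2[OF \<phi>] this], of "s *\<^sub>R b"]
  show ?thesis
    using W12_translation_estimate[OF test_function_W12(1)[OF open_UNIV \<phi>] b s]
    by (simp add: L2norm_minus_commute[of \<phi>])
qed

text \<open>Let g be the indicator of \<open>S\<close>. The increment \<Delta> of \<open>u\<close>
  vanishes where x and x + h b both lie in \<open>S\<close>, so \<Delta> g lives where g differs
  from its translate. This difference is small in \<open>L2\<close> and \<Delta> has norm at most h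
  L2norm D, so the integral of \<Delta> g is small compared with h. Divided by h it is close to the
  integral of D g; the mean value formula for a test function \<phi> near g makes this
  precise.\<close>

lemma weak_partial_integral_zero_on_zero_set:
  fixes u :: "'a::euclidean_space \<Rightarrow> real"
  assumes u: "u \<in> W12 UNIV" and b: "b \<in> Basis"
    and S: "S \<in> sets lebesgue" "bounded S" "\<And>x. x \<in> S \<Longrightarrow> u x = 0"
  shows "(LINT x|lebesgue. (weak_gradient UNIV u x \<bullet> b) * indicator S x) = 0"
proof -
  define D where "D = (\<lambda>x. weak_gradient UNIV u x \<bullet> b)"
  define g :: "'a \<Rightarrow> real" where "g = indicator S"
  have u2: "u \<in> L2" and D2: "D \<in> L2" using W12_partial_L2[OF u b] by (auto simp: D_def)
  have gapp: "approximable g" using approximable_indicator[OF S(1,2)] by (simp add: g_def)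
  then have g2: "g \<in> L2" by (simp add: approximable_def)
  have le: "\<bar>LINT x|lebesgue. D x * g x\<bar> \<le> 6 * \<epsilon> * L2norm D" if "\<epsilon> > 0" for \<epsilon>
  proof -
    obtain \<phi> where \<phi>: "test_function UNIV \<phi>" "L2norm (\<lambda>x. g x - \<phi> x) < \<epsilon>"
      using gapp \<open>\<epsilon> > 0\<close> by (auto simp: approximable_def)
    note \<phi>2 = test_function_L2[OF \<phi>(1)]
    define P where "P = L2norm (\<lambda>x. weak_gradient UNIV \<phi> x \<bullet> b)"
    \<comment> \<open>Shifts of \<phi> up to this \<open>h\<close> change it by at most \<epsilon>;
      the 1 guards against P = 0.\<close>
    define h where "h = \<epsilon> / (P + 1)"
    have P: "P + 1 > 0" by (simp add: P_def add_nonneg_pos)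
    then have h: "h > 0" using \<open>\<epsilon> > 0\<close> by (simp add: h_def)
    have \<phi>h: "L2norm (\<lambda>x. \<phi> (x - s *\<^sub>R b) - \<phi> x) \<le> \<epsilon>" if "0 \<le> s" "s \<le> h" for s
    proof -
      have "L2norm (\<lambda>x. \<phi> (x - s *\<^sub>R b) - \<phi> x) \<le> s * P"
        unfolding P_def using test_function_translation_estimate[OF \<phi>(1) b that(1)] .
      also have "\<dots> \<le> h * (P + 1)" using that P by (intro mult_mono) (auto simp: P_def)
      finally show ?thesis using P by (simp add: h_def)
    qed
    define \<Delta> where "\<Delta> = (\<lambda>x. u (x + h *\<^sub>R b) - u x)"
    have \<Delta>: "\<Delta> \<in> L2" "L2norm \<Delta> \<le> h * L2norm D"
      unfolding \<Delta>_def D_def using h by (auto intro!: L2_diff L2_translation u2 W12_translation_estimate[OF u b])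
    have tr: "(\<lambda>x. f (x - s *\<^sub>R b)) \<in> L2" if "f \<in> L2" for f s
      using L2_translation(1)[OF that, of "- s *\<^sub>R b"] by simp
    have trn: "L2norm (\<lambda>x. f (x - s *\<^sub>R b)) = L2norm f" if "f \<in> L2" for f s
      using L2_translation(2)[OF that, of "- s *\<^sub>R b"] by simp
    have gt: "L2norm (\<lambda>x. g (x - h *\<^sub>R b) - g x) \<le> 3 * \<epsilon>"
    proof -
      have "L2norm (\<lambda>x. (g (x - h *\<^sub>R b) - \<phi> (x - h *\<^sub>R b)) + ((\<phi> (x - h *\<^sub>R b) - \<phi> x) + (\<phi> x - g x)))
          \<le> L2norm (\<lambda>x. g (x - h *\<^sub>R b) - \<phi> (x - h *\<^sub>R b)) + (L2norm (\<lambda>x. \<phi> (x - h *\<^sub>R b) - \<phi> x) + L2norm (\<lambda>x. \<phi> x - g x))"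
        by (intro L2norm_triangle[THEN order_trans] add_left_mono L2norm_triangle L2_add L2_diff tr g2 \<phi>2)
      moreover have "L2norm (\<lambda>x. g (x - h *\<^sub>R b) - \<phi> (x - h *\<^sub>R b)) = L2norm (\<lambda>x. g x - \<phi> x)"
        using trn[OF L2_diff[OF g2 \<phi>2], of h] .
      ultimately show ?thesis using \<phi>h[of h] h \<phi>(2) L2norm_minus_commute[of g \<phi>] by simp
    qed
    have "(\<lambda>x. g (x + h *\<^sub>R b) - g x) \<in> L2" by (intro L2_diff L2_translation g2)
    then have gm: "(\<lambda>x. g x - g (x + h *\<^sub>R b)) \<in> L2" using L2_cmult[of _ "-1"] by fastforce
    have gmn: "L2norm (\<lambda>x. g x - g (x + h *\<^sub>R b)) \<le> 3 * \<epsilon>"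
      using gt trn[OF gm, of h] by (simp add: L2norm_minus_commute[of g])
    have A: "\<bar>LINT x|lebesgue. \<Delta> x * g x\<bar> \<le> 3 * \<epsilon> * (h * L2norm D)"
    proof -
      have gmeas: "g \<in> borel_measurable lebesgue" using L2_measurable[OF g2] .
      have q: "(\<lambda>x. g x * (g x - g (x + h *\<^sub>R b))) \<in> L2" "L2norm (\<lambda>x. g x * (g x - g (x + h *\<^sub>R b))) \<le> 1 * L2norm (\<lambda>x. g x - g (x + h *\<^sub>R b))"
        using L2_bounded_mult[OF gm gmeas, of 1] by (simp_all add: g_def indicator_def)
      \<comment> \<open>At a point of \<open>S\<close> whose shift is again in \<open>S\<close>,
        \<Delta> vanishes; at the other points of \<open>S\<close> the inserted factor is 1.\<close>
      have "(\<lambda>x. \<Delta> x * g x) = (\<lambda>x. \<Delta> x * (g x * (g x - g (x + h *\<^sub>R b))))"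
        using S(3) by (auto simp: fun_eq_iff \<Delta>_def g_def indicator_def)
      then have "\<bar>LINT x|lebesgue. \<Delta> x * g x\<bar> \<le> L2norm \<Delta> * L2norm (\<lambda>x. g x * (g x - g (x + h *\<^sub>R b)))"
        using L2_Cauchy_Schwarz[OF \<Delta>(1) q(1)] by simp
      also have "\<dots> \<le> (h * L2norm D) * (3 * \<epsilon>)"
        using \<Delta>(2) q(2) gmn h by (intro mult_mono) auto
      finally show ?thesis by (simp add: mult_ac)
    qed
    have B: "\<bar>(LINT x|lebesgue. \<Delta> x * g x) - (LINT x|lebesgue. \<Delta> x * \<phi> x)\<bar> \<le> \<epsilon> * (h * L2norm D)"
    proof -
      have "(LINT x|lebesgue. \<Delta> x * g x) - (LINT x|lebesgue. \<Delta> x * \<phi> x) = (LINT x|lebesgue. \<Delta> x * (g x - \<phi> x))"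
        using L2_mult_integrable[OF \<Delta>(1) g2] L2_mult_integrable[OF \<Delta>(1) \<phi>2] by (simp add: right_diff_distrib)
      also have "\<bar>\<dots>\<bar> \<le> L2norm \<Delta> * L2norm (\<lambda>x. g x - \<phi> x)" by (rule L2_Cauchy_Schwarz[OF \<Delta>(1) L2_diff[OF g2 \<phi>2]])
      also have "\<dots> \<le> (h * L2norm D) * \<epsilon>" using \<Delta>(2) \<phi>(2) h by (intro mult_mono) auto
      finally show ?thesis by (simp add: mult_ac)
    qed
    obtain s where s: "0 < s" "s < h" "(LINT x|lebesgue. \<Delta> x * \<phi> x) = h * (LINT x|lebesgue. D x * \<phi> (x - s *\<^sub>R b))"
      using W12_difference_mean_value[OF u b \<phi>(1) h] unfolding \<Delta>_def D_def by blast
    have C: "\<bar>(LINT x|lebesgue. D x * \<phi> (x - s *\<^sub>R b)) - (LINT x|lebesgue. D x * g x)\<bar> \<le> 2 * \<epsilon> * L2norm D"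
    proof -
      have d: "(\<lambda>x. (\<phi> (x - s *\<^sub>R b) - \<phi> x) + (\<phi> x - g x)) \<in> L2" by (intro L2_add L2_diff tr g2 \<phi>2)
      have "(LINT x|lebesgue. D x * \<phi> (x - s *\<^sub>R b)) - (LINT x|lebesgue. D x * g x)
          = (LINT x|lebesgue. D x * ((\<phi> (x - s *\<^sub>R b) - \<phi> x) + (\<phi> x - g x)))"
        using L2_mult_integrable[OF D2 tr[OF \<phi>2]] L2_mult_integrable[OF D2 g2] by (simp add: right_diff_distrib)
      also have "\<bar>\<dots>\<bar> \<le> L2norm D * L2norm (\<lambda>x. (\<phi> (x - s *\<^sub>R b) - \<phi> x) + (\<phi> x - g x))"
        by (rule L2_Cauchy_Schwarz[OF D2 d])
      also have "\<dots> \<le> L2norm D * (2 * \<epsilon>)"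
      proof (rule mult_left_mono)
        have "L2norm (\<lambda>x. (\<phi> (x - s *\<^sub>R b) - \<phi> x) + (\<phi> x - g x)) \<le> L2norm (\<lambda>x. \<phi> (x - s *\<^sub>R b) - \<phi> x) + L2norm (\<lambda>x. \<phi> x - g x)"
          by (intro L2norm_triangle L2_diff tr g2 \<phi>2)
        then show "L2norm (\<lambda>x. (\<phi> (x - s *\<^sub>R b) - \<phi> x) + (\<phi> x - g x)) \<le> 2 * \<epsilon>"
          using \<phi>h[of s] s \<phi>(2) L2norm_minus_commute[of g \<phi>] by simp
      qed simp
      finally show ?thesis by (simp add: mult_ac)
    qed
    \<comment> \<open>\<open>A\<close> and \<open>B\<close> contribute 3 + 1 multiples of
      \<epsilon>; the 2 of \<open>C\<close> completes the 6.\<close>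
    have "h * \<bar>LINT x|lebesgue. D x * \<phi> (x - s *\<^sub>R b)\<bar> = \<bar>LINT x|lebesgue. \<Delta> x * \<phi> x\<bar>"
      unfolding s(3) using h by (simp add: abs_mult)
    also have "\<dots> \<le> h * (4 * \<epsilon> * L2norm D)" using A B by (simp add: algebra_simps)
    finally have "\<bar>LINT x|lebesgue. D x * \<phi> (x - s *\<^sub>R b)\<bar> \<le> 4 * \<epsilon> * L2norm D" using h by simp
    with C show ?thesis by (simp add: algebra_simps)
  qed
  have "\<bar>LINT x|lebesgue. D x * g x\<bar> \<le> 0"
  proof (rule field_le_epsilon)
    fix e :: real assume "e > 0"
    define \<epsilon> where "\<epsilon> = e / (6 * (L2norm D + 1))"
    have "L2norm D + 1 > 0" using L2norm_nonneg[of D] by linarith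
    then have "\<epsilon> > 0" using \<open>e > 0\<close> by (simp add: \<epsilon>_def)
    have "\<bar>LINT x|lebesgue. D x * g x\<bar> \<le> 6 * \<epsilon> * L2norm D" by (rule le[OF \<open>\<epsilon> > 0\<close>])
    also have "\<dots> \<le> 6 * \<epsilon> * (L2norm D + 1)" using \<open>\<epsilon> > 0\<close> by simp
    also have "\<dots> = e"
    proof -
      have "6 * (e / (6 * z)) * z = e" if "z > 0" for z using that by simp
      from this[OF \<open>L2norm D + 1 > 0\<close>] show ?thesis unfolding \<epsilon>_def .
    qed
    finally show "\<bar>LINT x|lebesgue. D x * g x\<bar> \<le> 0 + e" by simp
  qed
  then show ?thesis by (simp add: D_def g_def)
qed

text \<open>Take the part of the zero set in a ball where one component of the weak gradient has a
  fixed strict sign. The integral of this component over it is 0, so the part is null.\<close>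

lemma weak_gradient_zero_on_zero_set:
  fixes u :: "'a::euclidean_space \<Rightarrow> real"
  assumes u: "u \<in> W12 UNIV"
  shows "AE x in lebesgue. u x = 0 \<longrightarrow> weak_gradient UNIV u x = 0"
proof -
  have part: "AE x in lebesgue. x \<in> cball 0 (real n) \<longrightarrow> u x = 0 \<longrightarrow> \<sigma> * (weak_gradient UNIV u x \<bullet> b) \<le> 0"
    if b: "b \<in> Basis" and \<sigma>: "\<sigma> \<in> {-1, 1}" for b n \<sigma>
  proof -
    define D where "D = (\<lambda>x. weak_gradient UNIV u x \<bullet> b)"
    have u2: "u \<in> L2" and D2: "D \<in> L2" using W12_partial_L2[OF u b] by (auto simp: D_def)
    define S where "S = cball 0 (real n) \<inter> {x. u x = 0} \<inter> {x. \<sigma> * D x > 0}"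
    have "{x \<in> space lebesgue. u x = 0} \<in> sets lebesgue" "{x \<in> space lebesgue. \<sigma> * D x > 0} \<in> sets lebesgue"
      using L2_measurable[OF u2] L2_measurable[OF D2] by measurable
    then have S: "S \<in> sets lebesgue" unfolding S_def by (intro sets.Int) simp_all
    have bS: "bounded S" unfolding S_def by (rule bounded_subset[OF bounded_cball]) auto
    have z: "(LINT x|lebesgue. D x * indicator S x) = 0"
      unfolding D_def by (rule weak_partial_integral_zero_on_zero_set[OF u b S bS]) (auto simp: S_def)
    have "S \<in> lmeasurable" using bS S bounded_set_imp_lmeasurable by blast
    then have "(\<lambda>x. 1 * indicator S x) \<in> L2" by (rule indicator_L2)
    then have i: "integrable lebesgue (\<lambda>x. D x * indicator S x)" using L2_mult_integrable[OF D2] by simp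
    have i': "integrable lebesgue (\<lambda>x. \<sigma> * (D x * indicator S x))" using i by simp
    have "AE x in lebesgue. \<sigma> * (D x * indicator S x) = 0"
      using z by (intro integral_nonneg_eq_0_iff_AE[OF i', THEN iffD1] AE_I2) (auto simp: S_def indicator_def)
    then show ?thesis
      by eventually_elim (use \<sigma> in \<open>auto simp: S_def D_def indicator_def split: if_splits\<close>)
  qed
  have "AE x in lebesgue. \<forall>b\<in>Basis. \<forall>\<sigma>\<in>{-1, 1}. \<forall>n::nat. x \<in> cball 0 (real n) \<longrightarrow> u x = 0 \<longrightarrow> \<sigma> * (weak_gradient UNIV u x \<bullet> b) \<le> 0"
    by (intro AE_finite_allI AE_all_countable[THEN iffD2] allI part) auto
  then show ?thesis
  proof eventually_elim
    case (elim x)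
    obtain n :: nat where "norm x \<le> n" using real_arch_simple by blast
    then have "x \<in> cball 0 (real n)" by simp
    then have "u x = 0 \<Longrightarrow> b \<in> Basis \<Longrightarrow> weak_gradient UNIV u x \<bullet> b = 0" for b
      using elim[rule_format, of b "-1" n] elim[rule_format, of b 1 n] by force
    then show ?case by (auto intro: euclidean_eqI)
  qed
qed

section \<open>Trial functions\<close>

text \<open>The spaces of \<open>ae_subspace_of_dim\<close> contain all representatives of their
  elements, so weak gradients have to pass to functions that agree only almost everywhere.\<close>

lemma has_weak_gradient_cong_AE:
  fixes u w :: "'a::euclidean_space \<Rightarrow> real"
  assumes u: "has_weak_gradient \<Omega> u G" and ae: "AE x in lebesgue. u x = w x"
  shows "has_weak_gradient \<Omega> w G"
  unfolding has_weak_gradient_iff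
proof (intro conjI allI impI ballI)
  have loc: "locally_integrable \<Omega> u" using u by (simp add: has_weak_gradient_iff)
  show "locally_integrable \<Omega> w"
    unfolding locally_integrable_def set_integrable_def
  proof (intro allI impI)
    fix C assume "compact C \<and> C \<subseteq> \<Omega>"
    then have i: "integrable lebesgue (\<lambda>x. indicator C x *\<^sub>R u x)"
      using loc by (simp add: locally_integrable_def set_integrable_def)
    have ae': "AE x in lebesgue. indicator C x *\<^sub>R u x = indicator C x *\<^sub>R w x"
      using ae by eventually_elim simp
    show "integrable lebesgue (\<lambda>x. indicator C x *\<^sub>R w x)"
      using lebesgue_cong_AE(1)[OF borel_measurable_integrable[OF i] ae'] i by simp
  qed
  show "locally_integrable \<Omega> G" using u by (simp add: has_weak_gradient_iff)
  fix \<phi> b assume \<phi>: "test_function \<Omega> \<phi>" and b: "b \<in> (Basis :: 'a set)"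
  have i: "integrable lebesgue (\<lambda>x. u x * partial_derivative b \<phi> x)"
    by (rule locally_integrable_mult_test[OF loc test_function_partial[OF \<phi> b]])
  have ae': "AE x in lebesgue. u x * partial_derivative b \<phi> x = w x * partial_derivative b \<phi> x"
    using ae by eventually_elim simp
  have "(LINT x|lebesgue. w x * partial_derivative b \<phi> x) = (LINT x|lebesgue. u x * partial_derivative b \<phi> x)"
    using lebesgue_cong_AE(2)[OF borel_measurable_integrable[OF i] ae'] by simp
  also have "\<dots> = - (LINT x|lebesgue. (G x \<bullet> b) * \<phi> x)" using u \<phi> b by (simp add: has_weak_gradient_iff)
  finally show "(LINT x|lebesgue. w x * partial_derivative b \<phi> x) = - (LINT x|lebesgue. (G x \<bullet> b) * \<phi> x)" .
qed

lemma W12_cong_AE: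
  fixes u w :: "'a::euclidean_space \<Rightarrow> real"
  assumes u: "u \<in> W12 UNIV" and ae: "AE x in lebesgue. u x = w x"
  shows "w \<in> W12 UNIV" "sq_integral UNIV w = sq_integral UNIV u"
    "sq_integral UNIV (weak_gradient UNIV w) = sq_integral UNIV (weak_gradient UNIV u)"
proof -
  note wg = weak_gradient_works[OF open_UNIV u]
  note hw = has_weak_gradient_cong_AE[OF wg(2) ae]
  have ae': "AE x in lebesgue. x \<in> UNIV \<longrightarrow> u x = w x" using ae by simp
  show "w \<in> W12 UNIV" using square_integrable_cong_AE(1)[OF wg(1) ae'] hw wg(3) by (rule W12I)
  show "sq_integral UNIV w = sq_integral UNIV u" by (rule square_integrable_cong_AE(2)[OF wg(1) ae'])
  have "AE x in lebesgue. x \<in> UNIV \<longrightarrow> weak_gradient UNIV u x = weak_gradient UNIV w x"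
    using weak_gradient_AE[OF open_UNIV hw] by eventually_elim simp
  then show "sq_integral UNIV (weak_gradient UNIV w) = sq_integral UNIV (weak_gradient UNIV u)"
    by (rule square_integrable_cong_AE(2)[OF wg(3)])
qed

text \<open>By completeness the integrand cut off by the indicator of \<open>A\<close> inherits
  measurability from \<open>F\<close>.\<close>

lemma set_integral_eq_integral_AE:
  fixes F :: "'a::euclidean_space \<Rightarrow> real"
  assumes F: "F \<in> borel_measurable lebesgue" and ae: "AE x in lebesgue. x \<notin> A \<longrightarrow> F x = 0"
  shows "(LINT x:A|lebesgue. F x) = (LINT x|lebesgue. F x)"
proof -
  have ae': "AE x in lebesgue. F x = indicator A x *\<^sub>R F x"
    using ae by eventually_elim (auto simp: indicator_def)
  show ?thesis unfolding set_lebesgue_integral_def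
    using lebesgue_cong_AE(2)[OF F ae'] by simp
qed

text \<open>The exceptional set of zero capacity is null, so \<open>u\<close> vanishes almost
  everywhere off \<open>A\<close>; its weak gradient vanishes almost everywhere on the zero set of
  \<open>u\<close>, so both integrals extend to the whole space.\<close>

lemma rayleigh_quotient_W012:
  fixes u :: "'a::euclidean_space \<Rightarrow> real"
  assumes u: "u \<in> W012 A"
  shows "u \<in> W12 UNIV"
    "rayleigh_quotient A u = sq_integral UNIV (weak_gradient UNIV u) / sq_integral UNIV u"
proof -
  show u1: "u \<in> W12 UNIV" using u by (simp add: W012_def)
  obtain v where v: "AE x in lebesgue. v x = u x" "zero_capacity {x. x \<notin> A \<and> v x \<noteq> 0}"
    using u by (auto simp: W012_def)
  have u0: "AE x in lebesgue. x \<notin> A \<longrightarrow> u x = 0"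
    using v(1) zero_capacity_imp_AE[OF v(2)] by eventually_elim auto
  have g0: "AE x in lebesgue. x \<notin> A \<longrightarrow> weak_gradient UNIV u x = 0"
    using u0 weak_gradient_zero_on_zero_set[OF u1] by eventually_elim auto
  note w = weak_gradient_works[OF open_UNIV u1]
  have 1: "(LINT x:A|lebesgue. (norm (weak_gradient UNIV u x))\<^sup>2) = sq_integral UNIV (weak_gradient UNIV u)"
    unfolding sq_integral_eq using square_integrable_integrable[OF w(3)] g0
    by (subst set_integral_eq_integral_AE) (auto elim!: eventually_mono)
  have 2: "(LINT x:A|lebesgue. (u x)\<^sup>2) = sq_integral UNIV u"
    unfolding sq_integral_eq using square_integrable_integrable[OF w(1)] u0
    by (subst set_integral_eq_integral_AE) (auto elim!: eventually_mono)
  show "rayleigh_quotient A u = sq_integral UNIV (weak_gradient UNIV u) / sq_integral UNIV u"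
    unfolding rayleigh_quotient_def 1 2 ..
qed

lemma quasi_continuous_mult:
  fixes v \<zeta> :: "'a::euclidean_space \<Rightarrow> real"
  assumes "quasi_continuous v" "continuous_on UNIV \<zeta>"
  shows "quasi_continuous (\<lambda>x. \<zeta> x * v x)"
  unfolding quasi_continuous_def
proof (intro allI impI)
  fix x :: 'a and r \<Omega> and \<epsilon> :: real assume "open \<Omega> \<and> compactly_contained (ball x r) \<Omega>" "\<epsilon> > 0"
  then obtain U where U: "open U" "U \<subseteq> ball x r" "capacity \<Omega> U < ereal \<epsilon>" "continuous_on (ball x r - U) v"
    using assms(1)[unfolded quasi_continuous_def, rule_format, of \<Omega> x r \<epsilon>] by auto
  then have "continuous_on (ball x r - U) (\<lambda>x. \<zeta> x * v x)"
    by (intro continuous_on_mult continuous_on_subset[OF assms(2)]) auto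
  with U(1-3) show "\<exists>U. open U \<and> U \<subseteq> ball x r \<and> capacity \<Omega> U < ereal \<epsilon> \<and> continuous_on (ball x r - U) (\<lambda>x. \<zeta> x * v x)"
    by blast
qed

text \<open>If \<open>v\<close> is a quasi-continuous representative of \<open>u\<close>, then
  \<zeta> v is one of the product, and off \<open>A\<close> it is nonzero only where
  \<open>v\<close> is. This is the place where subsets of sets of zero capacity are needed.\<close>

lemma W012_mult:
  fixes u :: "'a::euclidean_space \<Rightarrow> real"
  assumes u: "u \<in> W012 A" and \<zeta>: "smooth \<zeta>"
    and bd: "\<And>x. \<bar>\<zeta> x\<bar> \<le> \<alpha>" "\<And>x. norm (gradient \<zeta> x) \<le> \<beta>" and w: "AE x in lebesgue. w x = \<zeta> x * u x"
  shows "w \<in> W012 A" "sq_integral UNIV w = (L2norm (\<lambda>x. \<zeta> x * u x))\<^sup>2"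
    "sq_integral UNIV (weak_gradient UNIV w)
      \<le> 2 * \<alpha>\<^sup>2 * sq_integral UNIV (weak_gradient UNIV u) + 2 * \<beta>\<^sup>2 * sq_integral UNIV u"
proof -
  have u1: "u \<in> W12 UNIV" using u by (simp add: W012_def)
  obtain v where v: "quasi_continuous v" "AE x in lebesgue. v x = u x" "zero_capacity {x. x \<notin> A \<and> v x \<noteq> 0}"
    using u by (auto simp: W012_def)
  note m = W12_mult[OF open_UNIV open_UNIV u1 \<zeta> closed_UNIV _ _ bd, simplified]
  have ae: "AE x in lebesgue. \<zeta> x * u x = w x" using w by eventually_elim simp
  note c = W12_cong_AE[OF m(1) ae]
  have "quasi_continuous (\<lambda>x. \<zeta> x * v x)" using v(1) smooth_imp_continuous[OF \<zeta>] by (rule quasi_continuous_mult)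
  moreover have "AE x in lebesgue. \<zeta> x * v x = w x" using v(2) w by eventually_elim simp
  moreover have "zero_capacity {x. x \<notin> A \<and> \<zeta> x * v x \<noteq> 0}"
    by (rule zero_capacity_subset[OF v(3)]) auto
  ultimately show "w \<in> W012 A" using c(1) unfolding W012_def by blast
  show "sq_integral UNIV w = (L2norm (\<lambda>x. \<zeta> x * u x))\<^sup>2" unfolding c(2) by (rule sq_integral_UNIV)
  show "sq_integral UNIV (weak_gradient UNIV w)
      \<le> 2 * \<alpha>\<^sup>2 * sq_integral UNIV (weak_gradient UNIV u) + 2 * \<beta>\<^sup>2 * sq_integral UNIV u"
    unfolding c(3) by (rule m(4))
qed

subsection \<open>Periodic bumps\<close>

text \<open>Subtracting the nearest multiple of 2 pi brings \<open>z\<close> within distance pi of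
  0, where the cosine decreases with the distance.\<close>

lemma cos_gt_imp_near_period:
  assumes "cos a < cos z" "0 \<le> a" "a \<le> pi"
  obtains m :: int where "\<bar>z - 2 * pi * m\<bar> < a"
proof -
  define m where "m = round (z / (2 * pi))"
  have m: "\<bar>z - 2 * pi * m\<bar> \<le> pi"
  proof -
    have "\<bar>m - z / (2 * pi)\<bar> \<le> 1 / 2" unfolding m_def by (rule of_int_round_abs_le)
    then have "2 * pi * \<bar>m - z / (2 * pi)\<bar> \<le> pi" using pi_gt_zero by (simp add: field_simps)
    also have "2 * pi * \<bar>m - z / (2 * pi)\<bar> = \<bar>2 * pi * (m - z / (2 * pi))\<bar>" by (simp add: abs_mult)
    also have "2 * pi * (m - z / (2 * pi)) = 2 * pi * m - z" by (simp add: right_diff_distrib)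
    finally show ?thesis by linarith
  qed
  have "cos (z - 2 * pi * m) = cos z"
    by (simp add: cos_diff)
  then have "cos \<bar>z - 2 * pi * m\<bar> = cos z" by simp
  then have "\<bar>z - 2 * pi * m\<bar> < a"
    using cos_monotone_0_pi_le[of a "\<bar>z - 2 * pi * m\<bar>"] m assms by linarith
  then show thesis by (rule that)
qed

text \<open>The phase t x_b is compared on the circle with the centre i pi / k. For k \<ge> 1 the
  bump is positive exactly where they are less than pi / k apart. The 2k centres have spacing pi /
  k, so neighbouring bumps overlap and all of them cover, while those of even index are disjoint.
  For a unit vector \<open>b\<close> and t > 0, index i is index 0 translated along \<open>b\<close>
  by i pi / (k t).\<close>

definition periodic_bump :: "nat \<Rightarrow> 'a::euclidean_space \<Rightarrow> real \<Rightarrow> nat \<Rightarrow> 'a \<Rightarrow> real" where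
  "periodic_bump k b t i x = bump (cos (t * (x \<bullet> b) - real i * (pi / real k)) - cos (pi / real k))"

lemma smooth_periodic_bump: "smooth (periodic_bump k b t i)"
  unfolding periodic_bump_def
  by (intro smooth_bump smooth_diff smooth_cos smooth_mult smooth_const smooth_inner)

lemma periodic_bump_abs_le: "\<bar>periodic_bump k b t i x\<bar> \<le> 1"
  by (simp add: periodic_bump_def)

text \<open>The chain rule gives three factors: the derivative of \<open>bump\<close>, at most 2 in
  absolute value, a sine, and \<open>t\<close> from the phase.\<close>

lemma periodic_bump_gradient_le:
  assumes "norm b = 1" "t > 0"
  shows "norm (gradient (periodic_bump k b t i) x) \<le> 2 * t"
proof -
  obtain d where d: "\<And>s. (bump has_real_derivative d s) (at s)" "\<And>s. \<bar>d s\<bar> \<le> 2"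
    using bump_derivative by metis
  let ?y = "t * (x \<bullet> b) - real i * (pi / real k)"
  have "((\<lambda>x. bump (cos (t * (x \<bullet> b) - real i * (pi / real k)) - cos (pi / real k))) has_derivative
      (\<lambda>h. h \<bullet> ((d (cos ?y - cos (pi / real k)) * (- sin ?y) * t) *\<^sub>R b))) (at x)"
    by (rule has_derivative_compose[OF _ d(1)[unfolded has_field_derivative_def], THEN has_derivative_eq_rhs])
       (auto intro!: derivative_eq_intros simp: fun_eq_iff)
  then have "gradient (periodic_bump k b t i) x = (d (cos ?y - cos (pi / real k)) * (- sin ?y) * t) *\<^sub>R b"
    unfolding periodic_bump_def by (rule gradient_eqI)
  then have "norm (gradient (periodic_bump k b t i) x) = \<bar>d (cos ?y - cos (pi / real k))\<bar> * \<bar>sin ?y\<bar> * t"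
    using assms by (simp add: abs_mult)
  also have "\<dots> \<le> 2 * 1 * t"
    using assms d(2) by (intro mult_right_mono mult_mono) auto
  finally show ?thesis by simp
qed

lemma periodic_bump_shift:
  assumes "norm b = 1" "t > 0"
  shows "periodic_bump k b t i (x + (real i * (pi / real k) / t) *\<^sub>R b) = periodic_bump k b t 0 x"
proof -
  have "b \<bullet> b = 1" using assms by (simp add: norm_eq_1)
  then show ?thesis using assms by (simp add: periodic_bump_def inner_add_left distrib_left)
qed

text \<open>The value of a bump at phase distance pi / (2k) from its centre, half the spacing of the
  centres: no phase is farther from the nearest centre.\<close>

definition bump_height :: "nat \<Rightarrow> real" where
  "bump_height k = bump (cos (pi / (2 * real k)) - cos (pi / real k))"

lemma bump_height_pos:
  assumes "k \<ge> 1" shows "bump_height k > 0"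
proof -
  have "cos (pi / real k) < cos (pi / (2 * real k))"
    using assms by (intro cos_monotone_0_pi) (auto simp: field_simps)
  then show ?thesis by (simp add: bump_height_def flat_exp_def)
qed

text \<open>Rounding the phase to the nearest multiple of pi / k finds a centre within pi / (2k);
  its index modulo 2k names a bump of height at least \<open>bump_height k\<close> at
  \<open>x\<close>, and this one term already bounds the sum.\<close>

lemma periodic_bump_cover:
  assumes "k \<ge> 1"
  shows "(bump_height k)\<^sup>2 \<le> (\<Sum>i<2 * k. (periodic_bump k b t i x)\<^sup>2)"
proof -
  define y where "y = t * (x \<bullet> b)"
  define n where "n = round (y / (pi / real k))"
  define i where "i = nat (n mod int (2 * k))"
  have pk: "pi / real k > 0" using assms by simp
  have i: "i < 2 * k" using assms by (auto simp: i_def nat_less_iff)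
  have ni: "real_of_int n = real i + real (2 * k) * real_of_int (n div int (2 * k))"
  proof -
    have "int i = n mod int (2 * k)" using assms by (simp add: i_def)
    then have "n = int i + int (2 * k) * (n div int (2 * k))" by (simp add: mod_mult_div_eq)
    then have "real_of_int n = real_of_int (int i + int (2 * k) * (n div int (2 * k)))" by (rule arg_cong)
    then show ?thesis by simp
  qed
  define z where "z = y - n * (pi / real k)"
  have "\<bar>z\<bar> \<le> pi / (2 * real k)"
  proof -
    have "\<bar>n - y / (pi / real k)\<bar> \<le> 1 / 2" unfolding n_def by (rule of_int_round_abs_le)
    then have "(pi / real k) * \<bar>n - y / (pi / real k)\<bar> \<le> (pi / real k) * (1 / 2)"
      using pk by (intro mult_left_mono) auto
    also have "(pi / real k) * \<bar>n - y / (pi / real k)\<bar> = \<bar>(pi / real k) * (n - y / (pi / real k))\<bar>"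
      using pk by (simp only: abs_mult abs_of_pos)
    also have "(pi / real k) * (n - y / (pi / real k)) = - z"
      using assms by (simp add: z_def right_diff_distrib mult.commute)
    finally show ?thesis by simp
  qed
  moreover have "pi / (2 * real k) \<le> pi" using assms by (simp add: field_simps)
  ultimately have cz: "cos (pi / (2 * real k)) \<le> cos \<bar>z\<bar>" by (intro cos_monotone_0_pi_le) auto
  have "y - real i * (pi / real k) = z + 2 * pi * real_of_int (n div int (2 * k))"
    unfolding z_def ni using assms by (simp add: field_simps)
  then have "cos (y - real i * (pi / real k)) = cos \<bar>z\<bar>" by (simp add: cos_add)
  then have "bump_height k \<le> periodic_bump k b t i x"
    unfolding periodic_bump_def bump_height_def y_def[symmetric] using cz by (intro bump_mono) simp
  then have "(bump_height k)\<^sup>2 \<le> (periodic_bump k b t i x)\<^sup>2"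
    by (intro power_mono) (auto simp: bump_height_def)
  also have "\<dots> \<le> (\<Sum>i<2 * k. (periodic_bump k b t i x)\<^sup>2)"
    using i by (intro member_le_sum) auto
  finally show ?thesis .
qed

text \<open>Centres of even index are at least 2 pi / k apart, twice the radius of a bump. Were two
  bumps positive at the same phase, the integer \<open>q\<close> measuring the distance of their
  centres in units of 2 pi / k would satisfy |q| < 1, so \<open>j\<close> and \<open>j'\<close>
  would agree modulo \<open>k\<close>.\<close>

lemma periodic_bump_disjoint:
  assumes "j < k" "j' < k" "j \<noteq> j'"
  shows "periodic_bump k b t (2 * j) x * periodic_bump k b t (2 * j') x = 0"
proof (rule ccontr)
  define y where "y = t * (x \<bullet> b)"
  have k: "k > 0" using assms by simp
  have pk: "0 \<le> pi / real k" "pi / real k \<le> pi" using k by (auto simp: field_simps)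
  assume "\<not> ?thesis"
  then have "cos (pi / real k) < cos (y - real (2 * j) * (pi / real k))"
    "cos (pi / real k) < cos (y - real (2 * j') * (pi / real k))"
    by (auto simp: periodic_bump_def y_def not_le)
  then obtain m m' :: int where m: "\<bar>y - real (2 * j) * (pi / real k) - 2 * pi * m\<bar> < pi / real k"
    "\<bar>y - real (2 * j') * (pi / real k) - 2 * pi * m'\<bar> < pi / real k"
    using cos_gt_imp_near_period[OF _ pk] by metis
  define q where "q = int j - int j' + int k * (m - m')"
  have "(2 * (pi / real k)) * q = real (2 * j) * (pi / real k) + 2 * pi * m - (real (2 * j') * (pi / real k) + 2 * pi * m')"
    using k by (simp add: q_def field_simps)
  moreover have "\<bar>p - p'\<bar> < 2 * r" if "\<bar>y - p\<bar> < r" "\<bar>y - p'\<bar> < r" for p p' r :: real using that by linarith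
  ultimately have "\<bar>(2 * (pi / real k)) * q\<bar> < 2 * (pi / real k)" using m by (simp only: diff_diff_eq)
  then have "(2 * (pi / real k)) * \<bar>real_of_int q\<bar> < (2 * (pi / real k)) * 1"
    using k by (simp add: abs_mult)
  then have "\<bar>real_of_int q\<bar> < 1" using k by (subst (asm) mult_less_cancel_left_pos) auto
  then have "q = 0" by linarith
  then have "int j' - int j = int k * (m - m')" by (simp add: q_def)
  then have "int j' mod int k = int j mod int k" by (simp add: mod_eq_dvd_iff)
  then show False using assms by simp
qed

lemma sum_power2_orthogonal:
  fixes y :: "'i \<Rightarrow> real"
  assumes "finite I" "\<And>i j. i \<in> I \<Longrightarrow> j \<in> I \<Longrightarrow> i \<noteq> j \<Longrightarrow> y i * y j = 0"
  shows "(\<Sum>i\<in>I. y i)\<^sup>2 = (\<Sum>i\<in>I. (y i)\<^sup>2)"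
proof -
  have "(\<Sum>i\<in>I. y i)\<^sup>2 = (\<Sum>i\<in>I. \<Sum>j\<in>I. y i * y j)" by (simp add: power2_eq_square sum_product)
  also have "\<dots> = (\<Sum>i\<in>I. \<Sum>j\<in>I. if j = i then (y i)\<^sup>2 else 0)"
    using assms by (intro sum.cong) (auto simp: power2_eq_square)
  also have "\<dots> = (\<Sum>i\<in>I. (y i)\<^sup>2)" using assms(1) by simp
  finally show ?thesis .
qed

lemma gradient_sum:
  assumes "\<And>i. i \<in> I \<Longrightarrow> smooth (f i)"
  shows "gradient (\<lambda>x. \<Sum>i\<in>I. a i * f i x) x = (\<Sum>i\<in>I. a i *\<^sub>R gradient (f i) x)"
proof (rule gradient_eqI)
  have "((\<lambda>x. \<Sum>i\<in>I. a i * f i x) has_derivative (\<lambda>h. \<Sum>i\<in>I. a i * (h \<bullet> gradient (f i) x))) (at x)"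
    using assms by (intro has_derivative_sum has_derivative_mult_right smooth_has_derivative)
  then show "((\<lambda>x. \<Sum>i\<in>I. a i * f i x) has_derivative (\<lambda>h. h \<bullet> (\<Sum>i\<in>I. a i *\<^sub>R gradient (f i) x))) (at x)"
    by (simp add: inner_sum_right)
qed

text \<open>Since \<open>u\<close> cannot oscillate at scales much below \<open>L2norm u / L2norm (D u)\<close>, the translates of
  a periodic bump of that scale all carry comparable parts of the mass of \<open>u\<close>.\<close>

lemma periodic_bump_mass:
  fixes u :: "'a::euclidean_space \<Rightarrow> real" and k :: nat
  defines "c \<equiv> bump_height k"
  assumes k: "k \<ge> 1" and u: "u \<in> W12 UNIV" and b: "b \<in> Basis" and R: "R > 0"
    and E: "sq_integral UNIV (weak_gradient UNIV u) \<le> R * sq_integral UNIV u"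
    and t: "t = 8 * pi * sqrt (2 * real k) / c * sqrt R" and i: "i < 2 * k"
  shows "c\<^sup>2 / (8 * real k) * sq_integral UNIV u \<le> (L2norm (\<lambda>x. periodic_bump k b t i x * u x))\<^sup>2"
proof -
  have b1: "norm b = 1" using b by simp
  have c: "c > 0" using bump_height_pos[OF k] by (simp add: c_def)
  have tp: "t > 0" unfolding t using c k R by (intro mult_pos_pos divide_pos_pos) auto
  define N where "N = (\<lambda>i. L2norm (\<lambda>x. periodic_bump k b t i x * u x))"
  define D where "D = L2norm (\<lambda>x. weak_gradient UNIV u x \<bullet> b)"
  define U where "U = L2norm u"
  \<comment> \<open>The shifts that carry index 0 to the other indices stay within one period 2 pi /
    t, so \<delta> bounds the \<open>L2\<close> change of \<open>u\<close> under each of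
    them.\<close>
  define \<delta> where "\<delta> = 2 * pi / t * D"
  note u2 = W12_partial_L2[OF u b]
  have meas: "periodic_bump k b t i \<in> borel_measurable lebesgue" for i
    by (intro smooth_measurable smooth_periodic_bump)
  have bu: "(\<lambda>x. periodic_bump k b t i x * f x) \<in> L2"
    "L2norm (\<lambda>x. periodic_bump k b t i x * f x) \<le> L2norm f" if "f \<in> L2" for i f
    using L2_bounded_mult[OF that meas periodic_bump_abs_le] by simp_all
  have U: "sq_integral UNIV u = U\<^sup>2" by (simp add: U_def sq_integral_UNIV)
  have "D\<^sup>2 \<le> (sqrt R * U)\<^sup>2" using u2(3) E R unfolding D_def U by (simp add: power_mult_distrib)
  then have D: "D \<le> sqrt R * U" by (rule power2_le_imp_le) (use R in \<open>simp add: U_def\<close>)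
  \<comment> \<open>The constant in \<open>t\<close> is made for this bound: 2 \<delta> sqrt (2k) is
    then at most c U / 2.\<close>
  have \<delta>: "\<delta> \<le> c / (4 * sqrt (2 * real k)) * U"
  proof -
    have "\<delta> \<le> 2 * pi / t * (sqrt R * U)" unfolding \<delta>_def using D tp by (intro mult_left_mono) auto
    also have "\<dots> = c / (4 * sqrt (2 * real k)) * U"
      unfolding t using c R k by (simp add: field_simps)
    finally show ?thesis .
  qed
  have comp: "N i \<le> N 0 + \<delta>" "N 0 \<le> N i + \<delta>" if i: "i < 2 * k" for i
  proof -
    define s where "s = real i * (pi / real k) / t"
    have s: "s \<ge> 0" "s \<le> 2 * pi / t" using i k tp by (auto simp: s_def field_simps)
    define us where "us = (\<lambda>x. u (x + s *\<^sub>R b))"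
    have us: "us \<in> L2" unfolding us_def by (rule L2_translation(1)[OF u2(1)])
    have Ni: "N i = L2norm (\<lambda>x. periodic_bump k b t 0 x * us x)"
      using L2_translation(2)[OF bu(1)[OF u2(1)], of i "s *\<^sub>R b"] periodic_bump_shift[OF b1 tp, of k i]
      by (simp add: N_def us_def s_def)
    have "L2norm (\<lambda>x. us x - u x) \<le> s * D"
      unfolding us_def D_def by (rule W12_translation_estimate[OF u b s(1)])
    also have "\<dots> \<le> \<delta>" unfolding \<delta>_def using s by (intro mult_right_mono) (auto simp: D_def)
    finally have d: "L2norm (\<lambda>x. us x - u x) \<le> \<delta>" .
    have diff: "L2norm (\<lambda>x. periodic_bump k b t 0 x * us x - periodic_bump k b t 0 x * u x) \<le> \<delta>"
      using bu(2)[OF L2_diff[OF us u2(1)], of 0] d by (simp add: right_diff_distrib)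
    have N0: "N 0 = L2norm (\<lambda>x. periodic_bump k b t 0 x * u x)" by (simp add: N_def)
    show "N i \<le> N 0 + \<delta>"
      using L2norm_triangle_diff[OF bu(1)[OF us, of 0] bu(1)[OF u2(1), of 0]] diff unfolding Ni N0 by linarith
    show "N 0 \<le> N i + \<delta>"
      using L2norm_triangle_diff[OF bu(1)[OF u2(1), of 0] bu(1)[OF us, of 0]] diff
        L2norm_minus_commute[of "\<lambda>x. periodic_bump k b t 0 x * us x" "\<lambda>x. periodic_bump k b t 0 x * u x"]
      unfolding Ni N0 by linarith
  qed
  have \<delta>0: "\<delta> \<ge> 0" using tp by (simp add: \<delta>_def D_def)
  have N0: "N i \<ge> 0" for i by (simp add: N_def)
  \<comment> \<open>The covering bound sums the masses of all 2k bumps. Passing from each of them to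
    index 0 and from there to the given index costs 2 \<delta>, which the left-hand side
    absorbs.\<close>
  have "(c * U)\<^sup>2 = (LINT x|lebesgue. c\<^sup>2 * (u x)\<^sup>2)"
    using L2_integrable[OF u2(1)] by (simp add: U_def power_mult_distrib L2norm_power2)
  also have "\<dots> \<le> (LINT x|lebesgue. (\<Sum>i<2 * k. (periodic_bump k b t i x * u x)\<^sup>2))"
  proof (rule integral_mono)
    show "integrable lebesgue (\<lambda>x. c\<^sup>2 * (u x)\<^sup>2)" using L2_integrable[OF u2(1)] by simp
    show "integrable lebesgue (\<lambda>x. \<Sum>i<2 * k. (periodic_bump k b t i x * u x)\<^sup>2)"
      by (intro Bochner_Integration.integrable_sum L2_integrable bu u2)
    show "c\<^sup>2 * (u x)\<^sup>2 \<le> (\<Sum>i<2 * k. (periodic_bump k b t i x * u x)\<^sup>2)" for x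
      using mult_right_mono[OF periodic_bump_cover[OF k, of b t x], of "(u x)\<^sup>2"]
      by (simp add: c_def power_mult_distrib sum_distrib_right)
  qed
  also have "\<dots> = (\<Sum>i<2 * k. (N i)\<^sup>2)"
    unfolding N_def L2norm_power2
    by (intro Bochner_Integration.integral_sum L2_integrable bu u2)
  also have "\<dots> \<le> (\<Sum>i<2 * k. (N 0 + \<delta>)\<^sup>2)"
    using comp(1) N0 by (intro sum_mono power_mono) auto
  also have "\<dots> = (sqrt (2 * real k) * (N 0 + \<delta>))\<^sup>2" by (simp add: power_mult_distrib)
  finally have "c * U \<le> sqrt (2 * real k) * (N 0 + \<delta>)"
    by (rule power2_le_imp_le) (use N0[of 0] \<delta>0 in simp)
  also have "\<dots> \<le> sqrt (2 * real k) * (N i + 2 * \<delta>)"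
    using comp(2)[OF i] by (intro mult_left_mono) auto
  also have "\<dots> \<le> sqrt (2 * real k) * (N i + 2 * (c / (4 * sqrt (2 * real k)) * U))"
    using \<delta> by (intro mult_left_mono add_left_mono) auto
  also have "\<dots> = sqrt (2 * real k) * N i + c * U / 2"
    using k by (simp add: distrib_left)
  finally have "c * U / 2 \<le> sqrt (2 * real k) * N i" by simp
  then have "(c * U / 2)\<^sup>2 \<le> (sqrt (2 * real k) * N i)\<^sup>2"
    by (rule power_mono) (use c in \<open>simp add: U_def\<close>)
  then have "(c * U)\<^sup>2 / 4 \<le> 2 * real k * (N i)\<^sup>2" by (simp add: power_mult_distrib power_divide)
  then have "c\<^sup>2 / (8 * real k) * U\<^sup>2 \<le> (N i)\<^sup>2" using k by (simp add: field_simps)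
  then show ?thesis unfolding U N_def .
qed

section \<open>From one function to a k-dimensional trial space\<close>

lemma dirichlet_eigenvalue_le:
  assumes "ae_subspace_of_dim j K" "K \<subseteq> W012 A"
    and "\<And>w. w \<in> K \<Longrightarrow> \<not> (AE x in lebesgue. w x = 0) \<Longrightarrow> rayleigh_quotient A w \<le> C"
  shows "dirichlet_eigenvalue j A \<le> ereal C"
  unfolding dirichlet_eigenvalue_def
  using assms by (intro INF_lower2[of K] SUP_least) auto

text \<open>Bumps of even index have disjoint supports, so the squared norm of a combination with
  coefficients a_j is the sum of a_j^2 times the single masses, at least c^2 / (8k) U S with S the
  sum of the a_j^2. The gradient is estimated through the sum of the |a_j|, whose square is at most
  k S, which gives 2k (1 + 4 \<tau>^2) R S U. The constant is the quotient of these two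
  bounds.\<close>

lemma dirichlet_eigenvalue_le_rayleigh:
  fixes u :: "'a::euclidean_space \<Rightarrow> real" and k :: nat
  defines "c \<equiv> bump_height k"
  defines "\<tau> \<equiv> 8 * pi * sqrt (2 * real k) / c"
  assumes k: "k \<ge> 1" and u: "u \<in> W012 A" "\<not> (AE x in lebesgue. u x = 0)"
    and R: "rayleigh_quotient A u < R"
  shows "dirichlet_eigenvalue k A \<le> ereal (16 * (real k)\<^sup>2 * (1 + 4 * \<tau>\<^sup>2) / c\<^sup>2 * R)"
proof -
  obtain b :: 'a where b: "b \<in> Basis" using nonempty_Basis by blast
  have b1: "norm b = 1" using b by simp
  note rq = rayleigh_quotient_W012[OF u(1)]
  define E U where "E = sq_integral UNIV (weak_gradient UNIV u)" and "U = sq_integral UNIV u"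
  have u2: "u \<in> L2" using W12_partial_L2(1)[OF rq(1) b] .
  have pos: "sq_integral UNIV w > 0" if "w \<in> L2" "\<not> (AE x in lebesgue. w x = 0)" for w :: "'a \<Rightarrow> real"
  proof -
    have "sq_integral UNIV w \<noteq> 0"
      using integral_nonneg_eq_0_iff_AE[OF L2_integrable[OF that(1)]] that(2)
      by (simp add: sq_integral_UNIV L2norm_power2)
    then show ?thesis using sq_integral_nonneg[of UNIV w] by linarith
  qed
  have U: "U > 0" unfolding U_def using pos[OF u2 u(2)] .
  have E0: "E \<ge> 0" by (simp add: E_def)
  \<comment> \<open>A nonnegative quotient lies strictly below \<open>R\<close>; the positivity of
    \<open>t\<close> rests on this.\<close>
  have R0: "R > 0"
    using R E0 U unfolding rq(2) E_def[symmetric] U_def[symmetric] by (smt (verit) divide_nonneg_pos)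
  have E: "E \<le> R * U"
    using R U unfolding rq(2) E_def[symmetric] U_def[symmetric] by (simp add: field_simps)
  have c: "c > 0" using bump_height_pos[OF k] by (simp add: c_def)
  define t where "t = \<tau> * sqrt R"
  have tp: "t > 0" unfolding t_def \<tau>_def using c k R0 by (intro mult_pos_pos divide_pos_pos) auto
  have t2: "t\<^sup>2 = \<tau>\<^sup>2 * R" using R0 by (simp add: t_def power_mult_distrib)
  define \<rho> where "\<rho> = (\<lambda>j. periodic_bump k b t (2 * j))"
  define v where "v = (\<lambda>j x. \<rho> j x * u x)"
  define \<Psi> where "\<Psi> = (\<lambda>(a::nat \<Rightarrow> real) x. \<Sum>j<k. a j * \<rho> j x)"
  have comb: "(\<Sum>j<k. a j * v j x) = \<Psi> a x * u x" for a x
    by (simp add: \<Psi>_def v_def sum_distrib_right mult.assoc)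
  have sm: "smooth (\<rho> j)" for j unfolding \<rho>_def by (rule smooth_periodic_bump)
  have \<Psi>sm: "smooth (\<Psi> a)" for a unfolding \<Psi>_def by (intro smooth_sum smooth_mult smooth_const sm)
  have \<Psi>1: "\<bar>\<Psi> a x\<bar> \<le> (\<Sum>j<k. \<bar>a j\<bar>)" for a x
  proof -
    have "\<bar>\<Psi> a x\<bar> \<le> (\<Sum>j<k. \<bar>a j * \<rho> j x\<bar>)" unfolding \<Psi>_def by (rule sum_abs)
    also have "\<dots> \<le> (\<Sum>j<k. \<bar>a j\<bar>)"
    proof (rule sum_mono)
      fix j
      show "\<bar>a j * \<rho> j x\<bar> \<le> \<bar>a j\<bar>"
        using mult_left_mono[OF periodic_bump_abs_le abs_ge_zero[of "a j"]] by (simp add: abs_mult \<rho>_def)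
    qed
    finally show ?thesis .
  qed
  have \<Psi>2: "norm (gradient (\<Psi> a) x) \<le> 2 * t * (\<Sum>j<k. \<bar>a j\<bar>)" for a x
  proof -
    have "norm (gradient (\<Psi> a) x) \<le> (\<Sum>j<k. norm (a j *\<^sub>R gradient (\<rho> j) x))"
      unfolding \<Psi>_def gradient_sum[OF sm] by (rule norm_sum)
    also have "\<dots> \<le> (\<Sum>j<k. \<bar>a j\<bar> * (2 * t))"
      using periodic_bump_gradient_le[OF b1 tp] by (intro sum_mono) (simp add: \<rho>_def mult_left_mono)
    finally show ?thesis by (simp add: sum_distrib_left mult.commute)
  qed
  have mass: "c\<^sup>2 / (8 * real k) * U * (\<Sum>j<k. (a j)\<^sup>2) \<le> (L2norm (\<lambda>x. \<Psi> a x * u x))\<^sup>2" for a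
  proof -
    have v2: "v j \<in> L2" for j unfolding v_def \<rho>_def
      using L2_bounded_mult(1)[OF u2 smooth_measurable[OF smooth_periodic_bump] periodic_bump_abs_le] .
    have "c\<^sup>2 / (8 * real k) * U * (\<Sum>j<k. (a j)\<^sup>2) = (\<Sum>j<k. (a j)\<^sup>2 * (c\<^sup>2 / (8 * real k) * U))"
      unfolding sum_distrib_left by (simp add: mult.commute)
    also have "\<dots> \<le> (\<Sum>j<k. (a j)\<^sup>2 * (L2norm (v j))\<^sup>2)"
      unfolding v_def \<rho>_def U_def c_def
      using periodic_bump_mass[OF k rq(1) b R0 E[unfolded E_def U_def] t_def[unfolded \<tau>_def c_def]]
      by (intro sum_mono mult_left_mono) auto
    also have "\<dots> = (LINT x|lebesgue. (\<Sum>j<k. (a j)\<^sup>2 * (v j x)\<^sup>2))"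
      using L2_integrable[OF v2] by (simp add: L2norm_power2)
    also have "\<dots> = (LINT x|lebesgue. (\<Psi> a x * u x)\<^sup>2)"
    proof (intro Bochner_Integration.integral_cong refl)
      fix x
      have "(\<Sum>j<k. a j * v j x)\<^sup>2 = (\<Sum>j<k. (a j * v j x)\<^sup>2)"
      proof (rule sum_power2_orthogonal)
        fix i j assume "i \<in> {..<k}" "j \<in> {..<k}" "i \<noteq> j"
        then have "\<rho> i x * \<rho> j x = 0" unfolding \<rho>_def by (intro periodic_bump_disjoint) auto
        then show "a i * v i x * (a j * v j x) = 0" by (auto simp: v_def)
      qed simp
      then show "(\<Sum>j<k. (a j)\<^sup>2 * (v j x)\<^sup>2) = (\<Psi> a x * u x)\<^sup>2"
        by (simp add: comb power_mult_distrib)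
    qed
    finally show ?thesis by (simp add: L2norm_power2)
  qed
  have \<gamma>: "c\<^sup>2 / (8 * real k) * U > 0" using c k U by simp
  \<comment> \<open>The lower bound for the mass doubles as linear independence of the trial
    functions.\<close>
  have nonzero: "a i = 0" if "(L2norm (\<lambda>x. \<Psi> a x * u x))\<^sup>2 = 0" "i < k" for a i
  proof -
    have "c\<^sup>2 / (8 * real k) * U * (\<Sum>j<k. (a j)\<^sup>2) \<le> 0" using mass[of a] that(1) by simp
    then have "(\<Sum>j<k. (a j)\<^sup>2) \<le> 0" using \<gamma> by (metis mult_pos_pos not_le)
    then have "(\<Sum>j<k. (a j)\<^sup>2) = 0" by (meson antisym sum_nonneg zero_le_power2)
    then show ?thesis using that(2) by (simp add: sum_nonneg_eq_0_iff)
  qed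
  define K where "K = {w. \<exists>a::nat \<Rightarrow> real. AE x in lebesgue. w x = (\<Sum>j<k. a j * v j x)}"
  have Kmult: "w \<in> W012 A"
    "sq_integral UNIV w = (L2norm (\<lambda>x. \<Psi> a x * u x))\<^sup>2"
    "sq_integral UNIV (weak_gradient UNIV w) \<le> 2 * (\<Sum>j<k. \<bar>a j\<bar>)\<^sup>2 * E + 2 * (2 * t * (\<Sum>j<k. \<bar>a j\<bar>))\<^sup>2 * U"
    if "AE x in lebesgue. w x = (\<Sum>j<k. a j * v j x)" for w a
    using W012_mult[OF u(1) \<Psi>sm \<Psi>1 \<Psi>2 that[unfolded comb]] by (auto simp: E_def U_def)
  show ?thesis
  proof (rule dirichlet_eigenvalue_le)
    show "ae_subspace_of_dim k K"
      unfolding ae_subspace_of_dim_def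
    proof (intro exI[of _ v] conjI allI impI)
      fix a :: "nat \<Rightarrow> real" and i assume ae: "AE x in lebesgue. (\<Sum>i<k. a i * v i x) = 0" and "i < k"
      have ae': "AE x in lebesgue. (\<Psi> a x * u x)\<^sup>2 = 0" using ae unfolding comb by eventually_elim simp
      have "(L2norm (\<lambda>x. \<Psi> a x * u x))\<^sup>2 = 0"
        unfolding L2norm_power2 using integral_eq_zero_AE[OF ae'] .
      then show "a i = 0" using \<open>i < k\<close> by (rule nonzero)
    qed (simp add: K_def)
    show "K \<subseteq> W012 A" using Kmult(1) by (auto simp: K_def)
    fix w assume w: "w \<in> K" "\<not> (AE x in lebesgue. w x = 0)"
    then obtain a where a: "AE x in lebesgue. w x = (\<Sum>j<k. a j * v j x)" by (auto simp: K_def)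
    define S where "S = (\<Sum>j<k. (a j)\<^sup>2)"
    note m = Kmult[OF a]
    note wq = rayleigh_quotient_W012[OF m(1)]
    have "w \<in> L2" using W12_partial_L2(1)[OF wq(1) b] .
    then have wpos: "sq_integral UNIV w > 0" using pos w(2) by blast
    have "(\<Sum>j<k. \<bar>a j\<bar>)\<^sup>2 \<le> real k * S"
      using sum_squared_le_sum_of_squares[of "\<lambda>j. \<bar>a j\<bar>" "{..<k}"] by (simp add: S_def mult.commute)
    have S0: "S \<ge> 0" by (simp add: S_def sum_nonneg)
    have "S \<noteq> 0"
    proof
      assume "S = 0"
      then have a0: "a j = 0" if "j < k" for j using that by (simp add: S_def sum_nonneg_eq_0_iff)
      have "AE x in lebesgue. w x = 0" using a by eventually_elim (simp add: a0)
      then show False using w(2) by blast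
    qed
    then have S: "S > 0" using S0 by simp
    have "sq_integral UNIV (weak_gradient UNIV w) \<le> 2 * (\<Sum>j<k. \<bar>a j\<bar>)\<^sup>2 * (E + 4 * t\<^sup>2 * U)"
      using m(3) by (simp add: power_mult_distrib algebra_simps)
    also have "\<dots> \<le> 2 * (real k * S) * (R * U + 4 * t\<^sup>2 * U)"
      using \<open>(\<Sum>j<k. \<bar>a j\<bar>)\<^sup>2 \<le> real k * S\<close> E E0 U S0 by (intro mult_mono add_mono) auto
    also have "\<dots> = 2 * real k * (1 + 4 * \<tau>\<^sup>2) * R * (S * U)" by (simp add: t2 algebra_simps)
    also have "\<dots> = 16 * (real k)\<^sup>2 * (1 + 4 * \<tau>\<^sup>2) / c\<^sup>2 * R * (c\<^sup>2 / (8 * real k) * U * S)"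
      using c k by (simp add: power2_eq_square)
    also have "\<dots> \<le> 16 * (real k)\<^sup>2 * (1 + 4 * \<tau>\<^sup>2) / c\<^sup>2 * R * sq_integral UNIV w"
      unfolding m(2) using mass[of a] R0 c by (intro mult_left_mono) (auto simp: S_def)
    finally show "rayleigh_quotient A w \<le> 16 * (real k)\<^sup>2 * (1 + 4 * \<tau>\<^sup>2) / c\<^sup>2 * R"
      unfolding wq(2) using wpos by (simp add: pos_divide_le_eq)
  qed
qed

text \<open>A one-dimensional space enters through a generator, whose quotient is at most the
  supremum over the space. Dividing the left-hand side by \<open>M\<close> leaves a bare infimum on
  the right, so each space can be treated separately.\<close>

lemma dirichlet_eigenvalue_le_first:
  fixes A :: "'a::euclidean_space set"
  assumes M: "M > 0" and le: "\<And>u R. u \<in> W012 A \<Longrightarrow> \<not> (AE x in lebesgue. u x = 0) \<Longrightarrow>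
      rayleigh_quotient A u < R \<Longrightarrow> dirichlet_eigenvalue k A \<le> ereal (M * R)"
  shows "dirichlet_eigenvalue k A \<le> ereal M * dirichlet_eigenvalue 1 A"
proof -
  have "dirichlet_eigenvalue k A / ereal M \<le> dirichlet_eigenvalue 1 A"
    unfolding dirichlet_eigenvalue_def[of 1]
  proof (rule INF_greatest)
    fix K assume "K \<in> {K. ae_subspace_of_dim 1 K \<and> K \<subseteq> W012 A}"
    then have K: "ae_subspace_of_dim 1 K" "K \<subseteq> W012 A" by auto
    obtain u :: "nat \<Rightarrow> 'a \<Rightarrow> real" where u:
      "\<And>a::nat \<Rightarrow> real. (AE x in lebesgue. (\<Sum>i<1. a i * u i x) = 0) \<Longrightarrow> (\<forall>i<1. a i = 0)"
      "K = {w. \<exists>a::nat \<Rightarrow> real. AE x in lebesgue. w x = (\<Sum>i<1. a i * u i x)}"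
      using K(1) unfolding ae_subspace_of_dim_def by blast
    have u0: "u 0 \<in> K" unfolding u(2) by (auto intro!: exI[of _ "\<lambda>_. 1"])
    have nz: "\<not> (AE x in lebesgue. u 0 x = 0)" using u(1)[of "\<lambda>_. 1"] by auto
    have "dirichlet_eigenvalue k A \<le> ereal (M * rayleigh_quotient A (u 0))"
    proof (rule ereal_le_epsilon2)
      fix e :: real assume "e > 0"
      \<comment> \<open>The surplus e / M provides the strict inequality that \<open>le\<close> asks
        for and costs exactly e.\<close>
      then have "dirichlet_eigenvalue k A \<le> ereal (M * (rayleigh_quotient A (u 0) + e / M))"
        using u0 K(2) nz M by (intro le) auto
      then show "dirichlet_eigenvalue k A \<le> ereal (M * rayleigh_quotient A (u 0)) + ereal e"
        using M by (simp add: distrib_left)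
    qed
    then have "dirichlet_eigenvalue k A / ereal M \<le> ereal (rayleigh_quotient A (u 0))"
      using M by (subst ereal_divide_le_pos) auto
    also have "\<dots> \<le> (SUP w\<in>{w \<in> K. \<not> (AE x in lebesgue. w x = 0)}. ereal (rayleigh_quotient A w))"
      using u0 nz by (intro SUP_upper) auto
    finally show "dirichlet_eigenvalue k A / ereal M
        \<le> (SUP w\<in>{w \<in> K. \<not> (AE x in lebesgue. w x = 0)}. ereal (rayleigh_quotient A w))" .
  qed
  then show ?thesis using M by (subst (asm) ereal_divide_le_pos) auto
qed

theorem theoremB:
  fixes k :: nat
  assumes "2 \<le> CARD('n::finite)" and "1 \<le> k"
  shows "\<exists>M::real. \<forall>A::(real ^ 'n) set. quasi_open A \<longrightarrow>
           dirichlet_eigenvalue k A \<le> ereal M * dirichlet_eigenvalue 1 A"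
proof -
  define c where "c = bump_height k"
  define M where "M = 16 * (real k)\<^sup>2 * (1 + 4 * (8 * pi * sqrt (2 * real k) / c)\<^sup>2) / c\<^sup>2"
  have "c > 0" using bump_height_pos[OF assms(2)] by (simp add: c_def)
  then have "M > 0" unfolding M_def using assms(2) by (intro divide_pos_pos mult_pos_pos) (auto simp: add_pos_nonneg)
  then have "dirichlet_eigenvalue k A \<le> ereal M * dirichlet_eigenvalue 1 A" for A :: "(real ^ 'n) set"
    using dirichlet_eigenvalue_le_rayleigh[OF assms(2)]
    by (intro dirichlet_eigenvalue_le_first) (auto simp: M_def c_def)
  then show ?thesis by blast
qed

end
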